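(* Let $T>0$, $\kappa>0$ and $1<\alpha<\frac32$. Let $$X=H^{1}(0,T;\dot H^{-\frac{\alpha}{2}}(\mathbb R))\cap L^{2}(0,T;L^{2}(\mathbb R))\cap L^{2}(0,T;\dot H^{-\alpha}(\mathbb R)),$$ and let $f\in X$ with $f(0)=f(T)$ in $\dot H^{-\frac{\alpha}{2}}(\mathbb R)$. Then there exists a unique $T$-periodic strong solution $$u\in H^{1}(0,T;H^{\frac{\alpha}{2}}(\mathbb R))\cap L^{2}(0,T;\dot H^{\alpha}(\mathbb R))$$ of the linear problem $$u_t+\kappa\Lambda^{\alpha}u=f,\qquad (t,x)\in[0,T]\times\mathbb R,$$ satisfying $u(0)=u(T)$ in $H^{\frac{\alpha}{2}}(\mathbb R)$ and $$\|u\|_{H^{1}(0,T;H^{\frac{\alpha}{2}}(\mathbb R))}+\|\Lambda^{\alpha}u\|_{L^{2}(0,T;L^{2}(\mathbb R))}\le\left(1+\frac1\kappa\right)\|f\|_{X}.$$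
   Context: Functions are defined for $t\in[0,T]$, $x\in\mathbb R$. The operator $\Lambda^{s}=(-\partial_{xx})^{s/2}$ is the Fourier multiplier in $x$ given by $\widehat{\Lambda^{s}u}(\xi)=|\xi|^{s}\hat u(\xi)$. $H^{s}(\mathbb R)$ and $\dot H^{s}(\mathbb R)$ are the nonhomogeneous and homogeneous $L^2$-based Sobolev spaces, with $\|g\|_{\dot H^{s}}=\||\xi|^{s}\hat g\|_{L^{2}}$ (Fourier transform normalized to be an $L^2$-isometry). For a Banach space $B$, $H^{1}(0,T;B)$ is the space of $g\in L^{2}(0,T;B)$ with weak derivative $g_t\in L^{2}(0,T;B)$; such $g$ have continuous representatives $[0,T]\to B$, so the values $g(0),g(T)$ make sense. Norms: $\|g\|_{H^1(0,T;B)}=\|g\|_{L^2(0,T;B)}+\|g_t\|_{L^2(0,T;B)}$, where for $B=H^{\alpha/2}(\mathbb R)$ the norm $\|u\|_{H^{1}(0,T;H^{\alpha/2})}$ is $\|u\|_{L^2L^2}+\|\Lambda^{\alpha/2}u\|_{L^2L^2}+\|u_t\|_{L^2L^2}+\|\Lambda^{\alpha/2}u_t\|_{L^2L^2}$ with $L^2L^2=L^2(0,T;L^2(\mathbb R))$. The norm of $X$ is the sum of the norms of the three spaces: $\|f\|_X=\|f\|_{H^{1}(0,T;\dot H^{-\alpha/2})}+\|f\|_{L^{2}(0,T;L^{2})}+\|f\|_{L^{2}(0,T;\dot H^{-\alpha})}$. A $T$-periodic strong solution is a function $u$ in the stated class satisfying the equation almost everywhere in $(0,T)\times\mathbb R$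 (i.e. as an identity in $L^2(0,T;L^2(\mathbb R))$) together with $u(0)=u(T)$. *)

theory Defs
  imports "HOL-Analysis.Analysis"
begin

section \<open>Square-integrable functions\<close>

text \<open>
  Functions are complex-valued.  Elements of $L^2$-type spaces are represented by measurable
  functions, to be read modulo equality almost everywhere.
\<close>

definition sq_integrable :: "'a measure \<Rightarrow> ('a \<Rightarrow> complex) \<Rightarrow> bool" where
  "sq_integrable M h \<longleftrightarrow> h \<in> borel_measurable M \<and> integrable M (\<lambda>x. (cmod (h x))\<^sup>2)"

definition L2_norm :: "'a measure \<Rightarrow> ('a \<Rightarrow> complex) \<Rightarrow> real" where
  "L2_norm M h = sqrt (\<integral>x. (cmod (h x))\<^sup>2 \<partial>M)"

abbreviation time :: "real \<Rightarrow> real measure" where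
  "time T \<equiv> restrict_space lborel {0<..<T}"

abbreviation strip :: "real \<Rightarrow> (real \<times> real) measure" where
  "strip T \<equiv> time T \<Otimes>\<^sub>M lborel"

text \<open>
  $L^2(0,T;L^2(\mathbb R)) = L^2((0,T)\times\mathbb R)$; time is always the first argument.
\<close>

definition L2_L2 :: "real \<Rightarrow> (real \<Rightarrow> real \<Rightarrow> complex) set" where
  "L2_L2 T = {u. sq_integrable (strip T) (case_prod u)}"

definition L2_L2_norm :: "real \<Rightarrow> (real \<Rightarrow> real \<Rightarrow> complex) \<Rightarrow> real" where
  "L2_L2_norm T u = L2_norm (strip T) (case_prod u)"


section \<open>The Fourier transform on $L^2$ and the operator $\Lambda^s$\<close>

text \<open>
  \<open>is_fourier g h\<close>: the unitary Fourier transform of \<open>g\<close> is \<open>h\<close>, i.e. the truncated integrals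
  $(2\pi)^{-1/2}\int_{-R}^R g(x)e^{-ix\xi}\,dx$ converge to $h$ in $L^2$ as $R\to\infty$.
\<close>

definition is_fourier :: "(real \<Rightarrow> complex) \<Rightarrow> (real \<Rightarrow> complex) \<Rightarrow> bool" where
  "is_fourier g h \<longleftrightarrow> sq_integrable lborel g \<and> sq_integrable lborel h \<and>
     ((\<lambda>R. \<integral>\<^sup>+ \<xi>. ennreal ((cmod (h \<xi> -
         complex_of_real (1 / sqrt (2 * pi)) * (LBINT x:{-R..R}. g x * cis (- (x * \<xi>)))))\<^sup>2) \<partial>lborel)
       \<longlongrightarrow> 0) at_top"

text \<open>The Fourier transform in the space variable, as a jointly measurable function of $(t,\xi)$.\<close>

definition is_fourier_x ::
    "real \<Rightarrow> (real \<Rightarrow> real \<Rightarrow> complex) \<Rightarrow> (real \<Rightarrow> real \<Rightarrow> complex) \<Rightarrow> bool" where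
  "is_fourier_x T u U \<longleftrightarrow>
     case_prod u \<in> borel_measurable (strip T) \<and> case_prod U \<in> borel_measurable (strip T) \<and>
     (AE t in time T. is_fourier (u t) (U t))"

definition fourier_x :: "real \<Rightarrow> (real \<Rightarrow> real \<Rightarrow> complex) \<Rightarrow> real \<Rightarrow> real \<Rightarrow> complex" where
  "fourier_x T u = (SOME U. is_fourier_x T u U)"

text \<open>
  \<open>weighted w U\<close> multiplies by a Fourier multiplier.  The homogeneous weight is
  $|\xi|^s$ except possibly at the single point $\xi=0$, where \<open>0 powr s = 0\<close>.
\<close>

definition weighted ::
    "(real \<Rightarrow> real) \<Rightarrow> (real \<Rightarrow> real \<Rightarrow> complex) \<Rightarrow> real \<Rightarrow> real \<Rightarrow> complex" where
  "weighted w U t \<xi> = complex_of_real (w \<xi>) * U t \<xi>"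

definition hom_weight :: "real \<Rightarrow> real \<Rightarrow> real" where
  "hom_weight s \<xi> = \<bar>\<xi>\<bar> powr s"

definition inhom_weight :: "real \<Rightarrow> real \<Rightarrow> real" where
  "inhom_weight s \<xi> = (1 + \<xi>\<^sup>2) powr (s / 2)"

definition is_Lambda ::
    "real \<Rightarrow> real \<Rightarrow> (real \<Rightarrow> real \<Rightarrow> complex) \<Rightarrow> (real \<Rightarrow> real \<Rightarrow> complex) \<Rightarrow> bool" where
  "is_Lambda T s u v \<longleftrightarrow>
     (\<exists>U. is_fourier_x T u U \<and> is_fourier_x T v (weighted (hom_weight s) U))"

definition Lambda :: "real \<Rightarrow> real \<Rightarrow> (real \<Rightarrow> real \<Rightarrow> complex) \<Rightarrow> real \<Rightarrow> real \<Rightarrow> complex" where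
  "Lambda T s u = (SOME v. is_Lambda T s u v)"


section \<open>Weak time derivatives\<close>

definition test_functions :: "real \<Rightarrow> (real \<Rightarrow> real) set" where
  "test_functions T = {\<theta>. (\<forall>n t. (deriv ^^ n) \<theta> field_differentiable at t) \<and>
     (\<exists>a b. 0 < a \<and> b < T \<and> (\<forall>t. t \<notin> {a..b} \<longrightarrow> \<theta> t = 0))}"

text \<open>
  \<open>is_weak_dt T u v\<close>: $\int_0^T\theta'(t)\,u(t)\,dt=-\int_0^T\theta(t)\,v(t)\,dt$ for all
  $\theta\in C_c^\infty(0,T)$.  For $u,v\in L^2(0,T;B)$ with $B$ a weighted $L^2$ space, the Bochner
  integrals in $B$ are computed pointwise almost everywhere in the second variable, and the
  integrability required here is automatic.  The second variable is $x$ or $\xi$.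
\<close>

definition is_weak_dt ::
    "real \<Rightarrow> (real \<Rightarrow> real \<Rightarrow> complex) \<Rightarrow> (real \<Rightarrow> real \<Rightarrow> complex) \<Rightarrow> bool" where
  "is_weak_dt T u v \<longleftrightarrow>
     case_prod u \<in> borel_measurable (strip T) \<and> case_prod v \<in> borel_measurable (strip T) \<and>
     (AE x in lborel. integrable (time T) (\<lambda>t. u t x) \<and> integrable (time T) (\<lambda>t. v t x)) \<and>
     (\<forall>\<theta>\<in>test_functions T. AE x in lborel.
        (\<integral>t. complex_of_real (deriv \<theta> t) * u t x \<partial>time T) =
        - (\<integral>t. complex_of_real (\<theta> t) * v t x \<partial>time T))"

definition weak_dt :: "real \<Rightarrow> (real \<Rightarrow> real \<Rightarrow> complex) \<Rightarrow> real \<Rightarrow> real \<Rightarrow> complex" where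
  "weak_dt T u = (SOME v. is_weak_dt T u v)"


section \<open>Sobolev-valued functions of time\<close>

text \<open>
  The sets \<open>L2_Hdot\<close> and \<open>H1_Hdot\<close> contain those members of $L^2(0,T;\dot H^s)$ and
  $H^1(0,T;\dot H^s)$ whose values at almost every time are $L^2$ functions; below they only
  occur intersected with $L^2(0,T;L^2)$.  The time derivative of such a function need
  not take values in $L^2$: for $s<1/2$ an element of $\dot H^s$ is identified with its Fourier
  transform, a function in $L^2(|\xi|^{2s}d\xi)$, and the weak derivative is taken there.
\<close>

definition L2_Hdot :: "real \<Rightarrow> real \<Rightarrow> (real \<Rightarrow> real \<Rightarrow> complex) set" where
  "L2_Hdot T s = {u. \<exists>U. is_fourier_x T u U \<and> weighted (hom_weight s) U \<in> L2_L2 T}"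

definition L2_Hdot_norm :: "real \<Rightarrow> real \<Rightarrow> (real \<Rightarrow> real \<Rightarrow> complex) \<Rightarrow> real" where
  "L2_Hdot_norm T s u = L2_L2_norm T (weighted (hom_weight s) (fourier_x T u))"

definition H1_Hdot :: "real \<Rightarrow> real \<Rightarrow> (real \<Rightarrow> real \<Rightarrow> complex) set" where
  "H1_Hdot T s = {u. \<exists>U V. is_fourier_x T u U \<and> is_weak_dt T U V \<and>
     weighted (hom_weight s) U \<in> L2_L2 T \<and> weighted (hom_weight s) V \<in> L2_L2 T}"

definition H1_Hdot_norm :: "real \<Rightarrow> real \<Rightarrow> (real \<Rightarrow> real \<Rightarrow> complex) \<Rightarrow> real" where
  "H1_Hdot_norm T s u = L2_Hdot_norm T s u +
     L2_L2_norm T (weighted (hom_weight s) (weak_dt T (fourier_x T u)))"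

definition L2_H :: "real \<Rightarrow> real \<Rightarrow> (real \<Rightarrow> real \<Rightarrow> complex) set" where
  "L2_H T s = {u. \<exists>U. is_fourier_x T u U \<and> weighted (inhom_weight s) U \<in> L2_L2 T}"

definition H1_H :: "real \<Rightarrow> real \<Rightarrow> (real \<Rightarrow> real \<Rightarrow> complex) set" where
  "H1_H T s = {u. u \<in> L2_H T s \<and> (\<exists>v. is_weak_dt T u v \<and> v \<in> L2_H T s)}"

definition H1_H_norm :: "real \<Rightarrow> real \<Rightarrow> (real \<Rightarrow> real \<Rightarrow> complex) \<Rightarrow> real" where
  "H1_H_norm T s u =
     L2_L2_norm T u + L2_L2_norm T (Lambda T s u) +
     L2_L2_norm T (weak_dt T u) + L2_L2_norm T (Lambda T s (weak_dt T u))"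


section \<open>Values at the end points\<close>

text \<open>
  \<open>C\<close> is the Fourier transform of the continuous representative on $[0,T]$ of the function with
  Fourier transform \<open>U\<close>; continuity is with respect to the Sobolev norm with weight \<open>w\<close>.
\<close>

definition is_continuous_rep ::
    "real \<Rightarrow> (real \<Rightarrow> real) \<Rightarrow> (real \<Rightarrow> real \<Rightarrow> complex) \<Rightarrow> (real \<Rightarrow> real \<Rightarrow> complex) \<Rightarrow> bool" where
  "is_continuous_rep T w U C \<longleftrightarrow>
     (AE t in time T. AE \<xi> in lborel. C t \<xi> = U t \<xi>) \<and>
     (\<forall>t\<in>{0..T}. sq_integrable lborel (weighted w C t)) \<and>
     (\<forall>t\<in>{0..T}. ((\<lambda>r. L2_norm lborel (\<lambda>\<xi>. weighted w C r \<xi> - weighted w C t \<xi>)) \<longlongrightarrow> 0)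
        (at t within {0..T}))"

definition equal_end_values :: "real \<Rightarrow> (real \<Rightarrow> real) \<Rightarrow> (real \<Rightarrow> real \<Rightarrow> complex) \<Rightarrow> bool" where
  "equal_end_values T w u \<longleftrightarrow>
     (\<exists>C. is_continuous_rep T w (fourier_x T u) C \<and> (AE \<xi> in lborel. C 0 \<xi> = C T \<xi>))"


section \<open>Data space and periodic strong solutions\<close>

definition X_space :: "real \<Rightarrow> real \<Rightarrow> (real \<Rightarrow> real \<Rightarrow> complex) set" where
  "X_space T \<alpha> = H1_Hdot T (- \<alpha> / 2) \<inter> L2_L2 T \<inter> L2_Hdot T (- \<alpha>)"

definition X_norm :: "real \<Rightarrow> real \<Rightarrow> (real \<Rightarrow> real \<Rightarrow> complex) \<Rightarrow> real" where
  "X_norm T \<alpha> f = H1_Hdot_norm T (- \<alpha> / 2) f + L2_L2_norm T f + L2_Hdot_norm T (- \<alpha>) f"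

definition periodic_strong_solution ::
    "real \<Rightarrow> real \<Rightarrow> real \<Rightarrow> (real \<Rightarrow> real \<Rightarrow> complex) \<Rightarrow> (real \<Rightarrow> real \<Rightarrow> complex) \<Rightarrow> bool" where
  "periodic_strong_solution T \<kappa> \<alpha> f u \<longleftrightarrow>
     u \<in> H1_H T (\<alpha> / 2) \<inter> L2_Hdot T \<alpha> \<and>
     (AE (t, x) in strip T. weak_dt T u t x + complex_of_real \<kappa> * Lambda T \<alpha> u t x = f t x) \<and>
     equal_end_values T (inhom_weight (\<alpha> / 2)) u"

end

theory Submission
  imports Defs "HOL-Probability.Probability"
begin

text \<open>
  On the Fourier side the problem is, for each frequency \<open>\<xi>\<close>, the periodic scalar equation
  $\partial_t U + m U = F$ with $m=\kappa|\xi|^\alpha>0$, which has an explicit unique solution.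
  Multiplying by the conjugate of \<open>U\<close> and using periodicity gives
  $\|\partial_t U\|^2+m^2\|U\|^2=\|F\|^2$ in $L^2(0,T)$, hence the bounds on $U$, $|\xi|^{\alpha/2}U$,
  $|\xi|^{\alpha}U$ and $\partial_t U$; since \<open>F\<close> is periodic too, $\partial_t U$ solves the same
  equation with datum $\partial_t F$, which bounds $|\xi|^{\alpha/2}\partial_t U$.  The five bounds
  add up to the factor $1+1/\kappa$.

  Plancherel and inversion rest on the Gaussian-damped transform: on $L^1\cap L^2$ it is convolution
  with a Gaussian kernel, so the transform is an $L^2$ contraction by Schur's test, and letting the
  damping tend to zero, tested on intervals, gives the inversion formula and with it the isometry.
\<close>

section \<open>Squared norms\<close>

text \<open>The definitions pick transforms, weak derivatives and \<open>Lambda\<close> by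
  \<open>SOME\<close>, so every object is known only up to a null set, and the null set in
  \<open>is_weak_dt\<close> may depend on the test function. Passing to one fixed frequency
  therefore needs countably many test functions that still determine a weak derivative; smooth bumps
  with rational end points are built for this, and with them the transform at almost every \<xi>
  becomes a constant plus an integral in time. In that form calculus in time reduces to one product
  rule, and equality of end values says that the derivative has integral zero over the period. The
  time derivative of the transform of f is square integrable only after weighting by
  |\<xi>|^(-\<alpha>/2), so estimates are made at fixed \<xi> \<noteq> 0 and integrated with weights
  afterwards. With a, b, c, d the four parts of \<open>X_norm\<close> in order, the bounds sum to (a
  + b + c + d)/\<kappa> + c. Squared norms \<open>nsq\<close> take values in \<open>ennreal\<close>,
  so that Tonelli and Fatou apply before finiteness is known. The transform of the solution inherits
  conjugate symmetry, which makes u real when f is.\<close>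

definition nsq :: "'a measure \<Rightarrow> ('a \<Rightarrow> complex) \<Rightarrow> ennreal" where
  "nsq M h = (\<integral>\<^sup>+x. ennreal ((cmod (h x))\<^sup>2) \<partial>M)"

lemma sq_integrable_iff_nsq:
  "sq_integrable M h \<longleftrightarrow> h \<in> borel_measurable M \<and> nsq M h < \<infinity>"
  unfolding sq_integrable_def nsq_def by (auto simp: integrable_iff_bounded)

lemma sq_integrableD:
  assumes "sq_integrable M h"
  shows "h \<in> borel_measurable M" "nsq M h < \<infinity>"
  using assms by (auto simp: sq_integrable_iff_nsq)

lemma L2_norm_eq_nsq:
  assumes "h \<in> borel_measurable M"
  shows "L2_norm M h = sqrt (enn2real (nsq M h))"
  unfolding L2_norm_def nsq_def by (subst integral_eq_nn_integral) (use assms in auto)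

lemma ennreal_L2_norm_sq:
  assumes "sq_integrable M h"
  shows "ennreal ((L2_norm M h)\<^sup>2) = nsq M h"
  using sq_integrableD[OF assms] by (simp add: L2_norm_eq_nsq)

lemma nsq_cong_AE:
  assumes "AE x in M. g x = h x"
  shows "nsq M g = nsq M h"
  unfolding nsq_def using assms by (intro nn_integral_cong_AE) auto

lemma nsq_eq_0_iff:
  assumes "h \<in> borel_measurable M"
  shows "nsq M h = 0 \<longleftrightarrow> (AE x in M. h x = 0)"
  unfolding nsq_def using assms by (subst nn_integral_0_iff_AE) (auto simp: ennreal_eq_0_iff)

lemma nsq_mono:
  assumes "AE x in M. cmod (g x) \<le> cmod (h x)"
  shows "nsq M g \<le> nsq M h"
  unfolding nsq_def using assms by (intro nn_integral_mono_AE) (auto intro: power_mono)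

lemma nsq_cmult:
  assumes "h \<in> borel_measurable M"
  shows "nsq M (\<lambda>x. c * h x) = ennreal ((cmod c)\<^sup>2) * nsq M h"
  unfolding nsq_def
  by (subst nn_integral_cmult[symmetric]) (use assms in \<open>auto simp: norm_mult power_mult_distrib ennreal_mult\<close>)

text \<open>This is Young's inequality, read off from (d|a| - |b|)^2 / d \<ge> 0. The free parameter
  d brings the constant in front of the first term as close to 1 as wanted, which
  \<open>nsq_limit_le\<close> exploits.\<close>

lemma cmod_add_sq_le:
  assumes "d > 0"
  shows "(cmod (a + b))\<^sup>2 \<le> (1 + d) * (cmod a)\<^sup>2 + (1 + 1 / d) * (cmod b)\<^sup>2"
proof -
  have "(cmod (a + b))\<^sup>2 \<le> (cmod a + cmod b)\<^sup>2"
    by (intro power_mono norm_triangle_ineq) auto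
  also have "\<dots> \<le> (1 + d) * (cmod a)\<^sup>2 + (1 + 1 / d) * (cmod b)\<^sup>2"
  proof -
    have "0 \<le> (d * cmod a - cmod b)\<^sup>2 / d" using assms by simp
    also have "\<dots> = d * (cmod a)\<^sup>2 - 2 * cmod a * cmod b + (1 / d) * (cmod b)\<^sup>2"
      using assms by (simp add: power2_eq_square field_simps)
    finally show ?thesis by (simp add: power2_eq_square algebra_simps)
  qed
  finally show ?thesis .
qed

lemma nsq_add_le_weighted:
  assumes [measurable]: "g \<in> borel_measurable M" "h \<in> borel_measurable M" and d: "d > 0"
  shows "nsq M (\<lambda>x. g x + h x) \<le> ennreal (1 + d) * nsq M g + ennreal (1 + 1 / d) * nsq M h"
proof -
  have "nsq M (\<lambda>x. g x + h x)
     \<le> (\<integral>\<^sup>+x. ennreal (1 + d) * ennreal ((cmod (g x))\<^sup>2) + ennreal (1 + 1 / d) * ennreal ((cmod (h x))\<^sup>2) \<partial>M)"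
    unfolding nsq_def
  proof (intro nn_integral_mono)
    fix x
    have "ennreal ((cmod (g x + h x))\<^sup>2) \<le> ennreal ((1 + d) * (cmod (g x))\<^sup>2 + (1 + 1 / d) * (cmod (h x))\<^sup>2)"
      by (intro ennreal_leI cmod_add_sq_le d)
    then show "ennreal ((cmod (g x + h x))\<^sup>2) \<le> ennreal (1 + d) * ennreal ((cmod (g x))\<^sup>2) + ennreal (1 + 1 / d) * ennreal ((cmod (h x))\<^sup>2)"
      using d by (simp add: ennreal_mult)
  qed
  also have "\<dots> = ennreal (1 + d) * nsq M g + ennreal (1 + 1 / d) * nsq M h"
    unfolding nsq_def by (simp add: nn_integral_add nn_integral_cmult)
  finally show ?thesis .
qed

lemma nsq_add_le:
  assumes "g \<in> borel_measurable M" "h \<in> borel_measurable M"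
  shows "nsq M (\<lambda>x. g x + h x) \<le> 2 * nsq M g + 2 * nsq M h"
  using nsq_add_le_weighted[OF assms, of 1] by simp

lemma nsq_diff_triangle:
  assumes [measurable]: "f \<in> borel_measurable M" "g \<in> borel_measurable M" "h \<in> borel_measurable M"
  shows "nsq M (\<lambda>x. f x - h x) \<le> 2 * nsq M (\<lambda>x. f x - g x) + 2 * nsq M (\<lambda>x. g x - h x)"
  using nsq_add_le[of "\<lambda>x. f x - g x" M "\<lambda>x. g x - h x"] by simp

lemma nsq_diff_commute: "nsq M (\<lambda>x. f x - g x) = nsq M (\<lambda>x. g x - f x)"
  by (simp add: nsq_def norm_minus_commute)

lemma sq_integrable_add:
  assumes "sq_integrable M g" "sq_integrable M h"
  shows "sq_integrable M (\<lambda>x. g x + h x)"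
  using assms le_less_trans[OF nsq_add_le[of g M h]]
  by (auto simp: sq_integrable_iff_nsq ennreal_mult_less_top)

lemma sq_integrable_cmult:
  assumes "sq_integrable M h"
  shows "sq_integrable M (\<lambda>x. c * h x)"
  using assms by (auto simp: sq_integrable_iff_nsq nsq_cmult ennreal_mult_less_top)

lemma sq_integrable_diff:
  assumes "sq_integrable M g" "sq_integrable M h"
  shows "sq_integrable M (\<lambda>x. g x - h x)"
  using sq_integrable_add[OF assms(1) sq_integrable_cmult[OF assms(2), of "-1"]] by simp

lemma sq_integrable_bound:
  assumes "sq_integrable M h" "g \<in> borel_measurable M" "AE x in M. cmod (g x) \<le> cmod (h x)"
  shows "sq_integrable M g"
  using assms nsq_mono[OF assms(3)] by (auto simp: sq_integrable_iff_nsq)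

lemma tendsto_0_le_add2:
  fixes f g h :: "'a \<Rightarrow> ennreal"
  assumes "(g \<longlongrightarrow> 0) F" "(h \<longlongrightarrow> 0) F" "eventually (\<lambda>x. f x \<le> 2 * g x + 2 * h x) F"
  shows "(f \<longlongrightarrow> 0) F"
proof -
  have "((\<lambda>x. 2 * g x + 2 * h x) \<longlongrightarrow> 2 * 0 + 2 * 0) F"
    by (intro tendsto_add ennreal_tendsto_cmult assms) auto
  then show ?thesis
    by (intro tendsto_sandwich[OF _ assms(3) tendsto_const]) auto
qed

lemma nsq_limit_unique:
  assumes [measurable]: "h \<in> borel_measurable M" "k \<in> borel_measurable M"
    and meas: "\<And>i. f i \<in> borel_measurable M"
    and F: "F \<noteq> bot"
    and lim: "((\<lambda>i. nsq M (\<lambda>x. f i x - h x)) \<longlongrightarrow> 0) F" "((\<lambda>i. nsq M (\<lambda>x. f i x - k x)) \<longlongrightarrow> 0) F"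
  shows "AE x in M. h x = k x"
proof -
  note [measurable] = meas
  have "((\<lambda>i. nsq M (\<lambda>x. h x - k x)) \<longlongrightarrow> 0) F"
    by (rule tendsto_0_le_add2[OF lim])
       (intro always_eventually allI, subst (2) nsq_diff_commute, intro nsq_diff_triangle; measurable)
  then have "nsq M (\<lambda>x. h x - k x) = 0"
    using F tendsto_const tendsto_unique by blast
  then show ?thesis by (subst (asm) nsq_eq_0_iff) auto
qed

text \<open>Norms pass to the limit with constant exactly 1, although \<open>nsq_add_le\<close> has
  the factor 2: split h into f i + (h - f i) with the weights 1 + d and 1 + 1/d, let i go to the
  limit first and d to 0 afterwards. Contractivity of the transform on all of L2 depends on this
  sharp constant.\<close>

lemma nsq_limit_le:
  assumes [measurable]: "h \<in> borel_measurable M" and meas: "\<And>i. f i \<in> borel_measurable M"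
    and F: "F \<noteq> bot"
    and lim: "((\<lambda>i. nsq M (\<lambda>x. h x - f i x)) \<longlongrightarrow> 0) F"
    and le: "eventually (\<lambda>i. nsq M (f i) \<le> B) F"
  shows "nsq M h \<le> B"
proof (cases "B = top")
  case False
  note [measurable] = meas
  have d: "nsq M h \<le> ennreal (1 + d) * B" if "d > 0" for d
  proof -
    have "((\<lambda>i. ennreal (1 + d) * B + ennreal (1 + 1 / d) * nsq M (\<lambda>x. h x - f i x)) \<longlongrightarrow> ennreal (1 + d) * B + ennreal (1 + 1 / d) * 0) F"
      by (intro tendsto_add tendsto_const ennreal_tendsto_cmult lim) auto
    moreover have "eventually (\<lambda>i. nsq M h \<le> ennreal (1 + d) * B + ennreal (1 + 1 / d) * nsq M (\<lambda>x. h x - f i x)) F"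
      using le
    proof eventually_elim
      case (elim i)
      have "nsq M h \<le> ennreal (1 + d) * nsq M (f i) + ennreal (1 + 1 / d) * nsq M (\<lambda>x. h x - f i x)"
        using nsq_add_le_weighted[of "f i" M "\<lambda>x. h x - f i x" d] that by simp
      also have "\<dots> \<le> ennreal (1 + d) * B + ennreal (1 + 1 / d) * nsq M (\<lambda>x. h x - f i x)"
        by (intro add_mono mult_left_mono elim) auto
      finally show ?case .
    qed
    ultimately show ?thesis
      using tendsto_lowerbound[OF _ _ F] by force
  qed
  \<comment> \<open>The finiteness of B, secured by the case distinction, gives continuity of the
    product in \<open>ennreal\<close>.\<close>
  have "((\<lambda>d. ennreal (1 + d) * B) \<longlongrightarrow> ennreal (1 + 0) * B) (at_right 0)"
    using False
    by (subst (1 2) mult.commute, intro ennreal_tendsto_cmult tendsto_ennrealI tendsto_intros) (auto simp: less_top)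
  moreover have "eventually (\<lambda>d. nsq M h \<le> ennreal (1 + d) * B) (at_right (0::real))"
    using d eventually_at_right_less[of 0] by (auto elim: eventually_mono)
  ultimately show ?thesis
    using tendsto_lowerbound[of _ "ennreal (1 + 0) * B" "at_right (0::real)"] by force
qed auto

text \<open>Riesz-Fischer: a fast subsequence converges pointwise almost everywhere, and Fatou's
  lemma turns the Cauchy property into convergence of the whole sequence to that pointwise
  limit.\<close>

lemma L2_complete:
  assumes meas: "\<And>n. h n \<in> borel_measurable M"
    and cauchy: "\<And>e. e > 0 \<Longrightarrow> \<exists>N. \<forall>m\<ge>N. \<forall>n\<ge>N. nsq M (\<lambda>x. h m x - h n x) \<le> ennreal e"
  obtains k where "k \<in> borel_measurable M" "(\<lambda>n. nsq M (\<lambda>x. h n x - k x)) \<longlonglongrightarrow> 0"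
proof -
  note [measurable] = meas
  have "\<exists>N. \<forall>m\<ge>N. \<forall>n\<ge>N. nsq M (\<lambda>x. h m x - h n x) \<le> ennreal ((1/4)^k)" for k :: nat
    by (rule cauchy) auto
  then obtain N where N: "\<And>k m n. m \<ge> N k \<Longrightarrow> n \<ge> N k \<Longrightarrow> nsq M (\<lambda>x. h m x - h n x) \<le> ennreal ((1/4)^k)"
    by metis
  \<comment> \<open>Summing the thresholds makes r increasing, so that both \<open>r k\<close> and
    \<open>r (Suc k)\<close> lie beyond \<open>N k\<close>; the extra k forces r to tend to
    infinity.\<close>
  define r where "r k = (\<Sum>i\<le>k. N i) + k" for k
  have rN: "r k \<ge> N k" for k
    unfolding r_def by (induction k) auto
  have r_Suc: "r (Suc k) \<ge> N k" for k
    using rN[of k] unfolding r_def by simp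
  have r_ge: "r k \<ge> k" for k unfolding r_def by simp
  \<comment> \<open>The weight 2^k used below is chosen against the bound 4^(-k): the weighted
    squared increments have integrals at most 2^(-k) and hence a finite sum.\<close>
  define D where "D k x = h (r (Suc k)) x - h (r k) x" for k x
  have Dm [measurable]: "D k \<in> borel_measurable M" for k unfolding D_def by measurable
  have "(\<integral>\<^sup>+x. (\<Sum>k. ennreal (2^k * (cmod (D k x))\<^sup>2)) \<partial>M) = (\<Sum>k. \<integral>\<^sup>+x. ennreal (2^k * (cmod (D k x))\<^sup>2) \<partial>M)"
    by (rule nn_integral_suminf) measurable
  also have "\<dots> \<le> (\<Sum>k. ennreal ((1/2)^k))"
  proof (rule suminf_le)
    fix k
    have "(\<integral>\<^sup>+x. ennreal (2^k * (cmod (D k x))\<^sup>2) \<partial>M) = ennreal (2^k) * nsq M (D k)"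
      unfolding nsq_def by (subst nn_integral_cmult[symmetric]) (auto simp: ennreal_mult)
    also have "\<dots> \<le> ennreal (2^k) * ennreal ((1/4)^k)"
      unfolding D_def by (intro mult_left_mono N rN r_Suc) auto
    also have "\<dots> = ennreal ((1/2)^k)"
      by (subst ennreal_mult[symmetric]) (auto simp: power_mult_distrib[symmetric])
    finally show "(\<integral>\<^sup>+x. ennreal (2^k * (cmod (D k x))\<^sup>2) \<partial>M) \<le> ennreal ((1/2)^k)" .
  qed auto
  also have "\<dots> < \<infinity>"
  proof -
    have "(\<Sum>k. ennreal ((1/2)^k)) = ennreal (\<Sum>k. (1/2)^k)"
      by (intro suminf_ennreal2) auto
    then show ?thesis by simp
  qed
  finally have fin: "(\<integral>\<^sup>+x. (\<Sum>k. ennreal (2^k * (cmod (D k x))\<^sup>2)) \<partial>M) \<noteq> \<infinity>" by simp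
  have "AE x in M. (\<Sum>k. ennreal (2^k * (cmod (D k x))\<^sup>2)) \<noteq> \<infinity>"
    by (rule nn_integral_PInf_AE[OF _ fin]) measurable
  then have conv: "AE x in M. convergent (\<lambda>k. h (r k) x)"
  proof eventually_elim
    case (elim x)
    then have s: "summable (\<lambda>k. 2^k * (cmod (D k x))\<^sup>2)"
      by (intro summable_suminf_not_top) auto
    have "summable (\<lambda>k. (1/2)^k + 2^k * (cmod (D k x))\<^sup>2)"
      by (intro summable_add s summable_geometric) auto
    then have "summable (\<lambda>k. D k x)"
    proof (rule summable_comparison_test')
      fix k :: nat assume "k \<ge> 0"
      \<comment> \<open>AM-GM passes from the summable squares to the increments themselves: 2|D|
        \<le> 2^k |D|^2 + 2^(-k).\<close>
      have "0 \<le> (2^k * cmod (D k x) - 1)\<^sup>2" by simp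
      then have "2 * 2^k * cmod (D k x) \<le> 2^k * (2^k * (cmod (D k x))\<^sup>2) + 1"
        by (simp add: power2_eq_square algebra_simps)
      then have "2 * cmod (D k x) \<le> 2^k * (cmod (D k x))\<^sup>2 + 1 / 2^k"
        by (simp add: field_simps)
      moreover have "0 \<le> 2^k * (cmod (D k x))\<^sup>2" "0 \<le> 1 / (2::real)^k" by auto
      ultimately show "norm (D k x) \<le> (1/2)^k + 2^k * (cmod (D k x))\<^sup>2"
        unfolding real_norm_def power_divide power_one by linarith
    qed
    then have "(\<lambda>n. \<Sum>k<n. D k x) \<longlonglongrightarrow> (\<Sum>k. D k x)" by (rule summable_LIMSEQ)
    moreover have "(\<Sum>k<n. D k x) = h (r n) x - h (r 0) x" for n
      unfolding D_def by (rule sum_lessThan_telescope)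
    ultimately have "(\<lambda>n. (h (r n) x - h (r 0) x) + h (r 0) x) \<longlonglongrightarrow> (\<Sum>k. D k x) + h (r 0) x"
      by (intro tendsto_add) auto
    then show ?case by (auto simp: convergent_def)
  qed
  define k where "k x = lim (\<lambda>j. h (r j) x)" for x
  have km [measurable]: "k \<in> borel_measurable M" unfolding k_def by measurable
  have lim: "AE x in M. (\<lambda>j. h (r j) x) \<longlonglongrightarrow> k x"
    using conv unfolding k_def by eventually_elim (simp add: convergent_LIMSEQ_iff)
  have "(\<lambda>n. nsq M (\<lambda>x. h n x - k x)) \<longlonglongrightarrow> 0"
  proof (rule tendsto_0_if_Limsup_eq_0_ennreal[OF antisym])
    show "limsup (\<lambda>n. nsq M (\<lambda>x. h n x - k x)) \<le> 0"
    proof (rule ennreal_le_epsilon)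
      fix e :: real assume e: "e > 0"
      from cauchy[OF e] obtain K where K: "\<And>m n. m \<ge> K \<Longrightarrow> n \<ge> K \<Longrightarrow> nsq M (\<lambda>x. h m x - h n x) \<le> ennreal e"
        by auto
      \<comment> \<open>For fixed n the integrand is the pointwise limit along r, and Fatou's lemma
        keeps the Cauchy bound e.\<close>
      have "nsq M (\<lambda>x. h n x - k x) \<le> ennreal e" if n: "n \<ge> K" for n
      proof -
        have "nsq M (\<lambda>x. h n x - k x) = (\<integral>\<^sup>+x. liminf (\<lambda>j. ennreal ((cmod (h n x - h (r j) x))\<^sup>2)) \<partial>M)"
          unfolding nsq_def
        proof (rule nn_integral_cong_AE)
          show "AE x in M. ennreal ((cmod (h n x - k x))\<^sup>2) = liminf (\<lambda>j. ennreal ((cmod (h n x - h (r j) x))\<^sup>2))"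
            using lim
          proof eventually_elim
            case (elim x)
            have "(\<lambda>j. ennreal ((cmod (h n x - h (r j) x))\<^sup>2)) \<longlonglongrightarrow> ennreal ((cmod (h n x - k x))\<^sup>2)"
              by (intro tendsto_ennrealI tendsto_intros elim)
            then show ?case using lim_imp_Liminf[OF sequentially_bot] by metis
          qed
        qed
        also have "\<dots> \<le> liminf (\<lambda>j. nsq M (\<lambda>x. h n x - h (r j) x))"
          unfolding nsq_def by (rule nn_integral_liminf) measurable
        also have "\<dots> \<le> ennreal e"
        proof (rule Liminf_le)
          show "\<forall>\<^sub>F j in sequentially. nsq M (\<lambda>x. h n x - h (r j) x) \<le> ennreal e"
            using eventually_ge_at_top[of K]
            by eventually_elim (intro K n order_trans[OF _ r_ge])
        qed auto
        finally show ?thesis .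
      qed
      then have "limsup (\<lambda>n. nsq M (\<lambda>x. h n x - k x)) \<le> ennreal e"
        by (intro Limsup_bounded) (auto simp: eventually_sequentially)
      then show "limsup (\<lambda>n. nsq M (\<lambda>x. h n x - k x)) \<le> 0 + ennreal e" by simp
    qed
  qed auto
  with km that show ?thesis by blast
qed

section \<open>Functions with vanishing integrals over intervals\<close>

text \<open>Open intervals form an intersection-stable generator of the Borel sets, so a
  Dynkin-system induction spreads the hypothesis to every Borel set; a density with all set
  integrals zero vanishes almost everywhere.\<close>

lemma AE_zero_if_interval_integrals_zero:
  fixes E :: "real \<Rightarrow> complex"
  assumes int: "integrable lborel E"
    and zero: "\<And>a b. a < b \<Longrightarrow> (LBINT x:{a<..<b}. E x) = 0"
  shows "AE x in lborel. E x = 0"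
proof (rule sigma_finite_measure.density_zero[OF sigma_finite_lborel int])
  note [measurable] = borel_measurable_integrable[OF int]
  have set_int: "set_integrable lborel A E" if "A \<in> sets borel" for A
    unfolding set_integrable_def using int that by (intro integrable_mult_indicator) auto
  have sets_eq: "sets borel = sigma_sets UNIV (range (\<lambda>(a, b). {a<..<b::real}))"
    by (subst borel_eq_box) (simp add: case_prod_beta)
  \<comment> \<open>The complement step of the induction needs the integral over the whole line,
    which is not among the given intervals; it is the limit over (-n, n).\<close>
  have total: "(LBINT x. E x) = 0"
  proof -
    have "(\<lambda>n. LBINT x:{- real n<..<real n}. E x) \<longlonglongrightarrow> (LBINT x. E x)"
      unfolding set_lebesgue_integral_def
    proof (rule integral_dominated_convergence[where w = "\<lambda>x. norm (E x)"])
      show "AE x in lborel. (\<lambda>n. indicat_real {- real n<..<real n} x *\<^sub>R E x) \<longlonglongrightarrow> E x"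
      proof (intro AE_I2 tendsto_eventually)
        fix x :: real
        obtain m where "\<bar>x\<bar> < real m" using reals_Archimedean2 by blast
        then show "\<forall>\<^sub>F n in sequentially. indicat_real {- real n<..<real n} x *\<^sub>R E x = E x"
          unfolding eventually_sequentially by (intro exI[of _ m]) (auto simp: indicator_def)
      qed
    qed (use int in \<open>auto simp: indicator_def\<close>)
    moreover have "(LBINT x:{- real n<..<real n}. E x) = 0" for n
      using zero[of "- real n" "real n"] by (cases "n = 0") (auto simp: set_lebesgue_integral_def)
    ultimately show ?thesis by (simp add: LIMSEQ_const_iff)
  qed
  fix A :: "real set" assume "A \<in> sets lborel"
  then have A: "A \<in> sigma_sets UNIV (range (\<lambda>(a, b). {a<..<b::real}))"
    by (simp add: sets_eq)
  have "Int_stable (range (\<lambda>(a, b). {a<..<b::real}))" "range (\<lambda>(a, b). {a<..<b::real}) \<subseteq> Pow UNIV"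
    by (auto simp: Int_stable_def)
  from this A show "(LBINT x:A. E x) = 0"
  proof (induction rule: sigma_sets_induct_disjoint)
    case (basic A)
    then obtain a b where "A = {a<..<b}" by auto
    then show ?case using zero[of a b] by (cases "a < b") (auto simp: set_lebesgue_integral_def)
  next
    case empty
    show ?case by (simp add: set_lebesgue_integral_def)
  next
    case (compl A)
    then have [measurable]: "A \<in> sets borel" by (simp flip: sets_eq)
    have "(LBINT x:UNIV - A. E x) = (LBINT x. E x - indicat_real A x *\<^sub>R E x)"
      unfolding set_lebesgue_integral_def by (intro Bochner_Integration.integral_cong) (auto simp: indicator_def)
    also have "\<dots> = (LBINT x. E x) - (LBINT x:A. E x)"
      unfolding set_lebesgue_integral_def
      using set_int[of A] by (intro Bochner_Integration.integral_diff int) (simp add: set_integrable_def)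
    finally show ?case using total compl by simp
  next
    case (union A)
    then have [measurable]: "A i \<in> sets borel" for i by (auto simp flip: sets_eq)
    have UA: "(\<Union>i. A i) \<in> sets borel" by measurable
    have "(LBINT x:(\<Union>i. A i). E x) = (\<Sum>i. (LBINT x:A i. E x))"
      by (rule lebesgue_integral_countable_add)
         (use union set_int UA in \<open>auto simp: disjoint_family_on_def\<close>)
    then show ?case by (simp add: union)
  qed
qed

section \<open>Cauchy-Schwarz and pairings of square-integrable functions\<close>

text \<open>No integrability is assumed: the Bochner integral of a non-integrable function is 0 by
  convention.\<close>

lemma cmod_integral_le_nn_integral:
  fixes f :: "'a \<Rightarrow> complex"
  shows "ennreal (cmod (\<integral>x. f x \<partial>M)) \<le> (\<integral>\<^sup>+x. ennreal (cmod (f x)) \<partial>M)"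
  using integral_norm_bound_ennreal[of M f] by (cases "integrable M f") (auto simp: not_integrable_integral_eq)

lemma nn_integral_mult_sq_le:
  assumes [measurable]: "f \<in> borel_measurable M" "g \<in> borel_measurable M"
  shows "(\<integral>\<^sup>+x. ennreal (cmod (f x * g x)) \<partial>M)\<^sup>2 \<le> nsq M f * nsq M g"
proof -
  have "(\<integral>\<^sup>+x. ennreal (cmod (f x * g x)) \<partial>M)\<^sup>2 = (\<integral>\<^sup>+x. ennreal (cmod (f x)) * ennreal (cmod (g x)) \<partial>M)\<^sup>2"
    by (simp add: norm_mult ennreal_mult)
  also have "\<dots> \<le> (\<integral>\<^sup>+x. ennreal (cmod (f x)) ^ 2 \<partial>M) * (\<integral>\<^sup>+x. ennreal (cmod (g x)) ^ 2 \<partial>M)"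
    by (rule Cauchy_Schwarz_nn_integral) measurable
  finally show ?thesis by (simp add: nsq_def ennreal_power)
qed

lemma integrable_mult_sq_integrable:
  assumes "sq_integrable M f" "sq_integrable M g"
  shows "integrable M (\<lambda>x. f x * g x)"
proof -
  note [measurable] = sq_integrableD(1)[OF assms(1)] sq_integrableD(1)[OF assms(2)]
  have "(\<integral>\<^sup>+x. ennreal (cmod (f x * g x)) \<partial>M)\<^sup>2 < \<infinity>"
    using assms by (intro le_less_trans[OF nn_integral_mult_sq_le]) (auto simp: sq_integrable_iff_nsq ennreal_mult_less_top)
  then show ?thesis by (simp add: integrable_iff_bounded power_less_top_ennreal)
qed

lemma cmod_integral_mult_sq_le:
  assumes "f \<in> borel_measurable M" "g \<in> borel_measurable M"
  shows "ennreal ((cmod (\<integral>x. f x * g x \<partial>M))\<^sup>2) \<le> nsq M f * nsq M g"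
proof -
  have "ennreal ((cmod (\<integral>x. f x * g x \<partial>M))\<^sup>2) = (ennreal (cmod (\<integral>x. f x * g x \<partial>M)))\<^sup>2"
    by (simp add: ennreal_power)
  also have "\<dots> \<le> (\<integral>\<^sup>+x. ennreal (cmod (f x * g x)) \<partial>M)\<^sup>2"
    by (intro power_mono cmod_integral_le_nn_integral) auto
  also have "\<dots> \<le> nsq M f * nsq M g" by (rule nn_integral_mult_sq_le[OF assms])
  finally show ?thesis .
qed

lemma nsq_indicator_bounded:
  "nsq lborel (\<lambda>x::real. indicator {a..b} x :: complex) < \<infinity>"
proof -
  have "nsq lborel (\<lambda>x::real. indicator {a..b} x :: complex) = (\<integral>\<^sup>+x. indicator {a..b} x \<partial>lborel)"
    unfolding nsq_def by (intro nn_integral_cong) (auto simp: indicator_def)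
  also have "\<dots> = emeasure lborel {a..b}" by simp
  finally show ?thesis by (simp add: emeasure_lborel_Icc_eq)
qed

lemma sq_integrable_indicator: "sq_integrable lborel (\<lambda>x::real. indicator {a..b} x :: complex)"
  unfolding sq_integrable_iff_nsq using nsq_indicator_bounded[of a b] by (intro conjI borel_measurable_indicator) auto

text \<open>A square-integrable function need not be integrable on the line, so E is first cut to
  [-n, n], where Cauchy-Schwarz gives integrability; these intervals exhaust the line.\<close>

lemma AE_zero_if_interval_integrals_zero_L2:
  fixes E :: "real \<Rightarrow> complex"
  assumes E: "sq_integrable lborel E"
    and zero: "\<And>a b. a < b \<Longrightarrow> (\<integral>x. indicator {a..b} x * E x \<partial>lborel) = 0"
  shows "AE x in lborel. E x = 0"
proof -
  note [measurable] = sq_integrableD(1)[OF E]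
  have "AE x in lborel. indicator {- real n..real n} x * E x = 0" for n
  proof (rule AE_zero_if_interval_integrals_zero)
    show "integrable lborel (\<lambda>x. indicator {- real n..real n} x * E x)"
      by (rule integrable_mult_sq_integrable[OF sq_integrable_indicator E])
    fix a b :: real assume "a < b"
    let ?a = "max a (- real n)" and ?b = "min b (real n)"
    \<comment> \<open>An open interval cut with [-n, n] agrees with a closed interval up to end
      points; if at most one point is left, the integral vanishes for lack of measure.\<close>
    have "(LBINT x:{a<..<b}. indicator {- real n..real n} x * E x) = (LBINT x. indicator {?a..?b} x * E x)"
      unfolding set_lebesgue_integral_def
    proof (rule integral_cong_AE)
      have "AE x in lborel. x \<noteq> a \<and> x \<noteq> b" using AE_lborel_singleton[of a] AE_lborel_singleton[of b] by eventually_elim auto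
      then show "AE x in lborel. indicat_real {a<..<b} x *\<^sub>R (indicator {- real n..real n} x * E x) = indicator {?a..?b} x * E x"
        by eventually_elim (auto simp: indicator_def)
    qed auto
    also have "\<dots> = 0"
    proof (cases "?a < ?b")
      case True
      then show ?thesis by (rule zero)
    next
      case False
      show ?thesis
      proof (rule integral_eq_zero_AE)
        show "AE x in lborel. indicator {?a..?b} x * E x = 0"
          using AE_lborel_singleton[of ?a] by eventually_elim (use False in \<open>auto simp: indicator_def\<close>)
      qed
    qed
    finally show "(LBINT x:{a<..<b}. indicator {- real n..real n} x * E x) = 0" .
  qed
  then have "AE x in lborel. \<forall>n. indicator {- real n..real n} x * E x = 0"
    by (subst AE_all_countable) blast
  then show ?thesis
  proof eventually_elim
    case (elim x)
    obtain m where "\<bar>x\<bar> < real m" using reals_Archimedean2 by blast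
    then have "indicator {- real m..real m} x = (1::complex)" by (auto simp: indicator_def)
    with elim[rule_format, of m] show ?case by simp
  qed
qed

lemma tendsto_0_ennrealI:
  fixes f :: "'a \<Rightarrow> ennreal"
  assumes "\<And>e. e > 0 \<Longrightarrow> eventually (\<lambda>x. f x \<le> ennreal e) F"
  shows "(f \<longlongrightarrow> 0) F"
proof (rule order_tendstoI)
  fix a :: ennreal assume "0 < a"
  then obtain b where b: "0 < b" "b < a" using dense by blast
  then have "b < top" by (simp add: order.strict_trans2)
  then have e: "b = ennreal (enn2real b)" "enn2real b > 0" using b by (auto simp: enn2real_positive_iff)
  from assms[OF e(2)] show "eventually (\<lambda>x. f x < a) F"
    by eventually_elim (metis b(2) e(1) order.strict_trans1)
qed auto

section \<open>The Fourier transform of integrable functions\<close>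

text \<open>The transform as an absolutely convergent integral, meaningful on L1;
  \<open>is_fourier\<close> extends it to L2 through truncations to [-R, R].\<close>

definition fourier_int :: "(real \<Rightarrow> complex) \<Rightarrow> real \<Rightarrow> complex" where
  "fourier_int g \<xi> = complex_of_real (1 / sqrt (2 * pi)) * (\<integral>x. g x * cis (- (x * \<xi>)) \<partial>lborel)"

definition gauss :: "real \<Rightarrow> real \<Rightarrow> real" where
  "gauss \<sigma> \<xi> = exp (- (\<sigma> * \<xi>)\<^sup>2 / 2)"

lemma borel_measurable_cis [measurable]: "cis \<in> borel_measurable borel"
  by (intro borel_measurable_continuous_onI continuous_on_cis continuous_on_id)

lemma gauss_measurable [measurable]: "gauss \<sigma> \<in> borel_measurable borel"
  unfolding gauss_def[abs_def] by measurable

lemma fourier_int_measurable [measurable]: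
  assumes [measurable]: "g \<in> borel_measurable borel"
  shows "fourier_int g \<in> borel_measurable borel"
  unfolding fourier_int_def[abs_def] by measurable

lemma integrable_mult_cis:
  assumes "integrable lborel g"
  shows "integrable lborel (\<lambda>x. g x * cis (- (x * \<xi>)))"
proof (rule Bochner_Integration.integrable_bound[OF assms])
  note [measurable] = borel_measurable_integrable[OF assms]
  show "(\<lambda>x. g x * cis (- (x * \<xi>))) \<in> borel_measurable lborel" by measurable
qed (auto simp: norm_mult)

lemma fourier_int_bound: "cmod (fourier_int g \<xi>) \<le> 1 / sqrt (2 * pi) * (\<integral>x. cmod (g x) \<partial>lborel)"
proof -
  have "cmod (\<integral>x. g x * cis (- (x * \<xi>)) \<partial>lborel) \<le> (\<integral>x. cmod (g x * cis (- (x * \<xi>))) \<partial>lborel)"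
    by (rule integral_norm_bound)
  then show ?thesis unfolding fourier_int_def
    by (simp add: norm_mult norm_divide divide_right_mono)
qed

lemma fourier_int_diff:
  assumes "integrable lborel g" "integrable lborel h"
  shows "fourier_int (\<lambda>x. g x - h x) \<xi> = fourier_int g \<xi> - fourier_int h \<xi>"
  unfolding fourier_int_def
  by (simp add: left_diff_distrib right_diff_distrib Bochner_Integration.integral_diff[OF integrable_mult_cis integrable_mult_cis] assms)

lemma fourier_int_add:
  assumes "integrable lborel g" "integrable lborel h"
  shows "fourier_int (\<lambda>x. g x + h x) \<xi> = fourier_int g \<xi> + fourier_int h \<xi>"
  unfolding fourier_int_def
  by (simp add: distrib_left distrib_right Bochner_Integration.integral_add[OF integrable_mult_cis integrable_mult_cis] assms)

lemma fourier_int_cmult: "fourier_int (\<lambda>x. c * g x) \<xi> = c * fourier_int g \<xi>"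
  unfolding fourier_int_def by (simp add: mult.assoc)

lemma integral_lborel_uminus:
  fixes f :: "real \<Rightarrow> 'a :: {banach, second_countable_topology}"
  shows "(\<integral>x. f (- x) \<partial>lborel) = (\<integral>x. f x \<partial>lborel)"
  using lborel_integral_real_affine[of "-1" f 0] by simp

lemma fourier_int_reflect: "fourier_int (\<lambda>x. g (- x)) \<xi> = fourier_int g (- \<xi>)"
  unfolding fourier_int_def using integral_lborel_uminus[of "\<lambda>x. g x * cis (x * \<xi>)"] by simp

lemma fourier_int_cnj: "fourier_int (\<lambda>x. cnj (g x)) \<xi> = cnj (fourier_int g (- \<xi>))"
proof -
  have "cnj (\<integral>x. g x * cis (x * \<xi>) \<partial>lborel) = (\<integral>x. cnj (g x * cis (x * \<xi>)) \<partial>lborel)"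
    by (rule Bochner_Integration.integral_cnj[symmetric])
  then show ?thesis unfolding fourier_int_def by (simp add: cis_cnj)
qed

lemma integrable_prod_cis:
  assumes "integrable lborel g" "integrable lborel \<phi>"
  shows "integrable (lborel \<Otimes>\<^sub>M lborel) (\<lambda>(x, \<xi>). g x * \<phi> \<xi> * cis (- (x * \<xi>)))"
proof (rule lborel_pair.Fubini_integrable)
  note [measurable] = borel_measurable_integrable[OF assms(1)] borel_measurable_integrable[OF assms(2)]
  show "(\<lambda>(x, \<xi>). g x * \<phi> \<xi> * cis (- (x * \<xi>))) \<in> borel_measurable (lborel \<Otimes>\<^sub>M lborel)" by measurable
  show "integrable lborel (\<lambda>x. LBINT y. norm (case (x, y) of (x, \<xi>) \<Rightarrow> g x * \<phi> \<xi> * cis (- (x * \<xi>))))"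
    using assms by (simp add: norm_mult)
  have "integrable lborel (\<lambda>y. g x * \<phi> y * cis (- (x * y)))" for x
  proof -
    have "integrable lborel (\<lambda>y. g x * (\<phi> y * cis (- (y * x))))"
      by (intro integrable_mult_right integrable_mult_cis assms)
    then show ?thesis by (simp add: mult.assoc mult.commute[of x])
  qed
  then show "AE x in lborel. integrable lborel (\<lambda>y. case (x, y) of (x, \<xi>) \<Rightarrow> g x * \<phi> \<xi> * cis (- (x * \<xi>)))"
    by simp
qed

text \<open>The kernel cis (-(x \<xi>)) is symmetric in x and \<xi>, so Fubini lets the transform
  change sides. Contractivity and inversion are both extracted from this identity by special choices
  of \<phi>.\<close>

lemma fourier_int_multiplication:
  assumes g: "integrable lborel g" and \<phi>: "integrable lborel \<phi>"
  shows "(\<integral>\<xi>. fourier_int g \<xi> * \<phi> \<xi> \<partial>lborel) = (\<integral>x. g x * fourier_int \<phi> x \<partial>lborel)"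
proof -
  have "(\<integral>\<xi>. (\<integral>x. g x * \<phi> \<xi> * cis (- (x * \<xi>)) \<partial>lborel) \<partial>lborel) = (\<integral>x. (\<integral>\<xi>. g x * \<phi> \<xi> * cis (- (x * \<xi>)) \<partial>lborel) \<partial>lborel)"
    by (rule lborel_pair.Fubini_integral) (rule integrable_prod_cis[OF assms])
  moreover have "(\<integral>x. g x * \<phi> \<xi> * cis (- (x * \<xi>)) \<partial>lborel) = (\<integral>x. g x * cis (- (x * \<xi>)) \<partial>lborel) * \<phi> \<xi>" for \<xi>
    by (subst integral_mult_left_zero[symmetric]) (simp add: mult_ac)
  moreover have "(\<integral>\<xi>. g x * \<phi> \<xi> * cis (- (x * \<xi>)) \<partial>lborel) = g x * (\<integral>\<xi>. \<phi> \<xi> * cis (- (\<xi> * x)) \<partial>lborel)" for x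
    by (subst integral_mult_right_zero[symmetric]) (simp add: mult_ac)
  ultimately have "(\<integral>\<xi>. (\<integral>x. g x * cis (- (x * \<xi>)) \<partial>lborel) * \<phi> \<xi> \<partial>lborel) = (\<integral>x. g x * (\<integral>\<xi>. \<phi> \<xi> * cis (- (\<xi> * x)) \<partial>lborel) \<partial>lborel)"
    by simp
  then show ?thesis unfolding fourier_int_def
    by (simp add: mult.assoc mult.left_commute[of _ "complex_of_real _"])
qed

section \<open>Gaussian damping and mollification\<close>

lemma gauss_eq_normal_density:
  assumes "\<sigma> > 0"
  shows "gauss \<sigma> \<xi> = sqrt (2 * pi) / \<sigma> * normal_density 0 (1 / \<sigma>) \<xi>"
proof -
  have "sqrt (2 * pi * (1 / \<sigma>)\<^sup>2) = sqrt (2 * pi) / \<sigma>"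
    using assms by (simp add: real_sqrt_mult real_sqrt_divide)
  then show ?thesis unfolding gauss_def normal_density_def
    using assms by (simp add: power_mult_distrib field_simps)
qed

lemma integrable_gauss: "\<sigma> > 0 \<Longrightarrow> integrable lborel (gauss \<sigma>)"
  by (subst Bochner_Integration.integrable_cong[OF refl gauss_eq_normal_density]) auto

text \<open>After the substitution \<xi> = \<eta>/\<sigma> this is the known characteristic function
  of the standard normal distribution. Damping of width 1/\<sigma> thus corresponds to a normal
  density of standard deviation \<sigma>.\<close>

lemma integral_gauss_cis:
  assumes "\<sigma> > 0"
  shows "(\<integral>\<xi>. gauss \<sigma> \<xi> * cis (\<xi> * z) \<partial>lborel) = 2 * pi * normal_density 0 \<sigma> z"
proof -
  have c: "(\<integral>x. std_normal_density x * cis (x * t) \<partial>lborel) = exp (- t\<^sup>2 / 2)" for t :: real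
  proof -
    have "char std_normal_distribution t = (\<integral>x. std_normal_density x * cis (x * t) \<partial>lborel)"
      unfolding char_def by (subst integral_density) (auto simp: scaleR_conv_of_real cis_conv_exp mult_ac)
    then show ?thesis by (simp add: char_std_normal_distribution)
  qed
  have "(\<integral>\<xi>. gauss \<sigma> \<xi> * cis (\<xi> * z) \<partial>lborel) = (1 / \<sigma>) *\<^sub>R (\<integral>\<eta>. gauss \<sigma> (\<eta> / \<sigma>) * cis (\<eta> / \<sigma> * z) \<partial>lborel)"
    using lborel_integral_real_affine[of "1 / \<sigma>" "\<lambda>\<xi>. gauss \<sigma> \<xi> * cis (\<xi> * z)" 0] assms by simp
  also have "(\<integral>\<eta>. gauss \<sigma> (\<eta> / \<sigma>) * cis (\<eta> / \<sigma> * z) \<partial>lborel)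
      = (\<integral>\<eta>. complex_of_real (sqrt (2 * pi)) * (std_normal_density \<eta> * cis (\<eta> * (z / \<sigma>))) \<partial>lborel)"
  proof -
    have "gauss \<sigma> (\<eta> / \<sigma>) = sqrt (2 * pi) * std_normal_density \<eta>" for \<eta>
      using assms by (simp add: gauss_def std_normal_density_def)
    then show ?thesis by (simp add: mult.assoc)
  qed
  also have "\<dots> = sqrt (2 * pi) * exp (- (z / \<sigma>)\<^sup>2 / 2)" by (subst integral_mult_right_zero) (simp only: c of_real_mult)
  also have "(1 / \<sigma>) *\<^sub>R complex_of_real (sqrt (2 * pi) * exp (- (z / \<sigma>)\<^sup>2 / 2)) = 2 * pi * normal_density 0 \<sigma> z"
  proof -
    have q: "1 / \<sigma> * (q * e) = (q * q) * (1 / (q * \<sigma>) * e)" if "q > 0" for q e :: real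
      using assms that by simp
    have "1 / \<sigma> * (sqrt (2 * pi) * exp (- (z / \<sigma>)\<^sup>2 / 2)) = (sqrt (2*pi) * sqrt (2*pi)) * (1 / (sqrt (2 * pi) * \<sigma>) * exp (- (z / \<sigma>)\<^sup>2 / 2))"
      by (rule q) simp
    also have "\<dots> = 2 * pi * normal_density 0 \<sigma> z"
    proof -
      have "sqrt (2 * pi) * sqrt (2 * pi) = 2 * pi" by simp
      moreover have "sqrt (2 * pi * \<sigma>\<^sup>2) = sqrt (2 * pi) * \<sigma>" "- (z - 0)\<^sup>2 / (2 * \<sigma>\<^sup>2) = - (z / \<sigma>)\<^sup>2 / 2"
        using assms by (simp_all add: real_sqrt_mult power_divide)
      ultimately show ?thesis unfolding normal_density_def by (simp only: mult.assoc)
    qed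
    finally show ?thesis by (simp only: scaleR_conv_of_real of_real_mult[symmetric])
  qed
  finally show ?thesis by simp
qed

definition mollify :: "real \<Rightarrow> (real \<Rightarrow> complex) \<Rightarrow> real \<Rightarrow> complex" where
  "mollify \<sigma> g x = (\<integral>y. g y * normal_density x \<sigma> y \<partial>lborel)"

text \<open>Take \<phi> in the multiplication formula to be the Gaussian times the character of x;
  its transform is the normal density centred at x, up to the factor sqrt (2 pi). The argument -x
  appears because the inverse transform is the transform at the reflected point.\<close>

lemma fourier_int_gauss_mult:
  assumes \<sigma>: "\<sigma> > 0" and g: "integrable lborel g"
  shows "fourier_int (\<lambda>\<xi>. gauss \<sigma> \<xi> * fourier_int g \<xi>) (- x) = mollify \<sigma> g x"
proof -
  let ?\<phi> = "\<lambda>\<xi>. complex_of_real (gauss \<sigma> \<xi>) * cis (- (\<xi> * - x))"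
  have \<phi>: "integrable lborel ?\<phi>"
    by (rule integrable_mult_cis) (simp add: integrable_gauss \<sigma>)
  have F: "fourier_int ?\<phi> y = sqrt (2 * pi) * normal_density x \<sigma> y" for y
  proof -
    have "(\<integral>\<xi>. ?\<phi> \<xi> * cis (- (\<xi> * y)) \<partial>lborel) = (\<integral>\<xi>. gauss \<sigma> \<xi> * cis (\<xi> * (x - y)) \<partial>lborel)"
      by (intro Bochner_Integration.integral_cong) (auto simp: mult.assoc cis_mult algebra_simps)
    also have "\<dots> = 2 * pi * normal_density x \<sigma> y"
      by (subst integral_gauss_cis[OF \<sigma>]) (simp add: normal_density_def power2_commute)
    finally have *: "fourier_int ?\<phi> y = complex_of_real (1 / sqrt (2 * pi) * (2 * pi)) * normal_density x \<sigma> y"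
      unfolding fourier_int_def by simp
    have "1 / sqrt (2 * pi) * (2 * pi) = sqrt (2 * pi)"
      using real_sqrt_mult_self[of "2 * pi"] by (simp add: field_simps)
    then show ?thesis by (subst *) (simp del: real_sqrt_mult)
  qed
  have "fourier_int (\<lambda>\<xi>. gauss \<sigma> \<xi> * fourier_int g \<xi>) (- x) = complex_of_real (1 / sqrt (2 * pi)) * (\<integral>\<xi>. fourier_int g \<xi> * ?\<phi> \<xi> \<partial>lborel)"
    unfolding fourier_int_def[of "\<lambda>\<xi>. gauss \<sigma> \<xi> * fourier_int g \<xi>"] by (simp add: mult_ac)
  also have "\<dots> = complex_of_real (1 / sqrt (2 * pi)) * (\<integral>y. complex_of_real (sqrt (2 * pi)) * (g y * normal_density x \<sigma> y) \<partial>lborel)"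
    by (subst fourier_int_multiplication[OF g \<phi>]) (simp only: F, simp add: mult_ac)
  also have "\<dots> = mollify \<sigma> g x" unfolding mollify_def by (subst integral_mult_right_zero) simp
  finally show ?thesis .
qed

definition trunc :: "real \<Rightarrow> (real \<Rightarrow> complex) \<Rightarrow> real \<Rightarrow> complex" where
  "trunc R g x = indicator {- R..R} x * g x"

lemma cnj_measurable [measurable]: "cnj \<in> borel_measurable borel"
  by (intro borel_measurable_continuous_onI continuous_intros)

lemma nsq_lborel_uminus:
  fixes g :: "real \<Rightarrow> complex"
  assumes [measurable]: "g \<in> borel_measurable borel"
  shows "nsq lborel (\<lambda>x. g (- x)) = nsq lborel g"
  unfolding nsq_def using nn_integral_real_affine[of "\<lambda>x. ennreal ((cmod (g x))\<^sup>2)" "-1" 0] by simp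

lemma normal_density_commute: "normal_density x \<sigma> y = normal_density y \<sigma> x"
  by (simp add: normal_density_def power2_commute)

lemma nn_integral_normal_density:
  assumes "\<sigma> > 0"
  shows "(\<integral>\<^sup>+y. ennreal (normal_density x \<sigma> y) \<partial>lborel) = 1"
  by (subst nn_integral_eq_integral) (use assms in auto)

lemma normal_density_measurable2 [measurable]:
  "(\<lambda>(x, y). normal_density x \<sigma> y) \<in> borel_measurable (borel \<Otimes>\<^sub>M borel)"
  unfolding normal_density_def by measurable

lemma mollify_measurable [measurable]:
  assumes [measurable]: "g \<in> borel_measurable borel"
  shows "mollify \<sigma> g \<in> borel_measurable borel"
  unfolding mollify_def[abs_def] normal_density_def by measurable

text \<open>This is the Schur test for the kernel \<open>normal_density x \<sigma> y\<close>.\<close>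

lemma mollify_pairing_le:
  assumes \<sigma>: "\<sigma> > 0" and [measurable]: "g \<in> borel_measurable borel"
  shows "ennreal (cmod (\<integral>x. g x * cnj (mollify \<sigma> g x) \<partial>lborel)) \<le> nsq lborel g"
proof -
  let ?p = "\<lambda>x y. ennreal (normal_density x \<sigma> y)"
  have "ennreal (cmod (\<integral>x. g x * cnj (mollify \<sigma> g x) \<partial>lborel))
      \<le> (\<integral>\<^sup>+x. ennreal (cmod (g x)) * ennreal (cmod (mollify \<sigma> g x)) \<partial>lborel)"
    using cmod_integral_le_nn_integral[of lborel "\<lambda>x. g x * cnj (mollify \<sigma> g x)"]
    by (simp add: norm_mult ennreal_mult)
  also have "\<dots> \<le> (\<integral>\<^sup>+x. (\<integral>\<^sup>+y. ennreal (cmod (g x)) * (ennreal (cmod (g y)) * ?p x y) \<partial>lborel) \<partial>lborel)"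
  proof (intro nn_integral_mono)
    fix x
    have "ennreal (cmod (mollify \<sigma> g x)) \<le> (\<integral>\<^sup>+y. ennreal (cmod (g y)) * ?p x y \<partial>lborel)"
      unfolding mollify_def
      using cmod_integral_le_nn_integral[of lborel "\<lambda>y. g y * complex_of_real (normal_density x \<sigma> y)"]
      by (simp add: norm_mult ennreal_mult)
    then have "ennreal (cmod (g x)) * ennreal (cmod (mollify \<sigma> g x)) \<le> ennreal (cmod (g x)) * (\<integral>\<^sup>+y. ennreal (cmod (g y)) * ?p x y \<partial>lborel)"
      by (intro mult_left_mono) auto
    then show "ennreal (cmod (g x)) * ennreal (cmod (mollify \<sigma> g x)) \<le> (\<integral>\<^sup>+y. ennreal (cmod (g x)) * (ennreal (cmod (g y)) * ?p x y) \<partial>lborel)"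
      by (subst nn_integral_cmult) auto
  qed
  \<comment> \<open>The product is split by 2|g x||g y| \<le> |g x|^2 + |g y|^2; the kernel has mass
    1 in y for the first half and, being symmetric, mass 1 in x for the second.\<close>
  also have "\<dots> \<le> (\<integral>\<^sup>+x. (\<integral>\<^sup>+y. ennreal ((cmod (g x))\<^sup>2 / 2) * ?p x y + ennreal ((cmod (g y))\<^sup>2 / 2) * ?p x y \<partial>lborel) \<partial>lborel)"
  proof (intro nn_integral_mono)
    fix x y
    have "0 \<le> (cmod (g x) - cmod (g y))\<^sup>2" by simp
    then have "cmod (g x) * cmod (g y) \<le> (cmod (g x))\<^sup>2 / 2 + (cmod (g y))\<^sup>2 / 2"
      by (simp add: power2_eq_square algebra_simps)
    then have "ennreal (cmod (g x)) * ennreal (cmod (g y)) \<le> ennreal ((cmod (g x))\<^sup>2 / 2) + ennreal ((cmod (g y))\<^sup>2 / 2)"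
      by (simp flip: ennreal_mult ennreal_plus)
    then have "(ennreal (cmod (g x)) * ennreal (cmod (g y))) * ?p x y \<le> (ennreal ((cmod (g x))\<^sup>2 / 2) + ennreal ((cmod (g y))\<^sup>2 / 2)) * ?p x y"
      by (intro mult_right_mono) auto
    then show "ennreal (cmod (g x)) * (ennreal (cmod (g y)) * ?p x y)
        \<le> ennreal ((cmod (g x))\<^sup>2 / 2) * ?p x y + ennreal ((cmod (g y))\<^sup>2 / 2) * ?p x y"
      by (simp add: mult.assoc distrib_right)
  qed
  also have "\<dots> = (\<integral>\<^sup>+x. ennreal ((cmod (g x))\<^sup>2 / 2) \<partial>lborel) + (\<integral>\<^sup>+x. (\<integral>\<^sup>+y. ennreal ((cmod (g y))\<^sup>2 / 2) * ?p x y \<partial>lborel) \<partial>lborel)"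
  proof -
    have "(\<integral>\<^sup>+y. ennreal ((cmod (g x))\<^sup>2 / 2) * ?p x y + ennreal ((cmod (g y))\<^sup>2 / 2) * ?p x y \<partial>lborel)
        = ennreal ((cmod (g x))\<^sup>2 / 2) + (\<integral>\<^sup>+y. ennreal ((cmod (g y))\<^sup>2 / 2) * ?p x y \<partial>lborel)" for x
      by (subst nn_integral_add) (auto simp: nn_integral_cmult nn_integral_normal_density[OF \<sigma>])
    then show ?thesis
      by (simp only:) (rule nn_integral_add; measurable)
  qed
  also have "(\<integral>\<^sup>+x. (\<integral>\<^sup>+y. ennreal ((cmod (g y))\<^sup>2 / 2) * ?p x y \<partial>lborel) \<partial>lborel) = (\<integral>\<^sup>+y. (\<integral>\<^sup>+x. ennreal ((cmod (g y))\<^sup>2 / 2) * ?p x y \<partial>lborel) \<partial>lborel)"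
    by (rule lborel_pair.Fubini') measurable
  also have "\<dots> = (\<integral>\<^sup>+y. ennreal ((cmod (g y))\<^sup>2 / 2) \<partial>lborel)"
    by (subst normal_density_commute, subst nn_integral_cmult) (auto simp: nn_integral_normal_density[OF \<sigma>])
  also have "(\<integral>\<^sup>+y. ennreal ((cmod (g y))\<^sup>2 / 2) \<partial>lborel) + (\<integral>\<^sup>+y. ennreal ((cmod (g y))\<^sup>2 / 2) \<partial>lborel) = nsq lborel g"
    unfolding nsq_def by (subst nn_integral_add[symmetric]) (auto simp flip: ennreal_plus)
  finally show ?thesis .
qed

lemma gauss_tendsto_1: "(\<lambda>n. gauss (1 / real (Suc n)) \<xi>) \<longlonglongrightarrow> 1"
proof -
  have "(\<lambda>n. 1 / real (Suc n)) \<longlonglongrightarrow> 0" by (rule LIMSEQ_Suc[OF lim_1_over_n])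
  then have "(\<lambda>n. exp (- (1 / real (Suc n) * \<xi>)\<^sup>2 / 2)) \<longlonglongrightarrow> exp (- (0 * \<xi>)\<^sup>2 / 2)"
    by (intro tendsto_intros) auto
  then show ?thesis unfolding gauss_def by simp
qed

lemma gauss_nonneg: "0 \<le> gauss \<sigma> \<xi>" and gauss_le_1: "gauss \<sigma> \<xi> \<le> 1"
  by (auto simp: gauss_def)

text \<open>Pairing the transform with its own damped conjugate and moving the transform over leaves
  g against its mollification, which the Schur test bounds by the squared norm of g, uniformly in
  the damping. Fatou's lemma then removes the damping. The right-hand side may be infinite, since
  only integrability of g is assumed.\<close>

lemma nsq_fourier_int_le:
  assumes g: "integrable lborel g"
  shows "nsq lborel (fourier_int g) \<le> nsq lborel g"
proof -
  note [measurable] = borel_measurable_integrable[OF g, simplified]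
  define B where "B = 1 / sqrt (2 * pi) * (\<integral>x. cmod (g x) \<partial>lborel)"
  have B: "cmod (fourier_int g \<xi>) \<le> B" for \<xi> unfolding B_def by (rule fourier_int_bound)
  have B0: "B \<ge> 0" using order_trans[OF norm_ge_zero B] .
  have damped: "(\<integral>\<^sup>+\<xi>. ennreal ((cmod (fourier_int g \<xi>))\<^sup>2 * gauss \<sigma> \<xi>) \<partial>lborel) \<le> nsq lborel g" if \<sigma>: "\<sigma> > 0" for \<sigma>
  proof -
    \<comment> \<open>The undamped conjugate is bounded by B but need not be integrable; the
      Gaussian factor makes it so.\<close>
    let ?\<phi> = "\<lambda>\<xi>. cnj (gauss \<sigma> \<xi> * fourier_int g \<xi>)"
    have \<phi>: "integrable lborel ?\<phi>"
      by (rule Bochner_Integration.integrable_bound[where f = "\<lambda>\<xi>. B * gauss \<sigma> \<xi>"])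
         (use B B0 in \<open>auto simp: integrable_gauss[OF \<sigma>] norm_mult gauss_nonneg abs_mult mult.commute[of B] intro!: mult_left_mono\<close>)
    have eq: "fourier_int g \<xi> * ?\<phi> \<xi> = complex_of_real ((cmod (fourier_int g \<xi>))\<^sup>2 * gauss \<sigma> \<xi>)" for \<xi>
      by (simp only: of_real_mult complex_norm_square complex_cnj_mult complex_cnj_complex_of_real mult_ac)
    have int: "integrable lborel (\<lambda>\<xi>. (cmod (fourier_int g \<xi>))\<^sup>2 * gauss \<sigma> \<xi>)"
      by (rule Bochner_Integration.integrable_bound[where f = "\<lambda>\<xi>. B\<^sup>2 * gauss \<sigma> \<xi>"])
         (use B B0 in \<open>auto simp: integrable_gauss[OF \<sigma>] gauss_nonneg abs_mult intro!: mult_right_mono power_mono\<close>)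
    have "(\<integral>\<^sup>+\<xi>. ennreal ((cmod (fourier_int g \<xi>))\<^sup>2 * gauss \<sigma> \<xi>) \<partial>lborel) = ennreal (\<integral>\<xi>. (cmod (fourier_int g \<xi>))\<^sup>2 * gauss \<sigma> \<xi> \<partial>lborel)"
      by (rule nn_integral_eq_integral[OF int]) (auto simp: gauss_nonneg)
    also have "\<dots> = ennreal (cmod (complex_of_real (\<integral>\<xi>. (cmod (fourier_int g \<xi>))\<^sup>2 * gauss \<sigma> \<xi> \<partial>lborel)))"
      by (subst norm_of_real, subst abs_of_nonneg) (auto simp: gauss_nonneg intro!: integral_nonneg)
    also have "complex_of_real (\<integral>\<xi>. (cmod (fourier_int g \<xi>))\<^sup>2 * gauss \<sigma> \<xi> \<partial>lborel) = (\<integral>\<xi>. fourier_int g \<xi> * ?\<phi> \<xi> \<partial>lborel)"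
      unfolding eq by (rule integral_complex_of_real[symmetric])
    also have "\<dots> = (\<integral>x. g x * fourier_int ?\<phi> x \<partial>lborel)"
      by (rule fourier_int_multiplication[OF g \<phi>])
    also have "\<dots> = (\<integral>x. g x * cnj (mollify \<sigma> g x) \<partial>lborel)"
      by (simp only: fourier_int_cnj fourier_int_gauss_mult[OF \<sigma> g])
    also have "ennreal (cmod \<dots>) \<le> nsq lborel g"
      by (rule mollify_pairing_le[OF \<sigma>]) measurable
    finally show ?thesis .
  qed
  have "nsq lborel (fourier_int g) = (\<integral>\<^sup>+\<xi>. liminf (\<lambda>n. ennreal ((cmod (fourier_int g \<xi>))\<^sup>2 * gauss (1 / real (Suc n)) \<xi>)) \<partial>lborel)"
    unfolding nsq_def
  proof (rule nn_integral_cong)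
    fix \<xi>
    have "(\<lambda>n. ennreal ((cmod (fourier_int g \<xi>))\<^sup>2 * gauss (1 / real (Suc n)) \<xi>)) \<longlonglongrightarrow> ennreal ((cmod (fourier_int g \<xi>))\<^sup>2 * 1)"
      by (intro tendsto_ennrealI tendsto_mult tendsto_const gauss_tendsto_1)
    then show "ennreal ((cmod (fourier_int g \<xi>))\<^sup>2) = liminf (\<lambda>n. ennreal ((cmod (fourier_int g \<xi>))\<^sup>2 * gauss (1 / real (Suc n)) \<xi>))"
      using lim_imp_Liminf[OF sequentially_bot] by fastforce
  qed
  also have "\<dots> \<le> liminf (\<lambda>n. \<integral>\<^sup>+\<xi>. ennreal ((cmod (fourier_int g \<xi>))\<^sup>2 * gauss (1 / real (Suc n)) \<xi>) \<partial>lborel)"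
    by (rule nn_integral_liminf) measurable
  also have "\<dots> \<le> nsq lborel g"
    by (rule Liminf_le) (auto intro!: always_eventually damped)
  finally show ?thesis .
qed

section \<open>The Fourier transform of square-integrable functions\<close>

lemma trunc_measurable [measurable]:
  "g \<in> borel_measurable borel \<Longrightarrow> trunc R g \<in> borel_measurable borel"
  unfolding trunc_def[abs_def] by measurable

lemma cmod_trunc_le: "cmod (trunc R g x) \<le> cmod (g x)"
  by (auto simp: trunc_def indicator_def)

lemma sq_integrable_trunc: "sq_integrable lborel g \<Longrightarrow> sq_integrable lborel (trunc R g)"
  by (rule sq_integrable_bound) (auto simp: cmod_trunc_le dest: sq_integrableD)

lemma integrable_trunc: "sq_integrable lborel g \<Longrightarrow> integrable lborel (trunc R g)"
  unfolding trunc_def[abs_def] by (rule integrable_mult_sq_integrable[OF sq_integrable_indicator])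

text \<open>Dominated convergence is applied along the integers; monotonicity of the tail in R
  carries the result over to the full filter at infinity.\<close>

lemma trunc_tail_tendsto_0:
  assumes g: "sq_integrable lborel g"
  shows "((\<lambda>R. nsq lborel (\<lambda>x. g x - trunc R g x)) \<longlongrightarrow> 0) at_top"
proof (rule tendsto_0_ennrealI)
  note [measurable] = sq_integrableD(1)[OF g, simplified]
  have "(\<lambda>n. nsq lborel (\<lambda>x. g x - trunc (real n) g x)) \<longlonglongrightarrow> (\<integral>\<^sup>+(x::real). 0 \<partial>lborel)"
    unfolding nsq_def
  proof (rule nn_integral_dominated_convergence[where w = "\<lambda>x. ennreal ((cmod (g x))\<^sup>2)"])
    show "(\<integral>\<^sup>+x. ennreal ((cmod (g x))\<^sup>2) \<partial>lborel) < \<infinity>" using sq_integrableD(2)[OF g] by (simp add: nsq_def)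
    show "AE x in lborel. (\<lambda>n. ennreal ((cmod (g x - trunc (real n) g x))\<^sup>2)) \<longlonglongrightarrow> 0"
    proof (intro AE_I2 tendsto_eventually)
      fix x :: real
      obtain m where m: "\<bar>x\<bar> < real m" using reals_Archimedean2 by blast
      show "\<forall>\<^sub>F n in sequentially. ennreal ((cmod (g x - trunc (real n) g x))\<^sup>2) = 0"
        using eventually_ge_at_top[of m] by eventually_elim (use m in \<open>auto simp: trunc_def indicator_def\<close>)
    qed
  qed (auto simp: trunc_def indicator_def)
  then have seq: "(\<lambda>n. nsq lborel (\<lambda>x. g x - trunc (real n) g x)) \<longlonglongrightarrow> 0" by simp
  fix e :: real assume "e > 0"
  then have "\<forall>\<^sub>F n in sequentially. nsq lborel (\<lambda>x. g x - trunc (real n) g x) < ennreal e"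
    by (intro order_tendstoD[OF seq]) auto
  then obtain N where N: "nsq lborel (\<lambda>x. g x - trunc (real N) g x) < ennreal e"
    by (auto simp: eventually_sequentially)
  show "\<forall>\<^sub>F R in at_top. nsq lborel (\<lambda>x. g x - trunc R g x) \<le> ennreal e"
    using eventually_ge_at_top[of "real N"]
  proof eventually_elim
    case (elim R)
    have "nsq lborel (\<lambda>x. g x - trunc R g x) \<le> nsq lborel (\<lambda>x. g x - trunc (real N) g x)"
      by (rule nsq_mono) (use elim in \<open>auto simp: trunc_def indicator_def\<close>)
    with N show ?case by simp
  qed
qed

lemma is_fourier_iff:
  "is_fourier g h \<longleftrightarrow> sq_integrable lborel g \<and> sq_integrable lborel h \<and>
     ((\<lambda>R. nsq lborel (\<lambda>\<xi>. h \<xi> - fourier_int (trunc R g) \<xi>)) \<longlongrightarrow> 0) at_top"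
proof -
  have "(LBINT x:{- R..R}. g x * cis (- (x * \<xi>))) = (\<integral>x. trunc R g x * cis (- (x * \<xi>)) \<partial>lborel)" for R \<xi>
    unfolding set_lebesgue_integral_def trunc_def by (intro Bochner_Integration.integral_cong) (auto simp: indicator_def)
  then show ?thesis unfolding is_fourier_def nsq_def fourier_int_def by simp
qed

lemma is_fourierD:
  assumes "is_fourier g h"
  shows "sq_integrable lborel g" "sq_integrable lborel h" "g \<in> borel_measurable borel" "h \<in> borel_measurable borel"
    "((\<lambda>R. nsq lborel (\<lambda>\<xi>. h \<xi> - fourier_int (trunc R g) \<xi>)) \<longlongrightarrow> 0) at_top"
  using assms by (auto simp: is_fourier_iff dest: sq_integrableD)

lemma is_fourier_nsq_le:
  assumes "is_fourier g h"
  shows "nsq lborel h \<le> nsq lborel g"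
proof -
  note [measurable] = is_fourierD(3,4)[OF assms]
  show ?thesis
  proof (rule nsq_limit_le[OF _ _ _ is_fourierD(5)[OF assms]])
    show "\<forall>\<^sub>F R in at_top. nsq lborel (fourier_int (trunc R g)) \<le> nsq lborel g"
      by (intro always_eventually allI order_trans[OF nsq_fourier_int_le] nsq_mono integrable_trunc is_fourierD(1)[OF assms])
         (auto simp: cmod_trunc_le)
  qed auto
qed

text \<open>Both truncations agree with g on [-R0, R0], so their difference is dominated by the tail
  outside. One tail controls all later differences, as the Cauchy criterion demands.\<close>

lemma nsq_fourier_trunc_cauchy:
  assumes g: "sq_integrable lborel g" and R: "R0 \<le> R" "R0 \<le> S"
  shows "nsq lborel (\<lambda>\<xi>. fourier_int (trunc R g) \<xi> - fourier_int (trunc S g) \<xi>) \<le> nsq lborel (\<lambda>x. g x - trunc R0 g x)"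
proof -
  have "nsq lborel (\<lambda>\<xi>. fourier_int (trunc R g) \<xi> - fourier_int (trunc S g) \<xi>) = nsq lborel (fourier_int (\<lambda>x. trunc R g x - trunc S g x))"
    by (simp add: fourier_int_diff[OF integrable_trunc[OF g] integrable_trunc[OF g], abs_def])
  also have "\<dots> \<le> nsq lborel (\<lambda>x. trunc R g x - trunc S g x)"
    by (intro nsq_fourier_int_le Bochner_Integration.integrable_diff integrable_trunc g)
  also have "\<dots> \<le> nsq lborel (\<lambda>x. g x - trunc R0 g x)"
    by (rule nsq_mono) (use R in \<open>auto simp: trunc_def indicator_def\<close>)
  finally show ?thesis .
qed

text \<open>Convergence along one sequence of radii is enough, because the tail bound compares any
  two large radii. The quarter of e pays for the factor 2 on each of two terms.\<close>

lemma is_fourierI_seq: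
  assumes g: "sq_integrable lborel g" and h: "sq_integrable lborel h"
    and r: "filterlim r at_top sequentially"
    and lim: "(\<lambda>n. nsq lborel (\<lambda>\<xi>. h \<xi> - fourier_int (trunc (r n) g) \<xi>)) \<longlonglongrightarrow> 0"
  shows "is_fourier g h"
  unfolding is_fourier_iff
proof (intro conjI g h tendsto_0_ennrealI)
  note [measurable] = sq_integrableD(1)[OF g, simplified] sq_integrableD(1)[OF h, simplified]
  fix e :: real assume e: "e > 0"
  from order_tendstoD(2)[OF trunc_tail_tendsto_0[OF g], of "ennreal (e / 4)"] e
  obtain R0 where R0: "nsq lborel (\<lambda>x. g x - trunc R0 g x) < ennreal (e / 4)"
    by (auto simp: eventually_at_top_linorder)
  have "\<forall>\<^sub>F n in sequentially. nsq lborel (\<lambda>\<xi>. h \<xi> - fourier_int (trunc (r n) g) \<xi>) < ennreal (e / 4) \<and> R0 \<le> r n"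
    using e r by (intro eventually_conj order_tendstoD(2)[OF lim]) (auto simp: filterlim_at_top)
  then obtain n where n: "nsq lborel (\<lambda>\<xi>. h \<xi> - fourier_int (trunc (r n) g) \<xi>) < ennreal (e / 4)" "R0 \<le> r n"
    by (auto simp: eventually_sequentially)
  show "\<forall>\<^sub>F R in at_top. nsq lborel (\<lambda>\<xi>. h \<xi> - fourier_int (trunc R g) \<xi>) \<le> ennreal e"
    using eventually_ge_at_top[of R0]
  proof eventually_elim
    case (elim R)
    have "nsq lborel (\<lambda>\<xi>. h \<xi> - fourier_int (trunc R g) \<xi>)
        \<le> 2 * nsq lborel (\<lambda>\<xi>. h \<xi> - fourier_int (trunc (r n) g) \<xi>) + 2 * nsq lborel (\<lambda>\<xi>. fourier_int (trunc (r n) g) \<xi> - fourier_int (trunc R g) \<xi>)"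
      by (rule nsq_diff_triangle) auto
    also have "\<dots> \<le> 2 * ennreal (e / 4) + 2 * ennreal (e / 4)"
      using n R0 nsq_fourier_trunc_cauchy[OF g n(2) elim] by (intro add_mono mult_left_mono) (auto intro: order_trans less_imp_le)
    also have "\<dots> = ennreal e"
      using e by (simp add: ennreal_plus[symmetric] ennreal_numeral[symmetric] ennreal_mult[symmetric] del: ennreal_plus ennreal_numeral)
    finally show ?case .
  qed
qed

text \<open>Truncations are integrable, their transforms are Cauchy by the tail bound, and
  completeness supplies the limit; the sharp norm bound for limits makes it square
  integrable.\<close>

lemma is_fourier_exists:
  assumes g: "sq_integrable lborel g"
  obtains h where "is_fourier g h"
proof -
  note [measurable] = sq_integrableD(1)[OF g, simplified]
  obtain h where h: "h \<in> borel_measurable lborel" "(\<lambda>n. nsq lborel (\<lambda>\<xi>. fourier_int (trunc (real n) g) \<xi> - h \<xi>)) \<longlonglongrightarrow> 0"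
  proof (rule L2_complete[of "\<lambda>n. fourier_int (trunc (real n) g)" lborel])
    fix e :: real assume "e > 0"
    from order_tendstoD(2)[OF trunc_tail_tendsto_0[OF g], of "ennreal e"] this
    obtain R0 where R0: "nsq lborel (\<lambda>x. g x - trunc R0 g x) < ennreal e"
      by (auto simp: eventually_at_top_linorder)
    show "\<exists>N. \<forall>m\<ge>N. \<forall>n\<ge>N. nsq lborel (\<lambda>x. fourier_int (trunc (real m) g) x - fourier_int (trunc (real n) g) x) \<le> ennreal e"
    proof (intro exI allI impI)
      fix m n assume "nat \<lceil>R0\<rceil> \<le> m" "nat \<lceil>R0\<rceil> \<le> n"
      then have "R0 \<le> real m" "R0 \<le> real n" by linarith+
      from order_trans[OF nsq_fourier_trunc_cauchy[OF g this] less_imp_le[OF R0]]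
      show "nsq lborel (\<lambda>x. fourier_int (trunc (real m) g) x - fourier_int (trunc (real n) g) x) \<le> ennreal e" .
    qed
  qed auto
  note [measurable] = h(1)[simplified]
  have lim: "(\<lambda>n. nsq lborel (\<lambda>\<xi>. h \<xi> - fourier_int (trunc (real n) g) \<xi>)) \<longlonglongrightarrow> 0"
    using h(2) by (subst (asm) nsq_diff_commute)
  have "nsq lborel h \<le> nsq lborel g"
  proof (rule nsq_limit_le[OF _ _ _ lim])
    show "\<forall>\<^sub>F n in sequentially. nsq lborel (fourier_int (trunc (real n) g)) \<le> nsq lborel g"
      by (intro always_eventually allI order_trans[OF nsq_fourier_int_le] nsq_mono integrable_trunc g)
         (auto simp: cmod_trunc_le)
  qed auto
  then have "sq_integrable lborel h"
    using sq_integrableD(2)[OF g] h(1) by (auto simp: sq_integrable_iff_nsq)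
  from is_fourierI_seq[OF g this filterlim_real_sequentially lim] that show ?thesis by blast
qed

lemma is_fourier_unique:
  assumes "is_fourier g h" "is_fourier g k"
  shows "AE \<xi> in lborel. h \<xi> = k \<xi>"
proof -
  note [measurable] = is_fourierD(3,4)[OF assms(1)] is_fourierD(4)[OF assms(2)]
  show ?thesis
    by (rule nsq_limit_unique[where F = at_top and f = "\<lambda>R. fourier_int (trunc R g)"])
       (use is_fourierD(5)[OF assms(1)] is_fourierD(5)[OF assms(2)] in \<open>auto simp: nsq_diff_commute[of _ "fourier_int (trunc _ g)"]\<close>)
qed

text \<open>The integral transform does not see null sets of g, so equality holds at every frequency
  and not just almost everywhere.\<close>

lemma trunc_cong_AE:
  assumes "AE x in lborel. g x = g' x" and [measurable]: "g \<in> borel_measurable borel" "g' \<in> borel_measurable borel"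
  shows "fourier_int (trunc R g) = fourier_int (trunc R g')"
  unfolding fourier_int_def[abs_def]
  by (intro ext arg_cong2[where f = times] refl integral_cong_AE) (use assms(1) in \<open>auto simp: trunc_def elim: eventually_mono\<close>)

lemma is_fourier_cong_AE:
  assumes gh: "is_fourier g h"
    and g': "g' \<in> borel_measurable borel" "AE x in lborel. g x = g' x"
    and h': "h' \<in> borel_measurable borel" "AE x in lborel. h x = h' x"
  shows "is_fourier g' h'"
proof -
  have "nsq lborel (\<lambda>\<xi>. h' \<xi> - fourier_int (trunc R g') \<xi>) = nsq lborel (\<lambda>\<xi>. h \<xi> - fourier_int (trunc R g) \<xi>)" for R
    unfolding trunc_cong_AE[OF g'(2) is_fourierD(3)[OF gh] g'(1)] by (rule nsq_cong_AE) (use h' in auto)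
  then show ?thesis
    using gh g' h' nsq_cong_AE[OF g'(2)] nsq_cong_AE[OF h'(2)] by (auto simp: is_fourier_iff sq_integrable_iff_nsq)
qed

lemma is_fourier_add:
  assumes "is_fourier g h" "is_fourier g' h'"
  shows "is_fourier (\<lambda>x. g x + g' x) (\<lambda>x. h x + h' x)"
  unfolding is_fourier_iff
proof (intro conjI sq_integrable_add is_fourierD[OF assms(1)] is_fourierD[OF assms(2)])
  note [measurable] = is_fourierD(3,4)[OF assms(1)] is_fourierD(3,4)[OF assms(2)]
  have eq: "fourier_int (trunc R (\<lambda>x. g x + g' x)) \<xi> = fourier_int (trunc R g) \<xi> + fourier_int (trunc R g') \<xi>" for R \<xi>
  proof -
    have "trunc R (\<lambda>x. g x + g' x) = (\<lambda>x. trunc R g x + trunc R g' x)"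
      by (rule ext) (simp add: trunc_def distrib_left)
    then show ?thesis
      using fourier_int_add[OF integrable_trunc integrable_trunc, OF is_fourierD(1) is_fourierD(1), OF assms] by simp
  qed
  show "((\<lambda>R. nsq lborel (\<lambda>\<xi>. h \<xi> + h' \<xi> - fourier_int (trunc R (\<lambda>x. g x + g' x)) \<xi>)) \<longlongrightarrow> 0) at_top"
  proof (rule tendsto_0_le_add2[OF is_fourierD(5)[OF assms(1)] is_fourierD(5)[OF assms(2)]], intro always_eventually allI)
    fix R
    show "nsq lborel (\<lambda>\<xi>. h \<xi> + h' \<xi> - fourier_int (trunc R (\<lambda>x. g x + g' x)) \<xi>)
       \<le> 2 * nsq lborel (\<lambda>\<xi>. h \<xi> - fourier_int (trunc R g) \<xi>) + 2 * nsq lborel (\<lambda>\<xi>. h' \<xi> - fourier_int (trunc R g') \<xi>)"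
      unfolding eq using nsq_add_le[of "\<lambda>\<xi>. h \<xi> - fourier_int (trunc R g) \<xi>" lborel "\<lambda>\<xi>. h' \<xi> - fourier_int (trunc R g') \<xi>"]
      by (simp add: algebra_simps)
  qed
qed

lemma is_fourier_cmult:
  assumes "is_fourier g h"
  shows "is_fourier (\<lambda>x. c * g x) (\<lambda>x. c * h x)"
  unfolding is_fourier_iff
proof (intro conjI sq_integrable_cmult is_fourierD[OF assms(1)])
  note [measurable] = is_fourierD(3,4)[OF assms(1)]
  have eq: "fourier_int (trunc R (\<lambda>x. c * g x)) \<xi> = c * fourier_int (trunc R g) \<xi>" for R \<xi>
    by (subst fourier_int_cmult[symmetric]) (simp add: trunc_def[abs_def] mult_ac)
  have "nsq lborel (\<lambda>\<xi>. c * h \<xi> - fourier_int (trunc R (\<lambda>x. c * g x)) \<xi>) = ennreal ((cmod c)\<^sup>2) * nsq lborel (\<lambda>\<xi>. h \<xi> - fourier_int (trunc R g) \<xi>)" for R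
    unfolding eq right_diff_distrib[symmetric] by (rule nsq_cmult) measurable
  moreover have "((\<lambda>R. ennreal ((cmod c)\<^sup>2) * nsq lborel (\<lambda>\<xi>. h \<xi> - fourier_int (trunc R g) \<xi>)) \<longlongrightarrow> ennreal ((cmod c)\<^sup>2) * 0) at_top"
    by (intro ennreal_tendsto_cmult is_fourierD assms) auto
  ultimately show "((\<lambda>R. nsq lborel (\<lambda>\<xi>. c * h \<xi> - fourier_int (trunc R (\<lambda>x. c * g x)) \<xi>)) \<longlongrightarrow> 0) at_top"
    by simp
qed

lemma is_fourier_diff:
  assumes "is_fourier g h" "is_fourier g' h'"
  shows "is_fourier (\<lambda>x. g x - g' x) (\<lambda>x. h x - h' x)"
  using is_fourier_add[OF assms(1) is_fourier_cmult[OF assms(2), of "-1"]] by simp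

lemma sq_integrable_lborel_uminus:
  fixes g :: "real \<Rightarrow> complex"
  shows "sq_integrable lborel g \<Longrightarrow> sq_integrable lborel (\<lambda>x. g (- x))"
  by (auto simp: sq_integrable_iff_nsq nsq_lborel_uminus)

lemma is_fourier_reflect:
  assumes "is_fourier g h"
  shows "is_fourier (\<lambda>x. g (- x)) (\<lambda>x. h (- x))"
  unfolding is_fourier_iff
proof (intro conjI sq_integrable_lborel_uminus is_fourierD[OF assms(1)])
  note [measurable] = is_fourierD(3,4)[OF assms(1)]
  have "nsq lborel (\<lambda>\<xi>. h (- \<xi>) - fourier_int (trunc R (\<lambda>x. g (- x))) \<xi>) = nsq lborel (\<lambda>\<xi>. h \<xi> - fourier_int (trunc R g) \<xi>)" for R
  proof -
    have "trunc R (\<lambda>x. g (- x)) = (\<lambda>x. trunc R g (- x))" by (rule ext) (auto simp: trunc_def indicator_def)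
    then show ?thesis
      using nsq_lborel_uminus[of "\<lambda>\<xi>. h \<xi> - fourier_int (trunc R g) \<xi>"] by (simp add: fourier_int_reflect)
  qed
  with is_fourierD(5)[OF assms] show "((\<lambda>R. nsq lborel (\<lambda>\<xi>. h (- \<xi>) - fourier_int (trunc R (\<lambda>x. g (- x))) \<xi>)) \<longlongrightarrow> 0) at_top"
    by simp
qed

text \<open>Conjugating the phase reflects the frequency. This symmetry later characterises
  real-valued functions on the Fourier side.\<close>

lemma is_fourier_cnj:
  assumes "is_fourier g h"
  shows "is_fourier (\<lambda>x. cnj (g x)) (\<lambda>x. cnj (h (- x)))"
  unfolding is_fourier_iff
proof (intro conjI)
  note [measurable] = is_fourierD(3,4)[OF assms(1)]
  show "sq_integrable lborel (\<lambda>x. cnj (g x))" "sq_integrable lborel (\<lambda>x. cnj (h (- x)))"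
    by (rule sq_integrable_bound[OF is_fourierD(1)[OF assms]] sq_integrable_bound[OF sq_integrable_lborel_uminus[OF is_fourierD(2)[OF assms]]]; simp)+
  have "nsq lborel (\<lambda>\<xi>. cnj (h (- \<xi>)) - fourier_int (trunc R (\<lambda>x. cnj (g x))) \<xi>) = nsq lborel (\<lambda>\<xi>. h \<xi> - fourier_int (trunc R g) \<xi>)" for R
  proof -
    have "trunc R (\<lambda>x. cnj (g x)) = (\<lambda>x. cnj (trunc R g x))" by (rule ext) (auto simp: trunc_def indicator_def)
    then have "nsq lborel (\<lambda>\<xi>. cnj (h (- \<xi>)) - fourier_int (trunc R (\<lambda>x. cnj (g x))) \<xi>) = nsq lborel (\<lambda>\<xi>. h (- \<xi>) - fourier_int (trunc R g) (- \<xi>))"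
      by (simp add: fourier_int_cnj nsq_def flip: complex_cnj_diff)
    then show ?thesis
      using nsq_lborel_uminus[of "\<lambda>\<xi>. h \<xi> - fourier_int (trunc R g) \<xi>"] by simp
  qed
  with is_fourierD(5)[OF assms] show "((\<lambda>R. nsq lborel (\<lambda>\<xi>. cnj (h (- \<xi>)) - fourier_int (trunc R (\<lambda>x. cnj (g x))) \<xi>)) \<longlongrightarrow> 0) at_top"
    by simp
qed

text \<open>On the intersection of L1 and L2 both notions of transform agree: the error is the
  transform of the tail, and contractivity bounds it by the tail.\<close>

lemma is_fourier_fourier_int:
  assumes g: "sq_integrable lborel g" "integrable lborel g"
  shows "is_fourier g (fourier_int g)"
proof -
  note [measurable] = sq_integrableD(1)[OF g(1), simplified]
  have le: "nsq lborel (\<lambda>\<xi>. fourier_int g \<xi> - fourier_int (trunc R g) \<xi>) \<le> nsq lborel (\<lambda>x. g x - trunc R g x)" for R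
    using nsq_fourier_int_le[OF Bochner_Integration.integrable_diff[OF g(2) integrable_trunc[OF g(1), of R]]]
    by (simp add: fourier_int_diff[OF g(2) integrable_trunc[OF g(1)], abs_def])
  have "((\<lambda>R. nsq lborel (\<lambda>\<xi>. fourier_int g \<xi> - fourier_int (trunc R g) \<xi>)) \<longlongrightarrow> 0) at_top"
    by (rule tendsto_sandwich[OF _ _ tendsto_const trunc_tail_tendsto_0[OF g(1)]]) (auto simp: le)
  moreover have "sq_integrable lborel (fourier_int g)"
    using nsq_fourier_int_le[OF g(2)] sq_integrableD(2)[OF g(1)] by (auto simp: sq_integrable_iff_nsq)
  ultimately show ?thesis using g by (simp add: is_fourier_iff)
qed

section \<open>Fourier inversion and the Plancherel theorem\<close>

lemma interval_mass_eq:
  assumes \<sigma>: "\<sigma> > 0"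
  shows "(\<integral>x. indicator {a..b} x * normal_density y \<sigma> x \<partial>lborel) = (\<integral>z. indicator {a..b} (y + \<sigma> * z) * std_normal_density z \<partial>lborel)"
proof -
  have n: "\<sigma> * normal_density y \<sigma> (y + \<sigma> * z) = std_normal_density z" for z
  proof -
    have "sqrt (2 * pi * \<sigma>\<^sup>2) = sqrt (2 * pi) * \<sigma>" using \<sigma> by (simp add: real_sqrt_mult)
    then show ?thesis
      using \<sigma> by (simp add: normal_density_def std_normal_density_def power_mult_distrib del: real_sqrt_mult)
  qed
  have "(\<integral>x. indicator {a..b} x * normal_density y \<sigma> x \<partial>lborel) = \<sigma> * (\<integral>z. indicator {a..b} (y + \<sigma> * z) * normal_density y \<sigma> (y + \<sigma> * z) \<partial>lborel)"
    using lborel_integral_real_affine[of \<sigma> "\<lambda>x. indicator {a..b} x * normal_density y \<sigma> x" y] \<sigma> by simp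
  also have "\<dots> = (\<integral>z. \<sigma> * (indicator {a..b} (y + \<sigma> * z) * normal_density y \<sigma> (y + \<sigma> * z)) \<partial>lborel)"
    by (rule integral_mult_right_zero[symmetric])
  also have "\<dots> = (\<integral>z. indicator {a..b} (y + \<sigma> * z) * (\<sigma> * normal_density y \<sigma> (y + \<sigma> * z)) \<partial>lborel)"
    by (simp only: mult.left_commute)
  finally show ?thesis by (simp only: n)
qed

text \<open>The substitution x = y + \<sigma> z freezes the Gaussian, and only the indicator moves.
  It converges wherever the indicator is continuous, whence the exclusion of the end points.\<close>

lemma interval_mass_tendsto:
  assumes "y \<noteq> a" "y \<noteq> b"
  shows "(\<lambda>n. \<integral>x. indicator {a..b} x * normal_density y (1 / real (Suc n)) x \<partial>lborel) \<longlonglongrightarrow> indicator {a..b} y"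
proof -
  have "(\<lambda>n. \<integral>z. indicator {a..b} (y + 1 / real (Suc n) * z) * std_normal_density z \<partial>lborel) \<longlonglongrightarrow> (\<integral>z. indicator {a..b} y * std_normal_density z \<partial>lborel)"
  proof (rule integral_dominated_convergence[where w = std_normal_density])
    show "AE z in lborel. (\<lambda>n. indicator {a..b} (y + 1 / real (Suc n) * z) * std_normal_density z) \<longlonglongrightarrow> indicator {a..b} y * std_normal_density z"
    proof (intro AE_I2 tendsto_mult tendsto_const tendsto_eventually)
      fix z :: real
      have "(\<lambda>n. 1 / real (Suc n)) \<longlonglongrightarrow> 0" by (rule LIMSEQ_Suc[OF lim_1_over_n])
      then have lim: "(\<lambda>n. y + 1 / real (Suc n) * z) \<longlonglongrightarrow> y + 0 * z" by (intro tendsto_intros)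
      have "\<forall>\<^sub>F n in sequentially. (a < y \<longrightarrow> a < y + 1 / real (Suc n) * z) \<and> (y < a \<longrightarrow> y + 1 / real (Suc n) * z < a)
          \<and> (b < y \<longrightarrow> b < y + 1 / real (Suc n) * z) \<and> (y < b \<longrightarrow> y + 1 / real (Suc n) * z < b)"
        using order_tendstoD[OF lim] by (intro eventually_conj) (cases "a < y"; cases "y < a"; cases "b < y"; cases "y < b"; simp)+
      then show "\<forall>\<^sub>F n in sequentially. indicat_real {a..b} (y + 1 / real (Suc n) * z) = indicator {a..b} y"
        by eventually_elim (use assms in \<open>auto simp: indicator_def\<close>)
    qed
  qed (auto simp: indicator_def)
  then show ?thesis by (simp add: interval_mass_eq)
qed

lemma interval_mass_bounds:
  assumes \<sigma>: "\<sigma> > 0"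
  shows "0 \<le> (\<integral>x. indicator {a..b} x * normal_density y \<sigma> x \<partial>lborel)" (is "0 \<le> ?m")
    and "(\<integral>x. indicator {a..b} x * normal_density y \<sigma> x \<partial>lborel) \<le> 1"
proof -
  show "0 \<le> ?m" by (intro Bochner_Integration.integral_nonneg) auto
  have "?m \<le> (\<integral>x. normal_density y \<sigma> x \<partial>lborel)"
  proof (rule integral_mono)
    show "integrable lborel (\<lambda>x. indicator {a..b} x * normal_density y \<sigma> x)"
      by (rule Bochner_Integration.integrable_bound[OF integrable_normal_density[OF \<sigma>, of y]]) (auto simp: indicator_def)
  qed (use \<sigma> in \<open>auto simp: indicator_def\<close>)
  then show "?m \<le> 1" using \<sigma> by simp
qed

text \<open>Here k is the double transform of g. The damped transforms \<open>h n\<close> converge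
  to \<open>fourier_int g\<close> in L2, so by contractivity their transforms, which are reflected
  mollifications of g, converge to k. Comparing integrals over intervals identifies k without any
  pointwise convergence of the mollifications of g.\<close>

lemma fourier_inversion_integrable:
  assumes g: "sq_integrable lborel g" "integrable lborel g" and k: "is_fourier (fourier_int g) k"
  shows "AE x in lborel. k x = g (- x)"
proof -
  note [measurable] = sq_integrableD(1)[OF g(1), simplified] is_fourierD(4)[OF k]
  define s where "s n = 1 / real (Suc n)" for n
  have s: "s n > 0" for n unfolding s_def by simp
  define h where "h n \<xi> = complex_of_real (gauss (s n) \<xi>) * fourier_int g \<xi>" for n \<xi>
  have [measurable]: "h n \<in> borel_measurable borel" for n unfolding h_def[abs_def] by measurable
  have hL2: "sq_integrable lborel (h n)" for n
    by (rule sq_integrable_bound[OF is_fourierD(1)[OF k]]) (auto simp: h_def norm_mult gauss_nonneg intro!: mult_left_le_one_le gauss_le_1)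
  define B where "B = 1 / sqrt (2 * pi) * (\<integral>x. cmod (g x) \<partial>lborel)"
  have B: "cmod (fourier_int g \<xi>) \<le> B" for \<xi> unfolding B_def by (rule fourier_int_bound)
  have B0: "B \<ge> 0" using order_trans[OF norm_ge_zero B] .
  have hL1: "integrable lborel (h n)" for n
    by (rule Bochner_Integration.integrable_bound[where f = "\<lambda>\<xi>. B * gauss (s n) \<xi>"])
       (use B B0 in \<open>auto simp: h_def integrable_gauss[OF s] norm_mult gauss_nonneg abs_mult mult.commute[of B] intro!: mult_left_mono\<close>)
  have Fh: "fourier_int (h n) x = mollify (s n) g (- x)" for n x
    using fourier_int_gauss_mult[OF s g(2), of n "- x"] by (simp add: h_def[abs_def])
  have "(\<lambda>n. nsq lborel (\<lambda>\<xi>. h n \<xi> - fourier_int g \<xi>)) \<longlonglongrightarrow> (\<integral>\<^sup>+(x::real). 0 \<partial>lborel)"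
    unfolding nsq_def
  proof (rule nn_integral_dominated_convergence[where w = "\<lambda>x. ennreal ((cmod (fourier_int g x))\<^sup>2)"])
    show "(\<integral>\<^sup>+x. ennreal ((cmod (fourier_int g x))\<^sup>2) \<partial>lborel) < \<infinity>"
      using sq_integrableD(2)[OF is_fourierD(1)[OF k]] by (simp add: nsq_def)
    have eq: "h n \<xi> - fourier_int g \<xi> = - (complex_of_real (1 - gauss (s n) \<xi>) * fourier_int g \<xi>)" for n \<xi>
      by (simp add: h_def algebra_simps)
    show "AE \<xi> in lborel. ennreal ((cmod (h n \<xi> - fourier_int g \<xi>))\<^sup>2) \<le> ennreal ((cmod (fourier_int g \<xi>))\<^sup>2)" for n
      unfolding eq norm_minus_cancel norm_mult norm_of_real
      using gauss_nonneg gauss_le_1 by (intro AE_I2 ennreal_leI power_mono mult_left_le_one_le) (auto simp: abs_le_iff)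
    show "AE \<xi> in lborel. (\<lambda>n. ennreal ((cmod (h n \<xi> - fourier_int g \<xi>))\<^sup>2)) \<longlonglongrightarrow> 0"
    proof (rule AE_I2)
      fix \<xi>
      have "(\<lambda>n. ennreal ((cmod (h n \<xi> - fourier_int g \<xi>))\<^sup>2)) \<longlonglongrightarrow> ennreal ((cmod (of_real 1 * fourier_int g \<xi> - fourier_int g \<xi>))\<^sup>2)"
        unfolding h_def s_def by (intro tendsto_ennrealI tendsto_intros gauss_tendsto_1)
      then show "(\<lambda>n. ennreal ((cmod (h n \<xi> - fourier_int g \<xi>))\<^sup>2)) \<longlonglongrightarrow> 0" by simp
    qed
  qed measurable
  then have h0: "(\<lambda>n. nsq lborel (\<lambda>\<xi>. h n \<xi> - fourier_int g \<xi>)) \<longlonglongrightarrow> 0" by simp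
  have le: "nsq lborel (\<lambda>x. fourier_int (h n) x - k x) \<le> nsq lborel (\<lambda>\<xi>. h n \<xi> - fourier_int g \<xi>)" for n
    by (rule is_fourier_nsq_le[OF is_fourier_diff[OF is_fourier_fourier_int[OF hL2 hL1] k]])
  have k0: "(\<lambda>n. nsq lborel (\<lambda>x. fourier_int (h n) x - k x)) \<longlonglongrightarrow> 0"
    by (rule tendsto_sandwich[OF _ _ tendsto_const h0]) (auto simp: le)
  have gr: "sq_integrable lborel (\<lambda>x. g (- x))" by (rule sq_integrable_lborel_uminus[OF g(1)])
  have FhL2: "sq_integrable lborel (fourier_int (h n))" for n
    by (rule is_fourierD(2)[OF is_fourier_fourier_int[OF hL2 hL1]])
  have "AE x in lborel. k x - g (- x) = 0"
  proof (rule AE_zero_if_interval_integrals_zero_L2)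
    show "sq_integrable lborel (\<lambda>x. k x - g (- x))"
      by (intro sq_integrable_diff gr is_fourierD(2)[OF k])
    fix a b :: real assume ab: "a < b"
    let ?I = "\<lambda>x. indicator {a..b} x :: complex"
    note int = integrable_mult_sq_integrable[OF sq_integrable_indicator]
    \<comment> \<open>Cauchy-Schwarz against the indicator turns L2 convergence into convergence of
      integrals over [a, b].\<close>
    have lim1: "(\<lambda>n. \<integral>x. ?I x * fourier_int (h n) x \<partial>lborel) \<longlonglongrightarrow> (\<integral>x. ?I x * k x \<partial>lborel)"
    proof -
      have "(\<lambda>n. ennreal ((cmod ((\<integral>x. ?I x * fourier_int (h n) x \<partial>lborel) - (\<integral>x. ?I x * k x \<partial>lborel)))\<^sup>2)) \<longlonglongrightarrow> 0"
      proof (rule tendsto_sandwich[OF _ _ tendsto_const])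
        show "(\<lambda>n. nsq lborel ?I * nsq lborel (\<lambda>x. fourier_int (h n) x - k x)) \<longlonglongrightarrow> 0"
          using ennreal_tendsto_cmult[OF nsq_indicator_bounded[unfolded infinity_ennreal_def] k0, of a b] by simp
        show "\<forall>\<^sub>F n in sequentially. ennreal ((cmod ((\<integral>x. ?I x * fourier_int (h n) x \<partial>lborel) - (\<integral>x. ?I x * k x \<partial>lborel)))\<^sup>2) \<le> nsq lborel ?I * nsq lborel (\<lambda>x. fourier_int (h n) x - k x)"
        proof (intro always_eventually allI)
          fix n
          have "(\<integral>x. ?I x * fourier_int (h n) x \<partial>lborel) - (\<integral>x. ?I x * k x \<partial>lborel) = (\<integral>x. ?I x * (fourier_int (h n) x - k x) \<partial>lborel)"
            unfolding right_diff_distrib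
            by (rule Bochner_Integration.integral_diff[symmetric]) (intro int FhL2 is_fourierD(2)[OF k])+
          then show "ennreal ((cmod ((\<integral>x. ?I x * fourier_int (h n) x \<partial>lborel) - (\<integral>x. ?I x * k x \<partial>lborel)))\<^sup>2) \<le> nsq lborel ?I * nsq lborel (\<lambda>x. fourier_int (h n) x - k x)"
            by (simp only:) (rule cmod_integral_mult_sq_le; measurable)
        qed
      qed auto
      then have "(\<lambda>n. (cmod ((\<integral>x. ?I x * fourier_int (h n) x \<partial>lborel) - (\<integral>x. ?I x * k x \<partial>lborel)))\<^sup>2) \<longlonglongrightarrow> 0"
        by (simp add: ennreal_0[symmetric] tendsto_ennreal_iff del: ennreal_0)
      then have "(\<lambda>n. cmod ((\<integral>x. ?I x * fourier_int (h n) x \<partial>lborel) - (\<integral>x. ?I x * k x \<partial>lborel))) \<longlonglongrightarrow> 0"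
        by (subst (asm) power_tendsto_0_iff) auto
      then show ?thesis by (subst Lim_null) (rule tendsto_norm_zero_cancel)
    qed
    \<comment> \<open>Fubini moves the mollification from g to the indicator: \<open>m n y\<close>
      is the mass that a Gaussian centred at -y puts on [a, b]. It lies between 0 and 1 and
      converges off the end points, so |g| dominates the integrand.\<close>
    define m where "m n y = (\<integral>x. indicator {a..b} x * normal_density (- y) (s n) x \<partial>lborel)" for n y
    have mm [measurable]: "m n \<in> borel_measurable borel" for n
      unfolding m_def[abs_def] normal_density_def by measurable
    have m01: "0 \<le> m n y" "m n y \<le> 1" for n y
      unfolding m_def by (rule interval_mass_bounds[OF s])+
    have pos: "normal_density (- x) (s n) y = normal_density (- y) (s n) x" for x y n
      by (simp add: normal_density_def power2_commute)
         (metis (no_types, opaque_lifting) add.commute)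
    have eq: "(\<integral>x. ?I x * fourier_int (h n) x \<partial>lborel) = (\<integral>y. g y * complex_of_real (m n y) \<partial>lborel)" for n
    proof -
      let ?f = "\<lambda>y x. g y * complex_of_real (indicator {a..b} x * normal_density (- y) (s n) x)"
      have "integrable lborel (\<lambda>x. indicator {a..b} x * normal_density (- y) (s n) x)" for y
        by (rule Bochner_Integration.integrable_bound[OF integrable_normal_density[OF s, of "- y" n]]) (auto simp: indicator_def)
      then have i1: "integrable lborel (\<lambda>x. ?f y x)" for y
        by (intro integrable_mult_right integrable_of_real)
      have i2: "integrable lborel (\<lambda>y. \<integral>x. norm (?f y x) \<partial>lborel)"
      proof (rule Bochner_Integration.integrable_bound[OF integrable_norm[OF g(2)]])
        have "(\<integral>x. norm (?f y x) \<partial>lborel) = norm (g y) * m n y" for y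
          unfolding m_def by (subst integral_mult_right_zero[symmetric]) (simp add: norm_mult abs_mult)
        then show "AE y in lborel. norm (\<integral>x. norm (?f y x) \<partial>lborel) \<le> norm (norm (g y))"
          using m01 by (auto simp: abs_mult intro!: mult_right_le_one_le)
      qed (unfold normal_density_def, measurable)
      have i3: "integrable (lborel \<Otimes>\<^sub>M lborel) (case_prod ?f)"
        by (rule lborel_pair.Fubini_integrable) (use i1 i2 in \<open>auto simp: normal_density_def\<close>)
      have "(\<integral>x. ?I x * fourier_int (h n) x \<partial>lborel) = (\<integral>x. (\<integral>y. ?f y x \<partial>lborel) \<partial>lborel)"
      proof (intro Bochner_Integration.integral_cong refl)
        fix x :: real
        have "?I x * fourier_int (h n) x = (\<integral>y. ?I x * (g y * complex_of_real (normal_density (- x) (s n) y)) \<partial>lborel)"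
          by (simp add: Fh mollify_def)
        also have "\<dots> = (\<integral>y. ?f y x \<partial>lborel)"
          by (intro Bochner_Integration.integral_cong refl) (auto simp: pos[of x] indicator_def)
        finally show "?I x * fourier_int (h n) x = (\<integral>y. ?f y x \<partial>lborel)" .
      qed
      also have "\<dots> = (\<integral>y. (\<integral>x. ?f y x \<partial>lborel) \<partial>lborel)"
        by (rule lborel_pair.Fubini_integral[OF i3])
      also have "\<dots> = (\<integral>y. g y * complex_of_real (m n y) \<partial>lborel)"
        unfolding m_def by (simp only: integral_mult_right_zero integral_complex_of_real)
      finally show ?thesis .
    qed
    have lim2: "(\<lambda>n. \<integral>x. ?I x * fourier_int (h n) x \<partial>lborel) \<longlonglongrightarrow> (\<integral>y. g y * complex_of_real (indicator {a..b} (- y)) \<partial>lborel)"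
      unfolding eq
    proof (rule integral_dominated_convergence[where w = "\<lambda>y. norm (g y)"])
      show "integrable lborel (\<lambda>y. norm (g y))" using g(2) by (rule integrable_norm)
      show "AE y in lborel. norm (g y * complex_of_real (m n y)) \<le> norm (g y)" for n
        using m01 by (auto simp: norm_mult intro!: mult_right_le_one_le)
      have "AE y in lborel. y \<noteq> - a \<and> y \<noteq> - b"
        using AE_lborel_singleton[of "- a"] AE_lborel_singleton[of "- b"] by eventually_elim auto
      then show "AE y in lborel. (\<lambda>n. g y * complex_of_real (m n y)) \<longlonglongrightarrow> g y * complex_of_real (indicator {a..b} (- y))"
      proof eventually_elim
        case (elim y)
        then have "- y \<noteq> a" "- y \<noteq> b" by auto
        from interval_mass_tendsto[OF this] show ?case
          unfolding m_def s_def by (intro tendsto_intros)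
      qed
    qed measurable
    have "(\<integral>y. g y * complex_of_real (indicator {a..b} (- y)) \<partial>lborel) = (\<integral>x. ?I x * g (- x) \<partial>lborel)"
    proof -
      have "(\<integral>y. g y * complex_of_real (indicator {a..b} (- y)) \<partial>lborel) = (\<integral>y. ?I (- y) * g y \<partial>lborel)"
        by (intro Bochner_Integration.integral_cong) (auto simp: indicator_def)
      also have "\<dots> = (\<integral>x. ?I x * g (- x) \<partial>lborel)"
        using integral_lborel_uminus[of "\<lambda>x. ?I (- x) * g x"] by (simp only: minus_minus)
      finally show ?thesis .
    qed
    with LIMSEQ_unique[OF lim1 lim2] have "(\<integral>x. ?I x * k x \<partial>lborel) = (\<integral>x. ?I x * g (- x) \<partial>lborel)" by simp
    then show "(\<integral>x. ?I x * (k x - g (- x)) \<partial>lborel) = 0"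
      unfolding right_diff_distrib
      by (subst Bochner_Integration.integral_diff) (auto intro!: int gr is_fourierD(2)[OF k])
  qed
  then show ?thesis by simp
qed

text \<open>Truncations of g lie in L1 and L2, where inversion is known. Contractivity applied once
  more shows that their double transforms converge to the double transform of g, while by the tail
  estimate they converge to g reflected.\<close>

theorem fourier_inversion:
  assumes "is_fourier g h"
  shows "is_fourier h (\<lambda>x. g (- x))"
proof -
  note g = is_fourierD(1)[OF assms] and h = is_fourierD(2)[OF assms]
  note [measurable] = is_fourierD(3,4)[OF assms]
  obtain k where k: "is_fourier h k" using is_fourier_exists[OF h] .
  note [measurable] = is_fourierD(4)[OF k]
  have t: "is_fourier (fourier_int (trunc R g)) (\<lambda>x. trunc R g (- x))" for R
  proof -
    have F: "is_fourier (trunc R g) (fourier_int (trunc R g))"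
      by (intro is_fourier_fourier_int sq_integrable_trunc integrable_trunc g)
    obtain l where l: "is_fourier (fourier_int (trunc R g)) l"
      using is_fourier_exists[OF is_fourierD(2)[OF F]] .
    have "AE x in lborel. l x = trunc R g (- x)"
      by (rule fourier_inversion_integrable[OF _ _ l]) (intro sq_integrable_trunc integrable_trunc g)+
    then show ?thesis by (intro is_fourier_cong_AE[OF l]) auto
  qed
  have "nsq lborel (\<lambda>x. k x - trunc R g (- x)) \<le> nsq lborel (\<lambda>\<xi>. h \<xi> - fourier_int (trunc R g) \<xi>)" for R
    by (rule is_fourier_nsq_le[OF is_fourier_diff[OF k t]])
  then have k0: "((\<lambda>R. nsq lborel (\<lambda>x. k x - trunc R g (- x))) \<longlongrightarrow> 0) at_top"
    by (intro tendsto_sandwich[OF _ _ tendsto_const is_fourierD(5)[OF assms]]) auto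
  have "nsq lborel (\<lambda>x. g (- x) - trunc R g (- x)) = nsq lborel (\<lambda>x. g x - trunc R g x)" for R
    using nsq_lborel_uminus[of "\<lambda>x. g x - trunc R g x"] by simp
  then have g0: "((\<lambda>R. nsq lborel (\<lambda>x. g (- x) - trunc R g (- x))) \<longlongrightarrow> 0) at_top"
    using trunc_tail_tendsto_0[OF g] by simp
  have "AE x in lborel. k x = g (- x)"
    by (rule nsq_limit_unique[where F = at_top and f = "\<lambda>R x. trunc R g (- x)"])
       (use k0 g0 in \<open>auto simp: nsq_diff_commute[of _ "\<lambda>x. trunc _ g (- x)"]\<close>)
  then show ?thesis by (intro is_fourier_cong_AE[OF k]) auto
qed

text \<open>Contractivity in both directions: inversion exhibits g, up to reflection, as the
  transform of h.\<close>

theorem plancherel: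
  assumes "is_fourier g h"
  shows "nsq lborel h = nsq lborel g"
proof (rule antisym[OF is_fourier_nsq_le[OF assms]])
  show "nsq lborel g \<le> nsq lborel h"
    using is_fourier_nsq_le[OF fourier_inversion[OF assms]] nsq_lborel_uminus[OF is_fourierD(3)[OF assms]] by simp
qed

lemma is_fourier_inj:
  assumes "is_fourier g h" "is_fourier g' h'" "AE \<xi> in lborel. h \<xi> = h' \<xi>"
  shows "AE x in lborel. g x = g' x"
proof -
  note [measurable] = is_fourierD(3,4)[OF assms(1)] is_fourierD(3,4)[OF assms(2)]
  have "nsq lborel (\<lambda>x. h x - h' x) = 0"
    using assms(3) by (subst nsq_eq_0_iff) auto
  then have "nsq lborel (\<lambda>x. g x - g' x) = 0"
    using plancherel[OF is_fourier_diff[OF assms(1,2)]] by simp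
  then show ?thesis by (subst (asm) nsq_eq_0_iff) auto
qed

section \<open>The Fourier transform in the space variable\<close>

lemma finite_measure_time: "finite_measure (time T)"
proof
  have "emeasure (time T) (space (time T)) = emeasure lborel {0<..<T}"
    by (simp add: emeasure_restrict_space space_restrict_space)
  then show "emeasure (time T) (space (time T)) \<noteq> \<infinity>"
    by (cases "0 \<le> T") auto
qed

lemma sigma_finite_time: "sigma_finite_measure (time T)"
  using finite_measure_time by (rule finite_measure.axioms(1))

lemma pair_strip: "pair_sigma_finite (time T) lborel"
  by (intro pair_sigma_finite.intro sigma_finite_time sigma_finite_lborel)

lemma space_time: "space (time T) = {0<..<T}"
  by (simp add: space_restrict_space)

lemma measurable_time: "f \<in> borel_measurable borel \<Longrightarrow> f \<in> borel_measurable (time T)"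
  by (intro measurable_restrict_space1) auto

lemma measurable_time_ident: "(\<lambda>t. t) \<in> borel_measurable (time T)"
  by (intro measurable_restrict_space1) auto

lemma AE_time_iff: "(AE t in time T. P t) \<longleftrightarrow> (AE t in lborel. t \<in> {0<..<T} \<longrightarrow> P t)"
  by (rule AE_restrict_space_iff) auto

lemma AE_space_time: "AE t in time T. t \<in> {0<..<T}"
  using AE_space[of "time T"] by (simp add: space_time)

lemma sq_integrable_time_const: "sq_integrable (time T) (\<lambda>t. c)"
  using finite_measure.emeasure_finite[OF finite_measure_time, of T "space (time T)"]
  by (simp add: sq_integrable_iff_nsq nsq_def less_top ennreal_mult_less_top)

(* The simproc does not terminate on measurability of curried functions of (t, x). *)
declare [[simproc del: measurable]]

lemma measurable_uncurry:
  assumes "case_prod u \<in> M \<Otimes>\<^sub>M N \<rightarrow>\<^sub>M L" "f \<in> K \<rightarrow>\<^sub>M M" "g \<in> K \<rightarrow>\<^sub>M N"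
  shows "(\<lambda>k. u (f k) (g k)) \<in> K \<rightarrow>\<^sub>M L"
  using measurable_compose[OF measurable_Pair[OF assms(2,3)] assms(1)] by (simp only: prod.case)

lemma strip_section1:
  assumes "case_prod u \<in> borel_measurable (strip T)" "t \<in> {0<..<T}"
  shows "u t \<in> borel_measurable borel"
proof -
  have "(\<lambda>x. u t x) \<in> borel_measurable lborel"
    by (rule measurable_uncurry[OF assms(1) measurable_const measurable_ident_sets[OF refl]])
       (use assms(2) in \<open>simp only: space_time\<close>)
  then show ?thesis by (simp only: measurable_lborel2)
qed

lemma strip_section2:
  assumes "case_prod u \<in> borel_measurable (strip T)"
  shows "(\<lambda>t. u t x) \<in> borel_measurable (time T)"
  by (rule measurable_uncurry[OF assms measurable_ident_sets[OF refl] measurable_const]) (simp only: space_lborel space_borel UNIV_I)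

lemma strip_swap:
  assumes "case_prod u \<in> borel_measurable (strip T)"
  shows "(\<lambda>(x, t). u t x) \<in> borel_measurable (lborel \<Otimes>\<^sub>M time T)"
  using measurable_uncurry[OF assms measurable_snd measurable_fst] by (simp only: case_prod_beta')

lemma measurable_strip_borel:
  assumes "case_prod f \<in> borel_measurable (borel \<Otimes>\<^sub>M borel)"
  shows "case_prod f \<in> borel_measurable (strip T)"
proof -
  have "(\<lambda>k. f (fst k) (snd k)) \<in> borel_measurable (strip T)"
    by (rule measurable_uncurry[OF assms measurable_compose[OF measurable_fst measurable_time_ident]]) measurable
  then show ?thesis by (simp add: case_prod_beta')
qed

lemma nsq_strip:
  assumes "case_prod u \<in> borel_measurable (strip T)"
  shows "nsq (strip T) (case_prod u) = (\<integral>\<^sup>+t. nsq lborel (u t) \<partial>time T)"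
proof -
  have "(\<lambda>k. ennreal ((cmod (case_prod u k))\<^sup>2)) \<in> borel_measurable (strip T)"
    using assms by measurable
  from lborel.nn_integral_fst[OF this] show ?thesis by (simp add: nsq_def)
qed

lemma nsq_strip_swap:
  assumes "case_prod u \<in> borel_measurable (strip T)"
  shows "nsq (strip T) (case_prod u) = (\<integral>\<^sup>+x. nsq (time T) (\<lambda>t. u t x) \<partial>lborel)"
proof -
  have "(\<lambda>k. ennreal ((cmod (case_prod u k))\<^sup>2)) \<in> borel_measurable (strip T)"
    using assms by measurable
  from pair_sigma_finite.nn_integral_snd[OF pair_strip this] show ?thesis by (simp add: nsq_def)
qed

lemma nsq_section1_measurable:
  assumes "case_prod u \<in> borel_measurable (strip T)"
  shows "(\<lambda>t. nsq lborel (u t)) \<in> borel_measurable (time T)"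
proof -
  have "(\<lambda>k. ennreal ((cmod (case_prod u k))\<^sup>2)) \<in> borel_measurable (strip T)"
    using assms by measurable
  from lborel.borel_measurable_nn_integral_fst[OF this] show ?thesis by (simp add: nsq_def)
qed

lemma nsq_section2_measurable:
  assumes "case_prod u \<in> borel_measurable (strip T)"
  shows "(\<lambda>x. nsq (time T) (\<lambda>t. u t x)) \<in> borel_measurable lborel"
proof -
  have "(\<lambda>k. ennreal ((cmod (case_prod (\<lambda>x t. u t x) k))\<^sup>2)) \<in> borel_measurable (lborel \<Otimes>\<^sub>M time T)"
    using strip_swap[OF assms] by measurable
  from sigma_finite_measure.borel_measurable_nn_integral_fst[OF sigma_finite_time this] show ?thesis by (simp add: nsq_def)
qed

lemma L2_L2_iff: "u \<in> L2_L2 T \<longleftrightarrow> case_prod u \<in> borel_measurable (strip T) \<and> nsq (strip T) (case_prod u) < \<infinity>"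
  by (simp add: L2_L2_def sq_integrable_iff_nsq)

lemma L2_L2_norm_eq:
  "case_prod u \<in> borel_measurable (strip T) \<Longrightarrow> L2_L2_norm T u = sqrt (enn2real (nsq (strip T) (case_prod u)))"
  by (simp add: L2_L2_norm_def L2_norm_eq_nsq)

lemma L2_L2_section1:
  assumes "u \<in> L2_L2 T"
  shows "AE t in time T. sq_integrable lborel (u t)"
proof -
  have m: "case_prod u \<in> borel_measurable (strip T)" and f: "nsq (strip T) (case_prod u) \<noteq> \<infinity>"
    using assms by (auto simp: L2_L2_iff)
  have "AE t in time T. nsq lborel (u t) \<noteq> \<infinity>"
    using f unfolding nsq_strip[OF m] by (intro nn_integral_PInf_AE nsq_section1_measurable[OF m])
  with AE_space_time show ?thesis
    by eventually_elim (auto simp: sq_integrable_iff_nsq less_top intro: strip_section1[OF m])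
qed

lemma L2_L2_section2:
  assumes "u \<in> L2_L2 T"
  shows "AE x in lborel. sq_integrable (time T) (\<lambda>t. u t x)"
proof -
  have m: "case_prod u \<in> borel_measurable (strip T)" and f: "nsq (strip T) (case_prod u) \<noteq> \<infinity>"
    using assms by (auto simp: L2_L2_iff)
  have "AE x in lborel. nsq (time T) (\<lambda>t. u t x) \<noteq> \<infinity>"
    using f unfolding nsq_strip_swap[OF m] by (intro nn_integral_PInf_AE nsq_section2_measurable[OF m])
  then show ?thesis
    by eventually_elim (auto simp: sq_integrable_iff_nsq less_top intro: strip_section2[OF m])
qed

lemma sq_integrable_time_bounded:
  assumes "\<theta> \<in> borel_measurable (time T)" "\<And>t. t \<in> {0<..<T} \<Longrightarrow> cmod (\<theta> t) \<le> B"
  shows "sq_integrable (time T) \<theta>"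
proof (rule sq_integrable_bound[OF sq_integrable_time_const[of T "complex_of_real B"]])
  show "AE t in time T. cmod (\<theta> t) \<le> cmod (complex_of_real B)"
    using AE_space_time by eventually_elim (use assms(2) in \<open>fastforce\<close>)
qed fact

lemma sq_integrable_imp_integrable_time:
  assumes "sq_integrable (time T) f"
  shows "integrable (time T) f"
  using integrable_mult_sq_integrable[OF sq_integrable_time_const[of T 1] assms] by simp

text \<open>The passage between null sets of the strip and null sets of its sections requires the
  equality set to be measurable, which joint measurability of both functions ensures. All later
  arguments can thereby be run at fixed time or at fixed frequency.\<close>

lemma AE_strip_iff:
  fixes u v :: "real \<Rightarrow> real \<Rightarrow> complex"
  assumes "case_prod u \<in> borel_measurable (strip T)" "case_prod v \<in> borel_measurable (strip T)"
  shows "(AE (t, x) in strip T. u t x = v t x) \<longleftrightarrow> (AE t in time T. AE x in lborel. u t x = v t x)" (is ?t)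
    and "(AE (t, x) in strip T. u t x = v t x) \<longleftrightarrow> (AE x in lborel. AE t in time T. u t x = v t x)" (is ?x)
proof -
  have "{k \<in> space (strip T). case_prod u k = case_prod v k} \<in> sets (strip T)"
    by (rule measurable_equality_set[OF assms])
  moreover have "{k \<in> space (strip T). case_prod u k = case_prod v k} = {k \<in> space (strip T). u (fst k) (snd k) = v (fst k) (snd k)}"
    by auto
  ultimately have s: "{k \<in> space (strip T). u (fst k) (snd k) = v (fst k) (snd k)} \<in> sets (strip T)" by simp
  show ?t
  proof
    assume "AE (t, x) in strip T. u t x = v t x"
    from pair_sigma_finite.AE_pair[OF pair_strip this[unfolded case_prod_beta']] show "AE t in time T. AE x in lborel. u t x = v t x" by simp
  next
    assume "AE t in time T. AE x in lborel. u t x = v t x"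
    then show "AE (t, x) in strip T. u t x = v t x"
      unfolding case_prod_beta' by (intro pair_sigma_finite.AE_pair_measure[OF pair_strip]) (use s in auto)
  qed
  moreover have "(AE t in time T. AE x in lborel. u t x = v t x) \<longleftrightarrow> (AE x in lborel. AE t in time T. u t x = v t x)"
    by (rule pair_sigma_finite.AE_commute[OF pair_strip]) (use s in \<open>auto simp: case_prod_beta'\<close>)
  ultimately show ?x by simp
qed

section \<open>Jointly measurable transforms on the strip\<close>

text \<open>Cauchy-Schwarz in time at each x, followed by Tonelli.\<close>

lemma nsq_time_integral_le:
  fixes v :: "real \<Rightarrow> real \<Rightarrow> complex"
  assumes \<theta>: "\<theta> \<in> borel_measurable (time T)" and v: "case_prod v \<in> borel_measurable (strip T)"
  shows "nsq lborel (\<lambda>x. \<integral>t. \<theta> t * v t x \<partial>time T) \<le> nsq (time T) \<theta> * nsq (strip T) (case_prod v)"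
proof -
  have "nsq lborel (\<lambda>x. \<integral>t. \<theta> t * v t x \<partial>time T) \<le> (\<integral>\<^sup>+x. nsq (time T) \<theta> * nsq (time T) (\<lambda>t. v t x) \<partial>lborel)"
    unfolding nsq_def[of lborel]
    by (intro nn_integral_mono cmod_integral_mult_sq_le \<theta> strip_section2[OF v])
  also have "\<dots> = nsq (time T) \<theta> * nsq (strip T) (case_prod v)"
    unfolding nsq_strip_swap[OF v] by (rule nn_integral_cmult) (rule nsq_section2_measurable[OF v])
  finally show ?thesis .
qed

lemma time_integral_measurable:
  fixes v :: "real \<Rightarrow> real \<Rightarrow> complex"
  assumes "\<theta> \<in> borel_measurable (time T)" "case_prod v \<in> borel_measurable (strip T)"
  shows "(\<lambda>x. \<integral>t. \<theta> t * v t x \<partial>time T) \<in> borel_measurable (lborel :: real measure)"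
proof (rule sigma_finite_measure.borel_measurable_lebesgue_integral[OF sigma_finite_time])
  have "(\<lambda>k. \<theta> (snd k) * (case k of (x, t) \<Rightarrow> v t x)) \<in> borel_measurable (lborel \<Otimes>\<^sub>M time T)"
    using assms(1) strip_swap[OF assms(2)] by measurable
  then show "(\<lambda>(x, t). \<theta> t * v t x) \<in> borel_measurable (lborel \<Otimes>\<^sub>M time T)"
    by (simp add: case_prod_beta')
qed

lemma fourier_trunc_measurable:
  assumes "case_prod u \<in> borel_measurable (strip T)"
  shows "case_prod (\<lambda>t. fourier_int (trunc R (u t))) \<in> borel_measurable (strip T)"
proof -
  have [measurable]: "(\<lambda>(k, x). u (fst k) x) \<in> borel_measurable (strip T \<Otimes>\<^sub>M lborel)"
    using measurable_uncurry[OF assms measurable_compose[OF measurable_fst measurable_fst] measurable_snd] by (simp only: case_prod_beta')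
  have "(\<lambda>k. \<integral>x. trunc R (u (fst k)) x * cis (- (x * snd k)) \<partial>lborel) \<in> borel_measurable (strip T)"
  proof (rule lborel.borel_measurable_lebesgue_integral)
    have "(\<lambda>p. indicator {- R..R} (snd p) * (case p of (k, x) \<Rightarrow> u (fst k) x) * cis (- (snd p * snd (fst p)))) \<in> borel_measurable (strip T \<Otimes>\<^sub>M lborel)"
      by measurable
    then show "(\<lambda>(k, x). trunc R (u (fst k)) x * cis (- (x * snd k))) \<in> borel_measurable (strip T \<Otimes>\<^sub>M lborel)"
      by (simp add: trunc_def case_prod_beta')
  qed
  then show ?thesis unfolding fourier_int_def case_prod_beta'
    by (rule borel_measurable_times[OF borel_measurable_const])
qed

lemma liminf_zero_ex_less:
  fixes f :: "nat \<Rightarrow> ennreal"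
  assumes "liminf f = 0" "e > 0"
  shows "\<exists>n\<ge>N. f n < e"
proof (rule ccontr)
  assume "\<not> ?thesis"
  then have "\<forall>\<^sub>F n in sequentially. e \<le> f n"
    by (auto simp: eventually_sequentially not_less)
  then have "e \<le> liminf f" by (rule Liminf_bounded)
  with assms show False by simp
qed

text \<open>Choosing a transform separately for each t would lose joint measurability. U is instead
  built as an L2 limit on the strip of the transforms of truncations, which are jointly measurable,
  and is then recognised as the transform of \<open>u t\<close> for almost every t.\<close>

lemma is_fourier_x_approx:
  assumes u: "u \<in> L2_L2 T"
  obtains U where "is_fourier_x T u U" "U \<in> L2_L2 T"
    "(\<lambda>n. nsq (strip T) (\<lambda>(t, \<xi>). U t \<xi> - fourier_int (trunc (real n) (u t)) \<xi>)) \<longlonglongrightarrow> 0"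
proof -
  have um: "case_prod u \<in> borel_measurable (strip T)" and uf: "nsq (strip T) (case_prod u) < \<infinity>"
    using u by (auto simp: L2_L2_iff)
  define W where "W n = (\<lambda>(t, \<xi>). fourier_int (trunc (real n) (u t)) \<xi>)" for n
  have Wm [measurable]: "W n \<in> borel_measurable (strip T)" for n
    unfolding W_def by (rule fourier_trunc_measurable[OF um])
  have tailm: "case_prod (\<lambda>t x. u t x - trunc R (u t) x) \<in> borel_measurable (strip T)" for R
  proof -
    have "(\<lambda>k. case_prod u k - indicator {- R..R} (snd k) * case_prod u k) \<in> borel_measurable (strip T)"
      using um by measurable
    then show ?thesis by (simp add: trunc_def case_prod_beta')
  qed
  have "(\<lambda>n. \<integral>\<^sup>+k. ennreal ((cmod (case k of (t, x) \<Rightarrow> u t x - trunc (real n) (u t) x))\<^sup>2) \<partial>strip T) \<longlonglongrightarrow> (\<integral>\<^sup>+k. 0 \<partial>strip T)"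
  proof (rule nn_integral_dominated_convergence[where w = "\<lambda>k. ennreal ((cmod (case_prod u k))\<^sup>2)"])
    show "(\<integral>\<^sup>+k. ennreal ((cmod (case_prod u k))\<^sup>2) \<partial>strip T) < \<infinity>" using uf by (simp add: nsq_def)
    show "AE k in strip T. (\<lambda>n. ennreal ((cmod (case k of (t, x) \<Rightarrow> u t x - trunc (real n) (u t) x))\<^sup>2)) \<longlonglongrightarrow> 0"
    proof (intro AE_I2 tendsto_eventually, clarify)
      fix t x :: real
      obtain m where m: "\<bar>x\<bar> < real m" using reals_Archimedean2 by blast
      show "\<forall>\<^sub>F n in sequentially. ennreal ((cmod (u t x - trunc (real n) (u t) x))\<^sup>2) = 0"
        using eventually_ge_at_top[of m] by eventually_elim (use m in \<open>auto simp: trunc_def indicator_def\<close>)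
    qed
    show "(\<lambda>k. ennreal ((cmod (case k of (t, x) \<Rightarrow> u t x - trunc (real n) (u t) x))\<^sup>2)) \<in> borel_measurable (strip T)" for n
      using tailm by measurable
    show "(\<lambda>k. ennreal ((cmod (case_prod u k))\<^sup>2)) \<in> borel_measurable (strip T)"
      using um by measurable
    show "AE k in strip T. ennreal ((cmod (case k of (t, x) \<Rightarrow> u t x - trunc (real n) (u t) x))\<^sup>2) \<le> ennreal ((cmod (case_prod u k))\<^sup>2)" for n
      by (auto simp: trunc_def indicator_def)
  qed measurable
  then have tail0: "(\<lambda>n. nsq (strip T) (\<lambda>(t, x). u t x - trunc (real n) (u t) x)) \<longlonglongrightarrow> 0"
    by (simp add: nsq_def)
  have cauchy: "nsq (strip T) (\<lambda>k. W m k - W n k) \<le> nsq (strip T) (\<lambda>(t, x). u t x - trunc (real N) (u t) x)"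
    if "m \<ge> N" "n \<ge> N" for m n N
  proof -
    have Wmn: "(\<lambda>k. W m k - W n k) = (\<lambda>(t, \<xi>). fourier_int (trunc (real m) (u t)) \<xi> - fourier_int (trunc (real n) (u t)) \<xi>)"
      by (auto simp: W_def)
    have "(\<lambda>k. W m k - W n k) \<in> borel_measurable (strip T)" by measurable
    then show ?thesis
      unfolding Wmn nsq_strip[OF tailm]
      by (subst nsq_strip) (use L2_L2_section1[OF u] that in \<open>auto intro!: nn_integral_mono_AE nsq_fourier_trunc_cauchy elim: eventually_mono\<close>)
  qed
  obtain H where H: "H \<in> borel_measurable (strip T)" "(\<lambda>n. nsq (strip T) (\<lambda>k. W n k - H k)) \<longlonglongrightarrow> 0"
  proof (rule L2_complete[OF Wm])
    fix e :: real assume "e > 0"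
    then have "\<forall>\<^sub>F N in sequentially. nsq (strip T) (\<lambda>(t, x). u t x - trunc (real N) (u t) x) < ennreal e"
      by (intro order_tendstoD[OF tail0]) auto
    then obtain N where "nsq (strip T) (\<lambda>(t, x). u t x - trunc (real N) (u t) x) < ennreal e"
      by (auto simp: eventually_sequentially)
    then show "\<exists>N. \<forall>m\<ge>N. \<forall>n\<ge>N. nsq (strip T) (\<lambda>k. W m k - W n k) \<le> ennreal e"
      using cauchy by (meson less_imp_le order_trans)
  qed blast
  define U where "U t \<xi> = H (t, \<xi>)" for t \<xi>
  have UH: "case_prod U = H" by (auto simp: U_def)
  have Um: "case_prod U \<in> borel_measurable (strip T)" using H(1) UH by simp
  have diff: "(\<lambda>(t, \<xi>). U t \<xi> - fourier_int (trunc (real n) (u t)) \<xi>) = (\<lambda>k. H k - W n k)" for n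
    by (auto simp: U_def W_def)
  have lim: "(\<lambda>n. nsq (strip T) (\<lambda>(t, \<xi>). U t \<xi> - fourier_int (trunc (real n) (u t)) \<xi>)) \<longlonglongrightarrow> 0"
    unfolding diff using H(2) by (subst nsq_diff_commute)
  have dm: "case_prod (\<lambda>t \<xi>. U t \<xi> - fourier_int (trunc (real n) (u t)) \<xi>) \<in> borel_measurable (strip T)" for n
    unfolding diff using H(1) by measurable
  have "(\<integral>\<^sup>+t. liminf (\<lambda>n. nsq lborel (\<lambda>\<xi>. U t \<xi> - fourier_int (trunc (real n) (u t)) \<xi>)) \<partial>time T)
     \<le> liminf (\<lambda>n. \<integral>\<^sup>+t. nsq lborel (\<lambda>\<xi>. U t \<xi> - fourier_int (trunc (real n) (u t)) \<xi>) \<partial>time T)"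
    by (intro nn_integral_liminf nsq_section1_measurable[OF dm])
  also have "\<dots> = 0"
    using lim unfolding nsq_strip[OF dm] by (rule lim_imp_Liminf[OF sequentially_bot])
  finally have "(\<integral>\<^sup>+t. liminf (\<lambda>n. nsq lborel (\<lambda>\<xi>. U t \<xi> - fourier_int (trunc (real n) (u t)) \<xi>)) \<partial>time T) = 0" by simp
  \<comment> \<open>Convergence on the strip yields, at a fixed time, only a vanishing lower limit.
    That is enough: infinitely many n are good for U and all large n are good for the transform h of
    \<open>u t\<close>, so some n serves both.\<close>
  then have liminf0: "AE t in time T. liminf (\<lambda>n. nsq lborel (\<lambda>\<xi>. U t \<xi> - fourier_int (trunc (real n) (u t)) \<xi>)) = 0"
    by (subst (asm) nn_integral_0_iff_AE) (auto intro!: borel_measurable_liminf nsq_section1_measurable[OF dm])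
  have "AE t in time T. is_fourier (u t) (U t)"
    using liminf0 L2_L2_section1[OF u] AE_space_time
  proof eventually_elim
    case (elim t)
    have ms [measurable]: "u t \<in> borel_measurable borel" "U t \<in> borel_measurable borel"
      using elim(3) strip_section1[OF um] strip_section1[OF Um] by auto
    obtain h where h: "is_fourier (u t) h" using is_fourier_exists[OF elim(2)] .
    note [measurable] = is_fourierD(4)[OF h]
    have "nsq lborel (\<lambda>\<xi>. h \<xi> - U t \<xi>) \<le> 0 + ennreal e" if e: "e > 0" for e
    proof -
      have "filterlim (\<lambda>n. real n) at_top sequentially" by (rule filterlim_real_sequentially)
      from filterlim_compose[OF is_fourierD(5)[OF h] this]
      have "(\<lambda>n. nsq lborel (\<lambda>\<xi>. h \<xi> - fourier_int (trunc (real n) (u t)) \<xi>)) \<longlonglongrightarrow> 0" .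
      from order_tendstoD(2)[OF this, of "ennreal (e / 4)"] e
      obtain N where N: "\<And>n. n \<ge> N \<Longrightarrow> nsq lborel (\<lambda>\<xi>. h \<xi> - fourier_int (trunc (real n) (u t)) \<xi>) < ennreal (e / 4)"
        by (auto simp: eventually_sequentially)
      obtain n where n: "n \<ge> N" "nsq lborel (\<lambda>\<xi>. U t \<xi> - fourier_int (trunc (real n) (u t)) \<xi>) < ennreal (e / 4)"
        using liminf_zero_ex_less[OF elim(1), of "ennreal (e / 4)" N] e by auto
      have "nsq lborel (\<lambda>\<xi>. h \<xi> - U t \<xi>) \<le> 2 * nsq lborel (\<lambda>\<xi>. h \<xi> - fourier_int (trunc (real n) (u t)) \<xi>)
          + 2 * nsq lborel (\<lambda>\<xi>. U t \<xi> - fourier_int (trunc (real n) (u t)) \<xi>)"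
        by (subst nsq_diff_commute[of _ "U t"]) (rule nsq_diff_triangle; measurable)
      also have "\<dots> \<le> 2 * ennreal (e / 4) + 2 * ennreal (e / 4)"
        using N[OF n(1)] n(2) by (intro add_mono mult_left_mono) auto
      also have "\<dots> = ennreal e"
        using e by (simp add: ennreal_plus[symmetric] ennreal_numeral[symmetric] ennreal_mult[symmetric] del: ennreal_plus ennreal_numeral)
      finally show ?thesis by simp
    qed
    then have "nsq lborel (\<lambda>\<xi>. h \<xi> - U t \<xi>) \<le> 0" by (rule ennreal_le_epsilon)
    then have "nsq lborel (\<lambda>\<xi>. h \<xi> - U t \<xi>) = 0" by simp
    moreover have "(\<lambda>\<xi>. h \<xi> - U t \<xi>) \<in> borel_measurable lborel" by measurable
    ultimately have "AE \<xi> in lborel. h \<xi> = U t \<xi>" using nsq_eq_0_iff by fastforce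
    then show "is_fourier (u t) (U t)" by (intro is_fourier_cong_AE[OF h] ms) auto
  qed
  then have F: "is_fourier_x T u U" using um Um by (simp add: is_fourier_x_def)
  have "nsq (strip T) (case_prod U) = nsq (strip T) (case_prod u)"
    unfolding nsq_strip[OF um] nsq_strip[OF Um]
    using F unfolding is_fourier_x_def by (intro nn_integral_cong_AE) (auto elim!: eventually_mono intro: plancherel)
  then have "U \<in> L2_L2 T" using uf Um by (simp add: L2_L2_iff)
  with F lim that show ?thesis by blast
qed

lemma is_fourier_xD:
  assumes "is_fourier_x T u U"
  shows "case_prod u \<in> borel_measurable (strip T)" "case_prod U \<in> borel_measurable (strip T)"
    "AE t in time T. is_fourier (u t) (U t)"
  using assms by (auto simp: is_fourier_x_def)

lemma plancherel_x:
  assumes "is_fourier_x T u U"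
  shows "nsq (strip T) (case_prod U) = nsq (strip T) (case_prod u)"
  unfolding nsq_strip[OF is_fourier_xD(1)[OF assms]] nsq_strip[OF is_fourier_xD(2)[OF assms]]
  using is_fourier_xD(3)[OF assms] by (intro nn_integral_cong_AE) (auto elim!: eventually_mono intro: plancherel)

lemma is_fourier_x_L2_L2:
  assumes "is_fourier_x T u U"
  shows "u \<in> L2_L2 T \<longleftrightarrow> U \<in> L2_L2 T"
  using is_fourier_xD(1,2)[OF assms] plancherel_x[OF assms] by (simp add: L2_L2_iff)

lemma L2_L2_norm_fourier:
  assumes "is_fourier_x T u U"
  shows "L2_L2_norm T u = L2_L2_norm T U"
  using is_fourier_xD(1,2)[OF assms] plancherel_x[OF assms] by (simp add: L2_L2_norm_eq)

lemma is_fourier_x_unique: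
  assumes "is_fourier_x T u U" "is_fourier_x T u' U'" "AE (t, x) in strip T. u t x = u' t x"
  shows "AE (t, \<xi>) in strip T. U t \<xi> = U' t \<xi>"
proof -
  note F = is_fourier_xD[OF assms(1)] and F' = is_fourier_xD[OF assms(2)]
  have "AE t in time T. AE x in lborel. u t x = u' t x"
    using assms(3) AE_strip_iff(1)[OF F(1) F'(1)] by blast
  with F(3) F'(3) have "AE t in time T. AE \<xi> in lborel. U t \<xi> = U' t \<xi>"
  proof eventually_elim
    case (elim t)
    show ?case
      by (rule is_fourier_unique[OF _ elim(2)], rule is_fourier_cong_AE[OF elim(1)])
         (use elim in \<open>auto dest: is_fourierD\<close>)
  qed
  then show ?thesis using AE_strip_iff(1)[OF F(2) F'(2)] by blast
qed

lemma is_fourier_x_inj: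
  assumes "is_fourier_x T u U" "is_fourier_x T u' U'" "AE (t, \<xi>) in strip T. U t \<xi> = U' t \<xi>"
  shows "AE (t, x) in strip T. u t x = u' t x"
proof -
  note F = is_fourier_xD[OF assms(1)] and F' = is_fourier_xD[OF assms(2)]
  have "AE t in time T. AE x in lborel. U t x = U' t x"
    using assms(3) AE_strip_iff(1)[OF F(2) F'(2)] by blast
  with F(3) F'(3) have "AE t in time T. AE \<xi> in lborel. u t \<xi> = u' t \<xi>"
    by eventually_elim (rule is_fourier_inj)
  then show ?thesis using AE_strip_iff(1)[OF F(1) F'(1)] by blast
qed

lemma is_fourier_x_cong:
  assumes F: "is_fourier_x T u U" and m: "case_prod u' \<in> borel_measurable (strip T)" "case_prod U' \<in> borel_measurable (strip T)"
    and eq: "AE (t, x) in strip T. u t x = u' t x" "AE (t, \<xi>) in strip T. U t \<xi> = U' t \<xi>"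
  shows "is_fourier_x T u' U'"
proof -
  note F = is_fourier_xD[OF F]
  have "AE t in time T. AE x in lborel. u t x = u' t x" "AE t in time T. AE x in lborel. U t x = U' t x"
    using eq AE_strip_iff(1)[OF F(1) m(1)] AE_strip_iff(1)[OF F(2) m(2)] by blast+
  with F(3) AE_space_time have "AE t in time T. is_fourier (u' t) (U' t)"
  proof eventually_elim
    case (elim t)
    show ?case
      by (rule is_fourier_cong_AE[OF elim(1)])
         (use elim strip_section1[OF m(1)] strip_section1[OF m(2)] in auto)
  qed
  with m show ?thesis by (simp add: is_fourier_x_def)
qed

lemma case_prod_measurable_add:
  assumes "case_prod u \<in> borel_measurable M" "case_prod v \<in> borel_measurable M"
  shows "case_prod (\<lambda>t x. u t x + v t x :: complex) \<in> borel_measurable M"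
  using borel_measurable_add[OF assms] by (simp add: case_prod_beta')

lemma case_prod_measurable_cmult:
  assumes "case_prod u \<in> borel_measurable M"
  shows "case_prod (\<lambda>t x. c * u t x :: complex) \<in> borel_measurable M"
  using borel_measurable_times[OF borel_measurable_const[of c] assms] by (simp add: case_prod_beta')

lemma is_fourier_x_add:
  assumes "is_fourier_x T u U" "is_fourier_x T u' U'"
  shows "is_fourier_x T (\<lambda>t x. u t x + u' t x) (\<lambda>t x. U t x + U' t x)"
  using assms unfolding is_fourier_x_def
  by (auto intro!: case_prod_measurable_add elim: eventually_elim2 intro: is_fourier_add)

lemma is_fourier_x_cmult:
  assumes "is_fourier_x T u U"
  shows "is_fourier_x T (\<lambda>t x. c * u t x) (\<lambda>t x. c * U t x)"
  using assms unfolding is_fourier_x_def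
  by (auto intro!: case_prod_measurable_cmult elim: eventually_mono intro: is_fourier_cmult)

lemma strip_reflect:
  assumes "case_prod u \<in> borel_measurable (strip T)"
  shows "case_prod (\<lambda>t x. u t (- x)) \<in> borel_measurable (strip T)"
proof -
  have "(\<lambda>k. u (fst k) (- snd k)) \<in> borel_measurable (strip T)"
    by (rule measurable_uncurry[OF assms]) measurable
  then show ?thesis by (simp add: case_prod_beta')
qed

lemma is_fourier_x_cnj:
  assumes "is_fourier_x T u U"
  shows "is_fourier_x T (\<lambda>t x. cnj (u t x)) (\<lambda>t x. cnj (U t (- x)))"
proof -
  note F = is_fourier_xD[OF assms]
  have "case_prod (\<lambda>t x. cnj (u t x)) \<in> borel_measurable (strip T)" "case_prod (\<lambda>t x. cnj (U t (- x))) \<in> borel_measurable (strip T)"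
    using measurable_compose[OF F(1) cnj_measurable] measurable_compose[OF strip_reflect[OF F(2)] cnj_measurable]
    by (simp_all add: case_prod_beta')
  with F(3) show ?thesis unfolding is_fourier_x_def by (auto elim: eventually_mono intro: is_fourier_cnj)
qed

text \<open>The inverse transform is the transform followed by reflection, so the measurable
  construction of the forward direction suffices.\<close>

lemma inverse_fourier_x_exists:
  assumes "U \<in> L2_L2 T"
  obtains u where "is_fourier_x T u U" "u \<in> L2_L2 T"
proof -
  obtain W where W: "is_fourier_x T U W" using is_fourier_x_approx[OF assms] by blast
  note F = is_fourier_xD[OF W]
  have "AE t in time T. is_fourier (\<lambda>x. W t (- x)) (U t)"
    using F(3)
  proof eventually_elim
    case (elim t)
    from is_fourier_reflect[OF fourier_inversion[OF elim]] show ?case by simp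
  qed
  then have "is_fourier_x T (\<lambda>t x. W t (- x)) U"
    using F(2) strip_reflect[OF F(2)] F(1) by (simp add: is_fourier_x_def)
  then show ?thesis using that is_fourier_x_L2_L2 assms by blast
qed

text \<open>For truncations the claim is Fubini on the bounded rectangle with sides (0, T) and
  [-n, n]; the general case follows because time integration against \<theta> is bounded on L2 of
  the strip. This is what allows time derivatives to be tested on the Fourier side.\<close>

lemma fourier_x_time_integral:
  assumes F: "is_fourier_x T u U" and u: "u \<in> L2_L2 T" and \<theta>: "sq_integrable (time T) \<theta>"
  shows "is_fourier (\<lambda>x. \<integral>t. \<theta> t * u t x \<partial>time T) (\<lambda>\<xi>. \<integral>t. \<theta> t * U t \<xi> \<partial>time T)"
proof -
  have \<theta>m: "\<theta> \<in> borel_measurable (time T)" and \<theta>f: "nsq (time T) \<theta> < \<infinity>"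
    using \<theta> by (auto simp: sq_integrable_iff_nsq)
  have U: "U \<in> L2_L2 T" using is_fourier_x_L2_L2[OF F] u by simp
  note um = is_fourier_xD(1)[OF F] and Um = is_fourier_xD(2)[OF F]
  obtain V where V: "is_fourier_x T u V" "V \<in> L2_L2 T"
    and lim: "(\<lambda>n. nsq (strip T) (\<lambda>(t, \<xi>). V t \<xi> - fourier_int (trunc (real n) (u t)) \<xi>)) \<longlonglongrightarrow> 0"
    using is_fourier_x_approx[OF u] .
  have UV: "AE (t, \<xi>) in strip T. U t \<xi> = V t \<xi>" by (rule is_fourier_x_unique[OF F V(1)]) simp
  have Wm: "case_prod (\<lambda>t. fourier_int (trunc R (u t))) \<in> borel_measurable (strip T)" for R
    by (rule fourier_trunc_measurable[OF um])
  have dm: "case_prod (\<lambda>t \<xi>. U t \<xi> - fourier_int (trunc R (u t)) \<xi>) \<in> borel_measurable (strip T)" for R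
    using borel_measurable_diff[OF Um Wm[of R]] by (simp add: case_prod_beta')
  have "nsq (strip T) (\<lambda>(t, \<xi>). U t \<xi> - fourier_int (trunc (real n) (u t)) \<xi>) = nsq (strip T) (\<lambda>(t, \<xi>). V t \<xi> - fourier_int (trunc (real n) (u t)) \<xi>)" for n
    by (rule nsq_cong_AE) (use UV in \<open>auto elim: eventually_mono\<close>)
  with lim have limU: "(\<lambda>n. nsq (strip T) (\<lambda>(t, \<xi>). U t \<xi> - fourier_int (trunc (real n) (u t)) \<xi>)) \<longlonglongrightarrow> 0" by simp
  let ?w = "\<lambda>x. \<integral>t. \<theta> t * u t x \<partial>time T" and ?W = "\<lambda>\<xi>. \<integral>t. \<theta> t * U t \<xi> \<partial>time T"
  have sq: "sq_integrable lborel (\<lambda>x. \<integral>t. \<theta> t * v t x \<partial>time T)" if "v \<in> L2_L2 T" for v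
    unfolding sq_integrable_iff_nsq
    using that \<theta>f \<theta>m
    by (intro conjI time_integral_measurable le_less_trans[OF nsq_time_integral_le]) (auto simp: L2_L2_iff ennreal_mult_less_top)
  show ?thesis
  proof (rule is_fourierI_seq[OF sq[OF u] sq[OF U] filterlim_real_sequentially])
    show "(\<lambda>n. nsq lborel (\<lambda>\<xi>. ?W \<xi> - fourier_int (trunc (real n) ?w) \<xi>)) \<longlonglongrightarrow> 0"
    proof (rule tendsto_sandwich[OF _ _ tendsto_const])
      show "(\<lambda>n. nsq (time T) \<theta> * nsq (strip T) (\<lambda>(t, \<xi>). U t \<xi> - fourier_int (trunc (real n) (u t)) \<xi>)) \<longlonglongrightarrow> 0"
        using ennreal_tendsto_cmult[OF \<theta>f[unfolded infinity_ennreal_def] limU] by simp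
      show "\<forall>\<^sub>F n in sequentially. nsq lborel (\<lambda>\<xi>. ?W \<xi> - fourier_int (trunc (real n) ?w) \<xi>) \<le> nsq (time T) \<theta> * nsq (strip T) (\<lambda>(t, \<xi>). U t \<xi> - fourier_int (trunc (real n) (u t)) \<xi>)"
      proof (intro always_eventually allI)
        fix n
        let ?c = "complex_of_real (1 / sqrt (2 * pi))"
        \<comment> \<open>Integrability comes from a product of two square-integrable functions on
          the strip: \<theta> times the cut-off phase, and u.\<close>
        have int: "integrable (time T \<Otimes>\<^sub>M lborel) (\<lambda>(t, x). \<theta> t * trunc (real n) (u t) x * cis (- (x * \<xi>)))" for \<xi>
        proof -
          have m: "(\<lambda>(t, x). \<theta> t * indicator {- real n..real n} x * cis (- (x * \<xi>))) \<in> borel_measurable (strip T)"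
            using \<theta>m by measurable
          have "nsq (strip T) (\<lambda>(t, x). \<theta> t * indicator {- real n..real n} x * cis (- (x * \<xi>))) = (\<integral>\<^sup>+t. nsq lborel (\<lambda>x. \<theta> t * indicator {- real n..real n} x) \<partial>time T)"
            unfolding nsq_strip[OF m] by (simp add: nsq_def norm_mult)
          also have "\<dots> = (\<integral>\<^sup>+t. ennreal ((cmod (\<theta> t))\<^sup>2) * nsq lborel (\<lambda>x. indicator {- real n..real n} x) \<partial>time T)"
            by (subst nsq_cmult) (auto intro: sq_integrableD(1)[OF sq_integrable_indicator, unfolded measurable_lborel2])
          also have "\<dots> = nsq (time T) \<theta> * nsq lborel (\<lambda>x. indicator {- real n..real n} x)"
            unfolding nsq_def[of "time T"]
            by (rule nn_integral_multc) (rule measurable_compose[OF borel_measurable_power[OF measurable_compose[OF \<theta>m borel_measurable_norm]] measurable_ennreal])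
          also have "\<dots> < \<infinity>"
            using \<theta>f nsq_indicator_bounded[of "- real n" "real n"] by (simp add: ennreal_mult_less_top)
          finally have "sq_integrable (strip T) (\<lambda>(t, x). \<theta> t * indicator {- real n..real n} x * cis (- (x * \<xi>)))"
            using m by (simp add: sq_integrable_iff_nsq)
          from integrable_mult_sq_integrable[OF this u[unfolded L2_L2_def, simplified]]
          show ?thesis by (simp add: case_prod_beta' trunc_def mult_ac)
        qed
        have FT: "fourier_int (trunc (real n) ?w) \<xi> = (\<integral>t. \<theta> t * fourier_int (trunc (real n) (u t)) \<xi> \<partial>time T)" for \<xi>
        proof -
          have "fourier_int (trunc (real n) ?w) \<xi> = ?c * (\<integral>x. (\<integral>t. \<theta> t * trunc (real n) (u t) x * cis (- (x * \<xi>)) \<partial>time T) \<partial>lborel)"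
          proof -
            have "trunc (real n) ?w x * cis (- (x * \<xi>)) = (\<integral>t. \<theta> t * trunc (real n) (u t) x * cis (- (x * \<xi>)) \<partial>time T)" for x
            proof -
              have "(\<integral>t. \<theta> t * trunc (real n) (u t) x * cis (- (x * \<xi>)) \<partial>time T) = (\<integral>t. (indicator {- real n..real n} x * cis (- (x * \<xi>))) * (\<theta> t * u t x) \<partial>time T)"
                unfolding trunc_def by (simp only: mult_ac)
              also have "\<dots> = (indicator {- real n..real n} x * cis (- (x * \<xi>))) * ?w x"
                by (rule integral_mult_right_zero)
              also have "\<dots> = trunc (real n) ?w x * cis (- (x * \<xi>))"
                unfolding trunc_def by (simp only: mult_ac)
              finally show ?thesis by simp
            qed
            then show ?thesis by (simp only: fourier_int_def)
          qed
          also have "\<dots> = ?c * (\<integral>t. (\<integral>x. \<theta> t * trunc (real n) (u t) x * cis (- (x * \<xi>)) \<partial>lborel) \<partial>time T)"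
            by (subst pair_sigma_finite.Fubini_integral[OF pair_strip int]) (rule refl)
          also have "\<dots> = ?c * (\<integral>t. \<theta> t * (\<integral>x. trunc (real n) (u t) x * cis (- (x * \<xi>)) \<partial>lborel) \<partial>time T)"
            by (simp only: mult.assoc integral_mult_right_zero)
          also have "\<dots> = (\<integral>t. ?c * (\<theta> t * (\<integral>x. trunc (real n) (u t) x * cis (- (x * \<xi>)) \<partial>lborel)) \<partial>time T)"
            by (simp only: integral_mult_right_zero)
          also have "\<dots> = (\<integral>t. \<theta> t * fourier_int (trunc (real n) (u t)) \<xi> \<partial>time T)"
            unfolding fourier_int_def by (simp only: mult.left_commute)
          finally show ?thesis .
        qed
        have Wn: "(\<lambda>t. fourier_int (trunc (real n) (u t))) \<in> L2_L2 T"
        proof -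
          have "nsq (strip T) (case_prod (\<lambda>t. fourier_int (trunc (real n) (u t)))) \<le> nsq (strip T) (case_prod u)"
            unfolding nsq_strip[OF Wm] nsq_strip[OF um]
          proof (rule nn_integral_mono_AE)
            show "AE t in time T. nsq lborel (fourier_int (trunc (real n) (u t))) \<le> nsq lborel (u t)"
              using L2_L2_section1[OF u]
              by eventually_elim (intro order_trans[OF nsq_fourier_int_le] nsq_mono integrable_trunc, auto simp: cmod_trunc_le)
          qed
          then show ?thesis using u Wm by (auto simp: L2_L2_iff)
        qed
        have "AE \<xi> in lborel. ?W \<xi> - fourier_int (trunc (real n) ?w) \<xi> = (\<integral>t. \<theta> t * (U t \<xi> - fourier_int (trunc (real n) (u t)) \<xi>) \<partial>time T)"
          using L2_L2_section2[OF U] L2_L2_section2[OF Wn]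
        proof eventually_elim
          case (elim \<xi>)
          show ?case unfolding FT right_diff_distrib
            by (intro Bochner_Integration.integral_diff[symmetric] integrable_mult_sq_integrable \<theta> elim)
        qed
        then have "nsq lborel (\<lambda>\<xi>. ?W \<xi> - fourier_int (trunc (real n) ?w) \<xi>) = nsq lborel (\<lambda>\<xi>. \<integral>t. \<theta> t * (U t \<xi> - fourier_int (trunc (real n) (u t)) \<xi>) \<partial>time T)"
          by (rule nsq_cong_AE)
        also have "\<dots> \<le> nsq (time T) \<theta> * nsq (strip T) (\<lambda>(t, \<xi>). U t \<xi> - fourier_int (trunc (real n) (u t)) \<xi>)"
          by (rule nsq_time_integral_le[OF \<theta>m dm])
        finally show "nsq lborel (\<lambda>\<xi>. ?W \<xi> - fourier_int (trunc (real n) ?w) \<xi>) \<le> nsq (time T) \<theta> * nsq (strip T) (\<lambda>(t, \<xi>). U t \<xi> - fourier_int (trunc (real n) (u t)) \<xi>)" .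
      qed
    qed auto
  qed
qed

section \<open>Smooth bump functions\<close>

declare [[simproc add: measurable]]

text \<open>The classical flat function exp (-\<epsilon>/x) glued to 0, with a polynomial in 1/x in
  front so that the class is stable under differentiation. Small \<epsilon> brings it close to a
  step when the polynomial is 1.\<close>

definition flat :: "real \<Rightarrow> real poly \<Rightarrow> real \<Rightarrow> real" where
  "flat \<epsilon> p x = (if x > 0 then poly p (1 / x) * exp (- (\<epsilon> / x)) else 0)"

text \<open>With y = 1/x the chain rule contributes -y^2, so differentiating p(y) exp (-\<epsilon>
  y) in x produces the coefficient y^2 (\<epsilon> p - p').\<close>

definition flat_deriv :: "real \<Rightarrow> real poly \<Rightarrow> real poly" where
  "flat_deriv \<epsilon> p = monom 1 2 * (smult \<epsilon> p - pderiv p)"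

text \<open>Each induction step halves the exponent: one half of the decay absorbs the new factor y,
  the other half the remaining polynomial.\<close>

lemma poly_times_exp_tendsto_0:
  fixes p :: "real poly"
  assumes "\<epsilon> > 0"
  shows "((\<lambda>y. poly p y * exp (- (\<epsilon> * y))) \<longlongrightarrow> 0) at_top"
  using assms
proof (induction p arbitrary: \<epsilon>)
  case 0
  then show ?case by simp
next
  case (pCons a p)
  have at: "filterlim (\<lambda>y. \<epsilon> / 2 * y) at_top at_top"
    using pCons.prems by (intro filterlim_tendsto_pos_mult_at_top[OF tendsto_const _ filterlim_ident]) auto
  have e0: "((\<lambda>y. exp (- (\<epsilon> / 2 * y))) \<longlongrightarrow> 0) at_top"
    using filterlim_compose[OF tendsto_power_div_exp_0[of 0] at] by (simp add: exp_minus inverse_eq_divide)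
  have "((\<lambda>y. 2 / \<epsilon> * ((\<epsilon> / 2 * y) ^ 1 / exp (\<epsilon> / 2 * y))) \<longlongrightarrow> 2 / \<epsilon> * 0) at_top"
    by (intro tendsto_mult tendsto_const filterlim_compose[OF tendsto_power_div_exp_0 at])
  then have y0: "((\<lambda>y. y * exp (- (\<epsilon> / 2 * y))) \<longlongrightarrow> 0) at_top"
    using pCons.prems by (simp add: exp_minus field_simps)
  have p0: "((\<lambda>y. poly p y * exp (- (\<epsilon> / 2 * y))) \<longlongrightarrow> 0) at_top"
    using pCons.IH[of "\<epsilon> / 2"] pCons.prems by simp
  have "((\<lambda>y. a * (exp (- (\<epsilon> / 2 * y)) * exp (- (\<epsilon> / 2 * y))) + (y * exp (- (\<epsilon> / 2 * y))) * (poly p y * exp (- (\<epsilon> / 2 * y)))) \<longlongrightarrow> a * (0 * 0) + 0 * 0) at_top"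
    by (intro tendsto_intros e0 y0 p0)
  moreover have "a * (exp (- (\<epsilon> / 2 * y)) * exp (- (\<epsilon> / 2 * y))) + (y * exp (- (\<epsilon> / 2 * y))) * (poly p y * exp (- (\<epsilon> / 2 * y)))
      = poly (pCons a p) y * exp (- (\<epsilon> * y))" for y
  proof -
    have "exp (- (\<epsilon> * y)) = exp (- (\<epsilon> / 2 * y)) * exp (- (\<epsilon> / 2 * y))"
      by (simp flip: exp_add)
    then show ?thesis by (simp add: algebra_simps)
  qed
  ultimately show ?case by simp
qed

lemma flat_has_derivative:
  assumes \<epsilon>: "\<epsilon> > 0"
  shows "(flat \<epsilon> p has_real_derivative flat \<epsilon> (flat_deriv \<epsilon> p) x) (at x)"
proof -
  consider "x < 0" | "x > 0" | "x = 0" by linarith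
  then show ?thesis
  proof cases
    case 1
    have "((\<lambda>x. 0) has_real_derivative 0) (at x)" by simp
    then have "(flat \<epsilon> p has_real_derivative 0) (at x)"
      by (rule has_field_derivative_transform_within_open[where S = "{..<0}"]) (use 1 in \<open>auto simp: flat_def\<close>)
    then show ?thesis using 1 by (simp add: flat_def)
  next
    case 2
    have "((\<lambda>x. poly p (1 / x) * exp (- (\<epsilon> / x))) has_real_derivative
        (- (1 / x\<^sup>2) * poly (pderiv p) (1 / x)) * exp (- (\<epsilon> / x)) + poly p (1 / x) * (exp (- (\<epsilon> / x)) * (\<epsilon> / x\<^sup>2))) (at x)"
      using 2 by (auto intro!: derivative_eq_intros DERIV_chain'[where g = "poly p" and f = "\<lambda>x. 1 / x"] poly_DERIV simp: power2_eq_square divide_simps)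
    then have "(flat \<epsilon> p has_real_derivative
        (- (1 / x\<^sup>2) * poly (pderiv p) (1 / x)) * exp (- (\<epsilon> / x)) + poly p (1 / x) * (exp (- (\<epsilon> / x)) * (\<epsilon> / x\<^sup>2))) (at x)"
      by (rule has_field_derivative_transform_within_open[where S = "{0<..}"]) (use 2 in \<open>auto simp: flat_def\<close>)
    moreover have "(- (1 / x\<^sup>2) * poly (pderiv p) (1 / x)) * exp (- (\<epsilon> / x)) + poly p (1 / x) * (exp (- (\<epsilon> / x)) * (\<epsilon> / x\<^sup>2)) = flat \<epsilon> (flat_deriv \<epsilon> p) x"
      using 2 by (simp add: flat_def flat_deriv_def poly_monom algebra_simps power_divide)
    ultimately show ?thesis by simp
  next
    \<comment> \<open>At 0 the difference quotient from the right is a function of the same kind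
      with one more factor 1/h, hence the polynomial \<open>pCons 0 p\<close>; from the left it is
      0.\<close>
    case 3
    have "((\<lambda>h. flat \<epsilon> p h / h) \<longlongrightarrow> 0) (at_right 0)"
    proof -
      have "((\<lambda>h. poly (pCons 0 p) (inverse h) * exp (- (\<epsilon> * inverse h))) \<longlongrightarrow> 0) (at_right 0)"
        by (rule filterlim_compose[OF poly_times_exp_tendsto_0[OF \<epsilon>] filterlim_inverse_at_top_right])
      then show ?thesis
      proof (rule Lim_transform_eventually)
        show "\<forall>\<^sub>F h in at_right 0. poly (pCons 0 p) (inverse h) * exp (- (\<epsilon> * inverse h)) = flat \<epsilon> p h / h"
          using eventually_at_right_less[of 0] by eventually_elim (simp add: flat_def field_simps)
      qed
    qed
    moreover have "((\<lambda>h. flat \<epsilon> p h / h) \<longlongrightarrow> 0) (at_left 0)"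
      by (rule tendsto_eventually) (auto simp: flat_def eventually_at_filter)
    ultimately have "((\<lambda>h. flat \<epsilon> p h / h) \<longlongrightarrow> 0) (at 0)"
      by (rule filterlim_split_at_real[rotated])
    then show ?thesis using 3 by (simp add: DERIV_def flat_def)
  qed
qed

text \<open>Products of two opposed flat functions, closed under sums. Derivatives stay in the
  class, so smoothness of all orders follows from one differentiability statement by
  induction.\<close>

inductive_set bumps :: "(real \<Rightarrow> real) set" where
  base: "\<epsilon> > 0 \<Longrightarrow> (\<lambda>x. flat \<epsilon> p (x - a) * flat \<epsilon> q (b - x)) \<in> bumps"
| add: "f \<in> bumps \<Longrightarrow> g \<in> bumps \<Longrightarrow> (\<lambda>x. f x + g x) \<in> bumps"

lemma flat_uminus: "flat \<epsilon> (- p) x = - flat \<epsilon> p x"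
  by (simp add: flat_def)

lemma bumps_has_derivative:
  assumes "f \<in> bumps"
  shows "\<exists>f'\<in>bumps. \<forall>x. (f has_real_derivative f' x) (at x)"
  using assms
proof induction
  case (base \<epsilon> p a q b)
  let ?f' = "\<lambda>x. flat \<epsilon> (flat_deriv \<epsilon> p) (x - a) * flat \<epsilon> q (b - x) + flat \<epsilon> p (x - a) * flat \<epsilon> (- flat_deriv \<epsilon> q) (b - x)"
  have "?f' \<in> bumps" by (intro bumps.intros base)
  moreover have "((\<lambda>x. flat \<epsilon> p (x - a) * flat \<epsilon> q (b - x)) has_real_derivative ?f' x) (at x)" for x
  proof -
    have "((\<lambda>x. flat \<epsilon> p (x - a)) has_real_derivative flat \<epsilon> (flat_deriv \<epsilon> p) (x - a) * 1) (at x)"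
      by (rule DERIV_chain'[OF _ flat_has_derivative[OF base]]) (auto intro!: derivative_eq_intros)
    moreover have "((\<lambda>x. flat \<epsilon> q (b - x)) has_real_derivative flat \<epsilon> (flat_deriv \<epsilon> q) (b - x) * (- 1)) (at x)"
      by (rule DERIV_chain'[OF _ flat_has_derivative[OF base]]) (auto intro!: derivative_eq_intros)
    ultimately show ?thesis
      by (rule DERIV_mult[THEN DERIV_cong]) (simp add: flat_uminus)
  qed
  ultimately show ?case by (intro bexI[of _ ?f'] allI)
next
  case (add f g)
  then obtain f' g' where "f' \<in> bumps" "g' \<in> bumps" "\<And>x. (f has_real_derivative f' x) (at x)" "\<And>x. (g has_real_derivative g' x) (at x)"
    by blast
  then show ?case by (intro bexI[of _ "\<lambda>x. f' x + g' x"] allI DERIV_add bumps.add) auto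
qed

lemma bumps_smooth:
  assumes "f \<in> bumps"
  shows "(deriv ^^ n) f field_differentiable at t"
  using assms
proof (induction n arbitrary: f)
  case 0
  then show ?case using bumps_has_derivative[of f] by (auto simp: field_differentiable_def)
next
  case (Suc n)
  obtain f' where f': "f' \<in> bumps" "\<And>x. (f has_real_derivative f' x) (at x)"
    using bumps_has_derivative[OF Suc.prems] by blast
  have "deriv f = f'" using f'(2) by (intro ext DERIV_imp_deriv)
  then show ?case using Suc.IH[OF f'(1)] by (simp add: funpow_Suc_right del: funpow.simps)
qed

definition bump :: "real \<Rightarrow> real \<Rightarrow> real \<Rightarrow> real \<Rightarrow> real" where
  "bump \<epsilon> a b x = flat \<epsilon> 1 (x - a) * flat \<epsilon> 1 (b - x)"

lemma bump_eq: "bump \<epsilon> a b x = (if a < x \<and> x < b then exp (- (\<epsilon> / (x - a)) - \<epsilon> / (b - x)) else 0)"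
  by (simp add: bump_def flat_def flip: exp_add)

lemma bump_nonneg: "0 \<le> bump \<epsilon> a b x"
  by (simp add: bump_eq)

lemma bump_le_1:
  assumes "\<epsilon> > 0"
  shows "bump \<epsilon> a b x \<le> 1"
proof (cases "a < x \<and> x < b")
  case True
  then have "0 \<le> \<epsilon> / (x - a)" "0 \<le> \<epsilon> / (b - x)" using assms by auto
  then show ?thesis using True unfolding bump_eq by simp
next
  case False
  show ?thesis unfolding bump_eq by (simp only: False if_False zero_le_one)
qed

lemma continuous_on_bump: "\<epsilon> > 0 \<Longrightarrow> continuous_on S (bump \<epsilon> a b)"
  using bumps_has_derivative[OF bumps.base[of \<epsilon> 1 a 1 b]] DERIV_isCont
  unfolding bump_def[abs_def] by (intro continuous_at_imp_continuous_on) blast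

lemma bump_test_function:
  assumes "\<epsilon> > 0" "0 < a" "b < T"
  shows "bump \<epsilon> a b \<in> test_functions T"
proof -
  have "bump \<epsilon> a b \<in> bumps" unfolding bump_def[abs_def] by (rule bumps.base[OF assms(1)])
  then show ?thesis unfolding test_functions_def
    using assms bumps_smooth by (intro CollectI conjI allI exI[of _ a] exI[of _ b]) (auto simp: bump_eq)
qed

definition bump_mass :: "real \<Rightarrow> real \<Rightarrow> real \<Rightarrow> real" where
  "bump_mass \<epsilon> a b = (\<integral>x. bump \<epsilon> a b x \<partial>lborel)"

text \<open>Normalising by the mass turns an antiderivative into a smooth step from 0 to 1; it is
  constant on either side of (a, b) by the mean value theorem, as its derivative vanishes
  there.\<close>

lemma bump_primitive:
  assumes \<epsilon>: "\<epsilon> > 0" and ab: "a < b"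
  shows "bump_mass \<epsilon> a b > 0"
    and "\<exists>H. (\<forall>x. (H has_real_derivative bump \<epsilon> a b x / bump_mass \<epsilon> a b) (at x)) \<and> (\<forall>x\<le>a. H x = 0) \<and> (\<forall>x\<ge>b. H x = 1)"
proof -
  have "\<exists>F. \<forall>x::real. - \<infinity> < ereal x \<longrightarrow> ereal x < \<infinity> \<longrightarrow> (F has_vector_derivative bump \<epsilon> a b x) (at x)"
    by (rule einterval_antiderivative) (use continuous_on_bump[OF \<epsilon>, of UNIV a b] in \<open>auto simp: continuous_on_eq_continuous_at\<close>)
  then obtain F where F: "\<And>x. (F has_real_derivative bump \<epsilon> a b x) (at x)"
    by (auto simp: has_real_derivative_iff_has_vector_derivative)
  have left: "F x = F a" if "x \<le> a" for x
  proof (cases "x = a")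
    case False
    with that have "x < a" by simp
    then obtain z where "x < z" "z < a" "F a - F x = (a - x) * bump \<epsilon> a b z"
      using MVT2[of x a F "bump \<epsilon> a b"] F by blast
    then show ?thesis by (simp add: bump_eq)
  qed simp
  have right: "F x = F b" if "x \<ge> b" for x
  proof (cases "x = b")
    case False
    with that have "b < x" by simp
    then obtain z where "b < z" "z < x" "F x - F b = (x - b) * bump \<epsilon> a b z"
      using MVT2[of b x F "bump \<epsilon> a b"] F by blast
    then show ?thesis by (simp add: bump_eq)
  qed simp
  have pos: "F b - F a > 0"
  proof -
    obtain z where "a < z" "z < b" "F b - F a = (b - a) * bump \<epsilon> a b z"
      using MVT2[of a b F "bump \<epsilon> a b"] F ab by blast
    then show ?thesis using ab by (simp add: bump_eq)
  qed
  have "bump_mass \<epsilon> a b = (\<integral>x. indicator {a..b} x *\<^sub>R bump \<epsilon> a b x \<partial>lborel)"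
    unfolding bump_mass_def by (intro Bochner_Integration.integral_cong) (auto simp: indicator_def bump_eq)
  also have "\<dots> = F b - F a"
    by (rule integral_FTC_atLeastAtMost)
       (use ab F continuous_on_bump[OF \<epsilon>] in \<open>auto simp: has_real_derivative_iff_has_vector_derivative[symmetric] intro: DERIV_subset\<close>)
  finally have mass: "bump_mass \<epsilon> a b = F b - F a" .
  show "bump_mass \<epsilon> a b > 0" unfolding mass by (rule pos)
  show "\<exists>H. (\<forall>x. (H has_real_derivative bump \<epsilon> a b x / bump_mass \<epsilon> a b) (at x)) \<and> (\<forall>x\<le>a. H x = 0) \<and> (\<forall>x\<ge>b. H x = 1)"
  proof (intro exI[of _ "\<lambda>x. (F x - F a) / bump_mass \<epsilon> a b"] conjI allI impI)
    show "((\<lambda>x. (F x - F a) / bump_mass \<epsilon> a b) has_real_derivative bump \<epsilon> a b x / bump_mass \<epsilon> a b) (at x)" for x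
      using F[of x] pos unfolding mass by (auto intro!: derivative_eq_intros)
    show "(F x - F a) / bump_mass \<epsilon> a b = 0" if "x \<le> a" for x
      unfolding left[OF that] by simp
    show "(F x - F a) / bump_mass \<epsilon> a b = 1" if "x \<ge> b" for x
      unfolding right[OF that] mass using pos by simp
  qed
qed

text \<open>Two smooth steps both end at 1, so their difference has compact support, and its
  derivative is the difference of two normalised bumps. Such test functions compare two averages in
  the du Bois-Reymond argument.\<close>

lemma bump_difference_test_function:
  assumes "\<epsilon> > 0" "0 < a" "a < b" "b < T" "\<delta> > 0" "0 < c" "c < d" "d < T"
  obtains \<theta> where "\<theta> \<in> test_functions T"
    "\<And>t. deriv \<theta> t = bump \<epsilon> a b t / bump_mass \<epsilon> a b - bump \<delta> c d t / bump_mass \<delta> c d"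
proof -
  obtain H where H0: "(\<forall>x. (H has_real_derivative bump \<epsilon> a b x / bump_mass \<epsilon> a b) (at x)) \<and> (\<forall>x\<le>a. H x = 0) \<and> (\<forall>x\<ge>b. H x = 1)"
    using bump_primitive(2)[OF assms(1,3)] ..
  then have H: "(H has_real_derivative bump \<epsilon> a b x / bump_mass \<epsilon> a b) (at x)" "x \<le> a \<Longrightarrow> H x = 0" "x \<ge> b \<Longrightarrow> H x = 1" for x
    by simp_all
  obtain K where K0: "(\<forall>x. (K has_real_derivative bump \<delta> c d x / bump_mass \<delta> c d) (at x)) \<and> (\<forall>x\<le>c. K x = 0) \<and> (\<forall>x\<ge>d. K x = 1)"
    using bump_primitive(2)[OF assms(5,7)] ..
  then have K: "(K has_real_derivative bump \<delta> c d x / bump_mass \<delta> c d) (at x)" "x \<le> c \<Longrightarrow> K x = 0" "x \<ge> d \<Longrightarrow> K x = 1" for x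
    by simp_all
  define \<theta> where "\<theta> x = H x - K x" for x
  define \<theta>' where "\<theta>' x = bump \<epsilon> a b x / bump_mass \<epsilon> a b - bump \<delta> c d x / bump_mass \<delta> c d" for x
  have D: "(\<theta> has_real_derivative \<theta>' x) (at x)" for x
    unfolding \<theta>_def[abs_def] \<theta>'_def by (intro DERIV_diff H K)
  then have deriv: "deriv \<theta> = \<theta>'" by (intro ext DERIV_imp_deriv)
  \<comment> \<open>Writing the normalising factors as constant polynomials puts the derivative into
    \<open>bumps\<close>, which yields all higher derivatives.\<close>
  have "\<theta>' = (\<lambda>x. flat \<epsilon> [:1 / bump_mass \<epsilon> a b:] (x - a) * flat \<epsilon> 1 (b - x) + flat \<delta> [:- 1 / bump_mass \<delta> c d:] (x - c) * flat \<delta> 1 (d - x))"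
    by (auto simp: \<theta>'_def bump_def flat_def fun_eq_iff)
  then have "\<theta>' \<in> bumps" using assms by (auto intro!: bumps.intros)
  then have "(deriv ^^ n) \<theta> field_differentiable at t" for n t
    using D bumps_smooth by (cases n) (auto simp: field_differentiable_def funpow_Suc_right deriv simp del: funpow.simps)
  moreover have "\<theta> t = 0" if "t \<notin> {min a c..max b d}" for t
    using that assms H(2,3)[of t] K(2,3)[of t] by (auto simp: \<theta>_def min_def max_def split: if_splits)
  ultimately have "\<theta> \<in> test_functions T"
    unfolding test_functions_def using assms
    by (intro CollectI conjI allI exI[of _ "min a c"] exI[of _ "max b d"]) auto
  with that deriv show ?thesis by (auto simp: \<theta>'_def)
qed

lemma test_functionD:
  assumes "\<theta> \<in> test_functions T"
  shows "(\<theta> has_real_derivative deriv \<theta> t) (at t)" "continuous_on S \<theta>" "continuous_on S (deriv \<theta>)"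
    "t \<le> 0 \<Longrightarrow> \<theta> t = 0" "t \<ge> T \<Longrightarrow> \<theta> t = 0"
proof -
  have d: "(deriv ^^ n) \<theta> field_differentiable at t" for n t
    using assms by (auto simp: test_functions_def)
  obtain a b where ab: "0 < a" "b < T" "\<And>t. t \<notin> {a..b} \<Longrightarrow> \<theta> t = 0"
    using assms unfolding test_functions_def by blast
  show "(\<theta> has_real_derivative deriv \<theta> t) (at t)"
    using d[of 0 t] by (simp add: DERIV_deriv_iff_field_differentiable)
  show "continuous_on S \<theta>"
    using d[of 0] by (auto intro!: continuous_at_imp_continuous_on field_differentiable_imp_continuous_at)
  show "continuous_on S (deriv \<theta>)"
    using d[of 1] by (auto intro!: continuous_at_imp_continuous_on field_differentiable_imp_continuous_at)
  show "t \<le> 0 \<Longrightarrow> \<theta> t = 0" "t \<ge> T \<Longrightarrow> \<theta> t = 0"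
    using ab by auto
qed

section \<open>Recovering interval integrals from countably many bumps\<close>

text \<open>The moving end points lie inside (a, b), so the bumps vanish wherever the limit does;
  inside, the exponent tends to 0 because \<epsilon> = 1/(k+1) does.\<close>

lemma bump_tendsto_indicator:
  assumes "p \<longlonglongrightarrow> a" "q \<longlonglongrightarrow> b" "\<And>k. a < p k" "\<And>k. q k < b"
  shows "(\<lambda>k. bump (1 / real (Suc k)) (p k) (q k) t) \<longlonglongrightarrow> indicator {a<..<b} t"
proof (cases "a < t \<and> t < b")
  case True
  have e: "(\<lambda>k. 1 / real (Suc k)) \<longlonglongrightarrow> 0" by (rule LIMSEQ_Suc[OF lim_1_over_n])
  have "(\<lambda>k. exp (- (1 / real (Suc k) / (t - p k)) - 1 / real (Suc k) / (q k - t))) \<longlonglongrightarrow> exp (- (0 / (t - a)) - 0 / (b - t))"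
    using True by (intro tendsto_intros e assms) auto
  moreover have "\<forall>\<^sub>F k in sequentially. exp (- (1 / real (Suc k) / (t - p k)) - 1 / real (Suc k) / (q k - t)) = bump (1 / real (Suc k)) (p k) (q k) t"
    using order_tendstoD(2)[OF assms(1) conjunct1[OF True]] order_tendstoD(1)[OF assms(2) conjunct2[OF True]]
    by eventually_elim (simp add: bump_eq)
  ultimately have "(\<lambda>k. bump (1 / real (Suc k)) (p k) (q k) t) \<longlonglongrightarrow> exp (- (0 / (t - a)) - 0 / (b - t))"
    by (rule Lim_transform_eventually)
  then show ?thesis using True by simp
next
  case False
  then have "bump (1 / real (Suc k)) (p k) (q k) t = 0" for k
    using assms(3,4)[of k] by (auto simp: bump_eq)
  moreover have "indicator {a<..<b} t = (0::real)" using False by auto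
  ultimately show ?thesis by (simp only: tendsto_const)
qed

lemma rational_sequence_right:
  assumes "a < (b :: real)"
  obtains p where "\<And>k :: nat. p k \<in> \<rat>" "\<And>k. a < p k" "\<And>k. p k < b" "p \<longlonglongrightarrow> a"
proof -
  have "\<exists>r\<in>\<rat>. a < r \<and> r < a + (b - a) / real (Suc k)" for k
    using assms Rats_dense_in_real[of a "a + (b - a) / real (Suc k)"] by auto
  then obtain p where p: "\<And>k. p k \<in> \<rat>" "\<And>k. a < p k" "\<And>k. p k < a + (b - a) / real (Suc k)" by metis
  have e: "(\<lambda>k. 1 / real (Suc k)) \<longlonglongrightarrow> 0" by (rule LIMSEQ_Suc[OF lim_1_over_n])
  have "(\<lambda>k. a + (b - a) * (1 / real (Suc k))) \<longlonglongrightarrow> a + (b - a) * 0"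
    by (intro tendsto_intros e)
  then have lim: "(\<lambda>k. a + (b - a) / real (Suc k)) \<longlonglongrightarrow> a" by simp
  have "p \<longlonglongrightarrow> a"
    by (rule tendsto_sandwich[OF _ _ tendsto_const lim]) (use p in \<open>auto intro!: always_eventually less_imp_le\<close>)
  moreover have "p k < b" for k
  proof -
    have "(b - a) / real (Suc k) \<le> (b - a) / 1"
      using assms by (intro divide_left_mono) auto
    then have "(b - a) / real (Suc k) \<le> b - a" by (simp only: div_by_1)
    with p(3)[of k] show ?thesis by linarith
  qed
  ultimately show ?thesis using that p by blast
qed

text \<open>Rational end points approached from inside recover the indicator of any interval by
  dominated convergence, and interval integrals determine the function. Testing only countably many
  bumps allows a common null set when a further variable is present.\<close>

lemma AE_zero_if_bump_integrals_zero:
  assumes int: "integrable (time T) (E :: real \<Rightarrow> complex)"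
    and zero: "\<And>k p q. p \<in> \<rat> \<Longrightarrow> q \<in> \<rat> \<Longrightarrow> 0 < p \<Longrightarrow> p < q \<Longrightarrow> q < T \<Longrightarrow>
      (\<integral>t. complex_of_real (bump (1 / real (Suc k)) p q t) * E t \<partial>time T) = 0"
  shows "AE t in time T. E t = 0"
proof -
  have "AE t in lborel. indicator {0<..<T} t *\<^sub>R E t = 0"
  proof (rule AE_zero_if_interval_integrals_zero)
    show intE: "integrable lborel (\<lambda>t. indicator {0<..<T} t *\<^sub>R E t)"
      using int by (subst (asm) integrable_restrict_space) (auto simp: set_integrable_def)
    note Em = borel_measurable_integrable[OF intE]
    fix a b :: real assume "a < b"
    define a' b' where "a' = max a 0" and "b' = min b T"
    show "(LBINT t:{a<..<b}. indicator {0<..<T} t *\<^sub>R E t) = 0"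
    proof (cases "a' < b'")
      case True
      \<comment> \<open>The midpoint separates the two approximating sequences, so that
        \<open>p k < - q k\<close>; the right end is approached from below by applying the same
        lemma to -b'.\<close>
      define c where "c = (a' + b') / 2"
      have c: "a' < c" "- b' < - c" using True by (auto simp: c_def)
      obtain p where p: "\<And>k :: nat. p k \<in> \<rat>" "\<And>k. a' < p k" "\<And>k. p k < c" "p \<longlonglongrightarrow> a'"
        using rational_sequence_right[OF c(1)] by blast
      obtain q where q: "\<And>k :: nat. q k \<in> \<rat>" "\<And>k. - b' < q k" "\<And>k. q k < - c" "q \<longlonglongrightarrow> - b'"
        using rational_sequence_right[OF c(2)] by blast
      have lq: "(\<lambda>k. - q k) \<longlonglongrightarrow> b'" using tendsto_minus[OF q(4)] by simp
      let ?\<rho> = "\<lambda>k. bump (1 / real (Suc k)) (p k) (- q k)"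
      have "(\<lambda>k. \<integral>t. complex_of_real (?\<rho> k t) * (indicator {0<..<T} t *\<^sub>R E t) \<partial>lborel)
          \<longlonglongrightarrow> (\<integral>t. complex_of_real (indicator {a'<..<b'} t) * (indicator {0<..<T} t *\<^sub>R E t) \<partial>lborel)"
      proof (rule integral_dominated_convergence[where w = "\<lambda>t. norm (indicator {0<..<T} t *\<^sub>R E t)"])
        show "integrable lborel (\<lambda>t. norm (indicator {0<..<T} t *\<^sub>R E t))" using intE by (rule integrable_norm)
        show "AE t in lborel. (\<lambda>k. complex_of_real (?\<rho> k t) * (indicator {0<..<T} t *\<^sub>R E t)) \<longlonglongrightarrow> complex_of_real (indicator {a'<..<b'} t) * (indicator {0<..<T} t *\<^sub>R E t)"
          by (intro AE_I2 tendsto_intros bump_tendsto_indicator p lq) (use q(2) in \<open>simp add: minus_less_iff\<close>)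
        show "AE t in lborel. norm (complex_of_real (?\<rho> k t) * (indicator {0<..<T} t *\<^sub>R E t)) \<le> norm (indicator {0<..<T} t *\<^sub>R E t)" for k
          using bump_nonneg bump_le_1[of "1 / real (Suc k)"]
          by (intro AE_I2) (simp only: norm_mult norm_of_real abs_of_nonneg[OF bump_nonneg], intro mult_left_le_one_le, auto)
        have "?\<rho> k \<in> borel_measurable borel" for k
          by (intro borel_measurable_continuous_onI continuous_on_bump) auto
        then have "(\<lambda>t. complex_of_real (?\<rho> k t)) \<in> borel_measurable lborel" for k
          by measurable
        then show "(\<lambda>t. complex_of_real (?\<rho> k t) * (indicator {0<..<T} t *\<^sub>R E t)) \<in> borel_measurable lborel" for k
          using Em by (rule borel_measurable_times)
        have "(\<lambda>t. complex_of_real (indicator {a'<..<b'} t)) \<in> borel_measurable lborel" by measurable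
        then show "(\<lambda>t. complex_of_real (indicator {a'<..<b'} t) * (indicator {0<..<T} t *\<^sub>R E t)) \<in> borel_measurable lborel"
          using Em by (rule borel_measurable_times)
      qed
      moreover have "(\<integral>t. complex_of_real (?\<rho> k t) * (indicator {0<..<T} t *\<^sub>R E t) \<partial>lborel) = 0" for k
      proof -
        have "(\<integral>t. complex_of_real (?\<rho> k t) * (indicator {0<..<T} t *\<^sub>R E t) \<partial>lborel) = (\<integral>t. complex_of_real (?\<rho> k t) * E t \<partial>time T)"
          by (subst integral_restrict_space) (auto simp: set_lebesgue_integral_def intro!: Bochner_Integration.integral_cong)
        also have "\<dots> = 0"
        proof (rule zero)
          show "0 < p k" using p(2)[of k] by (simp add: a'_def)
          show "- q k < T" using q(2)[of k] by (simp add: b'_def)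
          show "p k < - q k" using p(3)[of k] q(3)[of k] by linarith
        qed (use p q in auto)
        finally show ?thesis .
      qed
      ultimately have "(\<integral>t. complex_of_real (indicator {a'<..<b'} t) * (indicator {0<..<T} t *\<^sub>R E t) \<partial>lborel) = 0"
        by (simp add: LIMSEQ_const_iff)
      moreover have "(LBINT t:{a<..<b}. indicator {0<..<T} t *\<^sub>R E t) = (\<integral>t. complex_of_real (indicator {a'<..<b'} t) * (indicator {0<..<T} t *\<^sub>R E t) \<partial>lborel)"
        unfolding set_lebesgue_integral_def a'_def b'_def by (intro Bochner_Integration.integral_cong) (auto simp: indicator_def)
      ultimately show ?thesis by simp
    next
      case False
      then have "indicat_real {a<..<b} t *\<^sub>R (indicator {0<..<T} t *\<^sub>R E t) = 0" for t
        by (auto simp: indicator_def a'_def b'_def)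
      then show ?thesis unfolding set_lebesgue_integral_def by (simp only: Bochner_Integration.integral_zero)
    qed
  qed
  then show ?thesis unfolding AE_time_iff by eventually_elim (auto simp: indicator_def)
qed

section \<open>Absolutely continuous functions of time\<close>

text \<open>Cutting with \<open>{..<r}\<close> inside the integral over (0, T) makes the function
  total in r: it is 0 for r \<le> 0 and the full integral for r \<ge> T. Absolutely continuous
  functions are handled throughout as a constant plus such a primitive.\<close>

definition primitive :: "real \<Rightarrow> (real \<Rightarrow> complex) \<Rightarrow> real \<Rightarrow> complex" where
  "primitive T g r = (\<integral>s. indicator {..<r} s * g s \<partial>time T)"

lemma integrable_bounded_mult_time:
  fixes g :: "real \<Rightarrow> complex"
  assumes g: "integrable (time T) g" and \<phi>: "\<phi> \<in> borel_measurable (time T)"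
    and bnd: "\<And>t. t \<in> {0<..<T} \<Longrightarrow> cmod (\<phi> t) \<le> B"
  shows "integrable (time T) (\<lambda>t. \<phi> t * g t)"
proof (rule Bochner_Integration.integrable_bound[where f = "\<lambda>t. B * cmod (g t)"])
  show "integrable (time T) (\<lambda>t. B * cmod (g t))" using g by simp
  show "(\<lambda>t. \<phi> t * g t) \<in> borel_measurable (time T)"
    using \<phi> borel_measurable_integrable[OF g] by (rule borel_measurable_times)
  show "AE t in time T. norm (\<phi> t * g t) \<le> norm (B * cmod (g t))"
    using AE_space_time
  proof eventually_elim
    case (elim t)
    have "cmod (\<phi> t) * cmod (g t) \<le> B * cmod (g t)" using bnd[OF elim] by (intro mult_right_mono) auto
    then show ?case by (simp add: norm_mult)
  qed
qed

lemma indicator_measurable_time: "(\<lambda>s. indicator {..<r} s :: complex) \<in> borel_measurable (time T)"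
  by (intro measurable_time) auto

lemma integrable_indicator_time:
  fixes g :: "real \<Rightarrow> complex"
  assumes "integrable (time T) g"
  shows "integrable (time T) (\<lambda>s. indicator {..<r} s * g s)"
  by (rule integrable_bounded_mult_time[OF assms indicator_measurable_time, of _ 1]) (auto simp: indicator_def)

lemma primitive_0: "r \<le> 0 \<Longrightarrow> primitive T g r = 0"
  unfolding primitive_def by (rule integral_eq_zero_AE) (use AE_space_time in \<open>auto elim!: eventually_mono simp: indicator_def\<close>)

lemma primitive_end:
  assumes "r \<ge> T"
  shows "primitive T g r = (\<integral>s. g s \<partial>time T)"
  unfolding primitive_def using assms by (intro Bochner_Integration.integral_cong) (auto simp: space_time indicator_def)

lemma primitive_cong:
  assumes "\<And>s. s \<in> {0<..<T} \<Longrightarrow> g s = h s"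
  shows "primitive T g r = primitive T h r"
  unfolding primitive_def using assms by (intro Bochner_Integration.integral_cong) (auto simp: space_time)

lemma primitive_cong_AE:
  assumes "AE s in time T. g s = h s" "g \<in> borel_measurable (time T)" "h \<in> borel_measurable (time T)"
  shows "primitive T g r = primitive T h r"
  unfolding primitive_def
  using assms by (intro integral_cong_AE borel_measurable_times indicator_measurable_time) (auto elim: eventually_mono)

lemma primitive_add:
  assumes "integrable (time T) g" "integrable (time T) h"
  shows "primitive T (\<lambda>s. g s + h s) r = primitive T g r + primitive T h r"
  unfolding primitive_def distrib_left
  by (intro Bochner_Integration.integral_add integrable_indicator_time assms)

lemma primitive_cmult: "primitive T (\<lambda>s. c * g s) r = c * primitive T g r"
proof -
  have "primitive T (\<lambda>s. c * g s) r = (\<integral>s. c * (indicator {..<r} s * g s) \<partial>time T)"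
    unfolding primitive_def by (simp only: mult.left_commute)
  then show ?thesis unfolding primitive_def by (simp only: integral_mult_right_zero)
qed

lemma primitive_diff:
  assumes "integrable (time T) g" "integrable (time T) h"
  shows "primitive T (\<lambda>s. g s - h s) r = primitive T g r - primitive T h r"
  unfolding primitive_def right_diff_distrib
  by (intro Bochner_Integration.integral_diff integrable_indicator_time assms)

lemma primitive_cnj: "primitive T (\<lambda>s. cnj (g s)) r = cnj (primitive T g r)"
proof -
  have "primitive T (\<lambda>s. cnj (g s)) r = (\<integral>s. cnj (indicator {..<r} s * g s) \<partial>time T)"
    unfolding primitive_def by (intro Bochner_Integration.integral_cong) (auto simp: indicator_def)
  then show ?thesis unfolding primitive_def by (simp only: Bochner_Integration.integral_cnj)
qed

lemma primitive_bound:
  assumes "integrable (time T) g"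
  shows "cmod (primitive T g r) \<le> (\<integral>s. cmod (g s) \<partial>time T)"
proof -
  have "cmod (primitive T g r) \<le> (\<integral>s. cmod (indicator {..<r} s * g s) \<partial>time T)"
    unfolding primitive_def by (rule integral_norm_bound)
  also have "\<dots> \<le> (\<integral>s. cmod (g s) \<partial>time T)"
    using assms integrable_indicator_time[OF assms, of r]
    by (intro integral_mono integrable_norm) (auto simp: indicator_def)
  finally show ?thesis .
qed

lemma primitive_measurable:
  assumes g: "g \<in> borel_measurable (time T)"
  shows "primitive T g \<in> borel_measurable borel"
  unfolding primitive_def[abs_def]
proof (rule sigma_finite_measure.borel_measurable_lebesgue_integral[OF sigma_finite_time])
  have i: "Measurable.pred (borel \<Otimes>\<^sub>M time T) (\<lambda>k. snd k < fst k)"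
  proof (rule borel_measurable_pred_less)
    show "snd \<in> borel_measurable (borel \<Otimes>\<^sub>M time T)"
      by (rule measurable_compose[OF measurable_snd measurable_time_ident])
  qed measurable
  have "(\<lambda>k. (if snd k < fst k then g (snd k) else 0)) \<in> borel_measurable (borel \<Otimes>\<^sub>M time T)"
    by (rule measurable_If[OF measurable_compose[OF measurable_snd g] borel_measurable_const]) (use i in \<open>simp only: pred_def\<close>)
  moreover have "(\<lambda>k. (if snd k < fst k then g (snd k) else 0)) = (\<lambda>(r, s). indicator {..<r} s * g s)"
    by (auto simp: indicator_def)
  ultimately show "(\<lambda>(r, s). indicator {..<r} s * g s) \<in> borel_measurable (borel \<Otimes>\<^sub>M time T)" by simp
qed

lemma primitive_integrable_mult:
  assumes g: "integrable (time T) g" and h: "integrable (time T) h"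
  shows "integrable (time T) (\<lambda>s. primitive T h s * g s)"
  by (rule integrable_bounded_mult_time[OF g measurable_time[OF primitive_measurable[OF borel_measurable_integrable[OF h]]] primitive_bound[OF h]])

lemma AE_time_neq: "AE t in time T. t \<noteq> s"
  unfolding AE_time_iff using AE_lborel_singleton[of s] by eventually_elim auto

lemma pair_time: "pair_sigma_finite (time T) (time T)"
  by (intro pair_sigma_finite.intro sigma_finite_time)

text \<open>Fubini on the square: the product g s h t is split into the parts on either side of the
  diagonal, each of which gives one of the two terms on the right; the diagonal itself is a null
  set.\<close>

lemma primitive_product_total:
  assumes g: "integrable (time T) g" and h: "integrable (time T) h"
  shows "(\<integral>s. g s \<partial>time T) * (\<integral>s. h s \<partial>time T) = (\<integral>s. primitive T h s * g s + primitive T g s * h s \<partial>time T)"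
proof -
  note gm = borel_measurable_integrable[OF g] and hm = borel_measurable_integrable[OF h]
  let ?f = "\<lambda>s t. indicator {..<t} s * (g s * h t)"
  have prim: "(\<integral>s. ?f s t \<partial>time T) = primitive T g t * h t" for t
  proof -
    have "(\<integral>s. ?f s t \<partial>time T) = (\<integral>s. indicator {..<t} s * g s * h t \<partial>time T)" by (simp only: mult.assoc)
    then show ?thesis by (simp only: integral_mult_left_zero primitive_def)
  qed
  have i: "Measurable.pred (time T \<Otimes>\<^sub>M time T) (\<lambda>k. fst k < snd k)"
    by (rule borel_measurable_pred_less[OF measurable_compose[OF measurable_fst measurable_time_ident] measurable_compose[OF measurable_snd measurable_time_ident]])
  have "(\<lambda>k. (if fst k < snd k then g (fst k) * h (snd k) else 0)) \<in> borel_measurable (time T \<Otimes>\<^sub>M time T)"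
    by (rule measurable_If[OF borel_measurable_times[OF measurable_compose[OF measurable_fst gm] measurable_compose[OF measurable_snd hm]] borel_measurable_const]) (use i in \<open>simp only: pred_def\<close>)
  moreover have "(\<lambda>k. (if fst k < snd k then g (fst k) * h (snd k) else 0)) = case_prod ?f"
    by (auto simp: indicator_def)
  ultimately have fm: "case_prod ?f \<in> borel_measurable (time T \<Otimes>\<^sub>M time T)" by simp
  have int: "integrable (time T \<Otimes>\<^sub>M time T) (case_prod ?f)"
  proof (rule Bochner_Integration.integrable_bound[OF _ fm])
    show "integrable (time T \<Otimes>\<^sub>M time T) (\<lambda>(s, t). g s * h t)"
    proof (rule pair_sigma_finite.Fubini_integrable[OF pair_time])
      show "(\<lambda>(s, t). g s * h t) \<in> borel_measurable (time T \<Otimes>\<^sub>M time T)"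
        using borel_measurable_times[OF measurable_compose[OF measurable_fst gm] measurable_compose[OF measurable_snd hm]]
        by (simp only: case_prod_beta')
    qed (use g h in \<open>auto simp: norm_mult\<close>)
    show "AE k in time T \<Otimes>\<^sub>M time T. norm (case_prod ?f k) \<le> norm (case k of (s, t) \<Rightarrow> g s * h t)"
      by (auto simp: indicator_def)
  qed
  have swap: "(\<integral>s. (\<integral>t. ?f s t \<partial>time T) \<partial>time T) = (\<integral>t. primitive T g t * h t \<partial>time T)"
    using pair_sigma_finite.Fubini_integral[OF pair_time int] by (simp only: prim)
  \<comment> \<open>For fixed s the part t > s is the whole integral minus the part t < s, as t = s
    has measure zero.\<close>
  have split: "(\<integral>t. ?f s t \<partial>time T) = g s * (\<integral>t. h t \<partial>time T) - primitive T h s * g s" for s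
  proof -
    have "(\<integral>t. ?f s t \<partial>time T) = (\<integral>t. g s * (h t - indicator {..<s} t * h t) \<partial>time T)"
    proof (rule integral_cong_AE)
      show "AE t in time T. ?f s t = g s * (h t - indicator {..<s} t * h t)"
        using AE_time_neq[where s = s and T = T] by eventually_elim (auto simp: indicator_def)
      show "(\<lambda>t. g s * (h t - indicator {..<s} t * h t)) \<in> borel_measurable (time T)"
        by (intro borel_measurable_times borel_measurable_diff borel_measurable_const hm indicator_measurable_time)
      have "(\<lambda>t. indicator {s<..} t * (g s * h t)) \<in> borel_measurable (time T)"
        by (intro borel_measurable_times borel_measurable_const hm measurable_time) auto
      moreover have "indicator {s<..} t = (indicator {..<t} s :: complex)" for t by (auto simp: indicator_def)
      ultimately show "(\<lambda>t. ?f s t) \<in> borel_measurable (time T)" by (simp only:)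
    qed
    also have "\<dots> = g s * ((\<integral>t. h t \<partial>time T) - primitive T h s)"
      unfolding primitive_def
      by (subst integral_mult_right_zero, subst Bochner_Integration.integral_diff[OF h integrable_indicator_time[OF h]]) simp
    finally show ?thesis by (simp add: algebra_simps)
  qed
  have "(\<integral>s. (\<integral>t. ?f s t \<partial>time T) \<partial>time T) = (\<integral>s. g s * (\<integral>t. h t \<partial>time T) \<partial>time T) - (\<integral>s. primitive T h s * g s \<partial>time T)"
    unfolding split by (intro Bochner_Integration.integral_diff integrable_mult_left g primitive_integrable_mult h)
  then have "(\<integral>s. g s \<partial>time T) * (\<integral>s. h s \<partial>time T) = (\<integral>s. primitive T h s * g s \<partial>time T) + (\<integral>t. primitive T g t * h t \<partial>time T)"
    unfolding swap by simp
  also have "\<dots> = (\<integral>s. primitive T h s * g s + primitive T g s * h s \<partial>time T)"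
    by (intro Bochner_Integration.integral_add[symmetric] primitive_integrable_mult g h)
  finally show ?thesis .
qed

text \<open>The identity on all of (0, T) is applied to g and h cut off at r; below r the primitives
  of the cut functions are unchanged.\<close>

lemma primitive_product:
  assumes g: "integrable (time T) g" and h: "integrable (time T) h"
  shows "primitive T g r * primitive T h r = primitive T (\<lambda>s. primitive T h s * g s + primitive T g s * h s) r"
proof -
  let ?g = "\<lambda>s. indicator {..<r} s * g s" and ?h = "\<lambda>s. indicator {..<r} s * h s"
  have p: "primitive T (\<lambda>s. indicator {..<r} s * k s) s = primitive T k s" if "s \<le> r" for k :: "real \<Rightarrow> complex" and s
    unfolding primitive_def using that by (intro Bochner_Integration.integral_cong) (auto simp: indicator_def)
  have "primitive T g r * primitive T h r = (\<integral>s. primitive T ?h s * ?g s + primitive T ?g s * ?h s \<partial>time T)"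
    using primitive_product_total[OF integrable_indicator_time[OF g, of r] integrable_indicator_time[OF h, of r]]
    by (simp only: primitive_def[of T g r] primitive_def[of T h r])
  also have "\<dots> = primitive T (\<lambda>s. primitive T h s * g s + primitive T g s * h s) r"
    unfolding primitive_def[of T "\<lambda>s. primitive T h s * g s + primitive T g s * h s"]
  proof (intro Bochner_Integration.integral_cong refl)
    fix s
    show "primitive T ?h s * ?g s + primitive T ?g s * ?h s = indicator {..<r} s * (primitive T h s * g s + primitive T g s * h s)"
    proof (cases "s < r")
      case True
      then have "indicator {..<r} s = (1::complex)" by simp
      then show ?thesis by (simp only: p[OF less_imp_le[OF True]] mult_1_left)
    next
      case False
      then have "indicator {..<r} s = (0::complex)" by simp
      then show ?thesis by (simp only: mult_zero_left mult_zero_right add_0_left)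
    qed
  qed
  finally show ?thesis .
qed

text \<open>The product rule for absolutely continuous functions in integrated form. The second
  factor will be a test function (integration by parts), an exponential (integrating factor) or the
  conjugate of the first (energy identity).\<close>

lemma primitive_product_rule:
  assumes g: "integrable (time T) g" and h: "integrable (time T) h"
    and A: "\<And>s. s \<in> {0..T} \<Longrightarrow> A s = a + primitive T g s" and B: "\<And>s. s \<in> {0..T} \<Longrightarrow> B s = b + primitive T h s"
    and r: "r \<in> {0..T}"
  shows "A r * B r = a * b + primitive T (\<lambda>s. B s * g s + A s * h s) r"
proof -
  have "primitive T (\<lambda>s. B s * g s + A s * h s) r = primitive T (\<lambda>s. (b * g s + a * h s) + (primitive T h s * g s + primitive T g s * h s)) r"
    by (rule primitive_cong) (simp add: A B algebra_simps)
  also have "\<dots> = (b * primitive T g r + a * primitive T h r) + primitive T g r * primitive T h r"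
    by (subst primitive_add) (auto simp: primitive_add primitive_cmult primitive_product g h
        intro!: Bochner_Integration.integrable_add primitive_integrable_mult g h)
  finally show ?thesis using A[OF r] B[OF r] by (simp add: algebra_simps)
qed

lemma continuous_imp_integrable_time:
  fixes f :: "real \<Rightarrow> complex"
  assumes f: "continuous_on UNIV f"
  shows "integrable (time T) f" "\<exists>B. \<forall>t\<in>{0<..<T}. cmod (f t) \<le> B" "f \<in> borel_measurable (time T)"
proof -
  show m: "f \<in> borel_measurable (time T)"
    using f by (intro measurable_time borel_measurable_continuous_onI)
  have "bounded (f ` {0..T})"
    by (intro compact_imp_bounded compact_continuous_image continuous_on_subset[OF f]) auto
  then obtain B where "\<forall>z\<in>f ` {0..T}. cmod z \<le> B" unfolding bounded_iff ..
  then have B: "cmod (f t) \<le> B" if "t \<in> {0..T}" for t using that by blast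
  then show "\<exists>B. \<forall>t\<in>{0<..<T}. cmod (f t) \<le> B" by (intro exI[of _ B]) auto
  show "integrable (time T) f"
    by (intro sq_integrable_imp_integrable_time sq_integrable_time_bounded[OF m, of B] B) auto
qed

lemma primitive_FTC:
  fixes f f' :: "real \<Rightarrow> complex"
  assumes D: "\<And>t. (f has_vector_derivative f' t) (at t)" and c: "continuous_on UNIV f'" and r: "r \<in> {0..T}"
  shows "f r = f 0 + primitive T f' r"
proof -
  have "primitive T f' r = (\<integral>s. indicator {0<..<T} s *\<^sub>R (indicator {..<r} s * f' s) \<partial>lborel)"
    unfolding primitive_def by (subst integral_restrict_space) (auto simp: set_lebesgue_integral_def)
  also have "\<dots> = (\<integral>s. indicator {0..r} s *\<^sub>R f' s \<partial>lborel)"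
  proof (rule integral_cong_AE)
    have [measurable]: "f' \<in> borel_measurable borel" using c by (rule borel_measurable_continuous_onI)
    show "(\<lambda>s. indicator {0<..<T} s *\<^sub>R (indicator {..<r} s * f' s)) \<in> borel_measurable lborel"
      "(\<lambda>s. indicator {0..r} s *\<^sub>R f' s) \<in> borel_measurable lborel" by measurable
    have "AE s in lborel. s \<noteq> 0 \<and> s \<noteq> r"
      using AE_lborel_singleton[of 0] AE_lborel_singleton[of r] by eventually_elim auto
    then show "AE s in lborel. indicator {0<..<T} s *\<^sub>R (indicator {..<r} s * f' s) = indicator {0..r} s *\<^sub>R f' s"
      by eventually_elim (use r in \<open>auto simp: indicator_def\<close>)
  qed
  also have "\<dots> = f r - f 0"
    by (rule integral_FTC_atLeastAtMost)
       (use r D c in \<open>auto intro: has_vector_derivative_at_within continuous_on_subset\<close>)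
  finally show ?thesis by simp
qed

lemma test_function_primitive:
  assumes \<theta>: "\<theta> \<in> test_functions T" and r: "r \<in> {0..T}"
  shows "complex_of_real (\<theta> r) = 0 + primitive T (\<lambda>t. complex_of_real (deriv \<theta> t)) r"
proof -
  have "((\<lambda>t. complex_of_real (\<theta> t)) has_vector_derivative complex_of_real (deriv \<theta> t)) (at t)" for t
    using test_functionD(1)[OF \<theta>, of t] by (intro has_vector_derivative_of_real) (simp add: has_real_derivative_iff_has_vector_derivative)
  from primitive_FTC[OF this _ r] show ?thesis
    using test_functionD(3,4)[OF \<theta>] by (simp add: continuous_on_of_real)
qed

text \<open>The product rule at r = T, where the boundary terms vanish because \<theta> is 0 at both
  ends.\<close>

lemma integration_by_parts_test:
  assumes \<theta>: "\<theta> \<in> test_functions T" and T: "T > 0" and g: "integrable (time T) g"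
    and A: "\<And>s. s \<in> {0..T} \<Longrightarrow> A s = a + primitive T g s"
  shows "(\<integral>t. complex_of_real (deriv \<theta> t) * A t \<partial>time T) = - (\<integral>t. complex_of_real (\<theta> t) * g t \<partial>time T)"
proof -
  have c: "continuous_on UNIV (\<lambda>t. complex_of_real (deriv \<theta> t))" "continuous_on UNIV (\<lambda>t. complex_of_real (\<theta> t))"
    using test_functionD(2,3)[OF \<theta>] by (simp_all add: continuous_on_of_real)
  note d = continuous_imp_integrable_time[OF c(1), of T]
  obtain B where B: "\<And>t. t \<in> {0<..<T} \<Longrightarrow> cmod (complex_of_real (\<theta> t)) \<le> B"
    using continuous_imp_integrable_time(2)[OF c(2), of T] by blast
  have "T \<in> {0..T}" using T by simp
  from primitive_product_rule[OF g d(1) A test_function_primitive[OF \<theta>] this]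
  have "0 = (\<integral>s. complex_of_real (\<theta> s) * g s + A s * complex_of_real (deriv \<theta> s) \<partial>time T)"
    using test_functionD(5)[OF \<theta>, of T] by (simp add: primitive_end)
  also have "\<dots> = (\<integral>s. complex_of_real (\<theta> s) * g s \<partial>time T) + (\<integral>s. A s * complex_of_real (deriv \<theta> s) \<partial>time T)"
  proof (rule Bochner_Integration.integral_add)
    show "integrable (time T) (\<lambda>s. complex_of_real (\<theta> s) * g s)"
      by (rule integrable_bounded_mult_time[OF g continuous_imp_integrable_time(3)[OF c(2)] B])
    have "integrable (time T) (\<lambda>s. a * complex_of_real (deriv \<theta> s) + primitive T g s * complex_of_real (deriv \<theta> s))"
      by (intro Bochner_Integration.integrable_add integrable_mult_right d primitive_integrable_mult g)
    then show "integrable (time T) (\<lambda>s. A s * complex_of_real (deriv \<theta> s))"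
      by (rule Bochner_Integration.integrable_cong[THEN iffD1, rotated -1]) (auto simp: space_time A distrib_right)
  qed
  finally show ?thesis by (simp add: mult.commute add_eq_0_iff2)
qed

section \<open>Periodic solutions of the scalar equation\<close>

lemma exp_primitive:
  assumes r: "r \<in> {0..T}"
  shows "complex_of_real (exp (k * r)) = 1 + primitive T (\<lambda>s. complex_of_real (k * exp (k * s))) r"
proof -
  have "((\<lambda>t. complex_of_real (exp (k * t))) has_vector_derivative complex_of_real (k * exp (k * t))) (at t)" for t
  proof -
    have "((\<lambda>t. exp (k * t)) has_real_derivative k * exp (k * t)) (at t)"
      by (auto intro!: derivative_eq_intros)
    then show ?thesis by (intro has_vector_derivative_of_real) (simp add: has_real_derivative_iff_has_vector_derivative)
  qed
  from primitive_FTC[OF this _ r] show ?thesis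
    by (simp add: continuous_intros del: of_real_mult)
qed

lemma continuous_exp_complex: "continuous_on UNIV (\<lambda>s. complex_of_real (exp (k * s)))"
  by (intro continuous_intros)

lemma integrable_exp_mult:
  assumes "integrable (time T) F"
  shows "integrable (time T) (\<lambda>s. complex_of_real (exp (k * s)) * F s)"
proof -
  obtain B where "\<forall>t\<in>{0<..<T}. cmod (complex_of_real (exp (k * t))) \<le> B"
    using continuous_imp_integrable_time(2)[OF continuous_exp_complex, of T k] ..
  then show ?thesis
    by (intro integrable_bounded_mult_time[OF assms continuous_imp_integrable_time(3)[OF continuous_exp_complex], of _ B]) blast
qed

text \<open>The initial value c for which variation of constants closes up after one period: c = exp
  (-m T) (c + I), with I the integral. For m = 0 the denominator vanishes and the quotient is 0 by
  convention; this concerns the frequency 0 only.\<close>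

definition periodic_const :: "real \<Rightarrow> real \<Rightarrow> (real \<Rightarrow> complex) \<Rightarrow> complex" where
  "periodic_const T m F = complex_of_real (exp (- m * T) / (1 - exp (- m * T))) * (\<integral>s. complex_of_real (exp (m * s)) * F s \<partial>time T)"

text \<open>Variation of constants, with the decaying exponential pulled out of the
  integral.\<close>

definition periodic_sol :: "real \<Rightarrow> real \<Rightarrow> (real \<Rightarrow> complex) \<Rightarrow> real \<Rightarrow> complex" where
  "periodic_sol T m F t = complex_of_real (exp (- m * t)) * (periodic_const T m F + primitive T (\<lambda>s. complex_of_real (exp (m * s)) * F s) t)"

lemma periodic_sol_0: "periodic_sol T m F 0 = periodic_const T m F"
  by (simp add: periodic_sol_def primitive_0)

lemma periodic_sol_measurable:
  assumes "integrable (time T) F"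
  shows "periodic_sol T m F \<in> borel_measurable borel"
proof -
  have [measurable]: "primitive T (\<lambda>s. complex_of_real (exp (m * s)) * F s) \<in> borel_measurable borel"
    by (rule primitive_measurable[OF borel_measurable_integrable[OF integrable_exp_mult[OF assms]]])
  show ?thesis unfolding periodic_sol_def[abs_def] by measurable
qed

lemma periodic_sol_bounded:
  assumes F: "integrable (time T) F"
  shows "\<exists>B. \<forall>t\<in>{0<..<T}. cmod (periodic_sol T m F t) \<le> B"
proof -
  obtain B where B: "\<forall>t\<in>{0<..<T}. cmod (complex_of_real (exp (- m * t))) \<le> B"
    using continuous_imp_integrable_time(2)[OF continuous_exp_complex, of T "- m"] ..
  define K where "K = cmod (periodic_const T m F) + (\<integral>s. cmod (complex_of_real (exp (m * s)) * F s) \<partial>time T)"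
  have K: "cmod (periodic_const T m F + primitive T (\<lambda>s. complex_of_real (exp (m * s)) * F s) t) \<le> K" for t
    unfolding K_def by (intro order_trans[OF norm_triangle_ineq] add_left_mono primitive_bound integrable_exp_mult F)
  have "cmod (periodic_sol T m F t) \<le> B * K" if "t \<in> {0<..<T}" for t
    unfolding periodic_sol_def norm_mult using B that K order_trans[OF norm_ge_zero bspec[OF B that]]
    by (intro mult_mono) auto
  then show ?thesis by (intro exI ballI)
qed

lemma sq_integrable_periodic_sol:
  assumes F: "integrable (time T) F"
  shows "sq_integrable (time T) (periodic_sol T m F)"
proof -
  obtain B where "\<forall>t\<in>{0<..<T}. cmod (periodic_sol T m F t) \<le> B"
    using periodic_sol_bounded[OF F, of m] ..
  then show ?thesis by (intro sq_integrable_time_bounded[where B = B] measurable_time periodic_sol_measurable F) blast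
qed

lemma integrable_periodic_rhs:
  assumes F: "integrable (time T) F"
  shows "integrable (time T) (\<lambda>s. F s - complex_of_real m * periodic_sol T m F s)"
  by (intro Bochner_Integration.integrable_diff F integrable_mult_right sq_integrable_imp_integrable_time sq_integrable_periodic_sol)

text \<open>The product rule for the decaying exponential and the bracket in the formula; the two
  exponentials cancel in front of F.\<close>

lemma periodic_sol_primitive:
  assumes F: "integrable (time T) F" and t: "t \<in> {0..T}"
  shows "periodic_sol T m F t = periodic_sol T m F 0 + primitive T (\<lambda>s. F s - complex_of_real m * periodic_sol T m F s) t"
proof -
  let ?g = "\<lambda>s. complex_of_real (- m * exp (- m * s))" and ?h = "\<lambda>s. complex_of_real (exp (m * s)) * F s"
  let ?B = "\<lambda>s. periodic_const T m F + primitive T ?h s"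
  have g: "integrable (time T) ?g"
    by (rule continuous_imp_integrable_time(1)) (intro continuous_intros)
  have "complex_of_real (exp (- m * t)) * ?B t = 1 * periodic_const T m F + primitive T (\<lambda>s. ?B s * ?g s + complex_of_real (exp (- m * s)) * ?h s) t"
    by (rule primitive_product_rule[OF g integrable_exp_mult[OF F] exp_primitive refl t])
  moreover have "primitive T (\<lambda>s. ?B s * ?g s + complex_of_real (exp (- m * s)) * ?h s) t = primitive T (\<lambda>s. F s - complex_of_real m * periodic_sol T m F s) t"
  proof (rule primitive_cong)
    fix s
    have "complex_of_real (exp (- m * s)) * complex_of_real (exp (m * s)) = 1"
      by (simp add: exp_minus flip: of_real_mult)
    then have "complex_of_real (exp (- m * s)) * ?h s = F s" by (simp only: mult.assoc[symmetric] mult_1_left)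
    then show "?B s * ?g s + complex_of_real (exp (- m * s)) * ?h s = F s - complex_of_real m * periodic_sol T m F s"
      by (simp add: periodic_sol_def algebra_simps)
  qed
  ultimately show ?thesis unfolding periodic_sol_0 by (simp add: periodic_sol_def)
qed

lemma periodic_sol_periodic:
  assumes T: "T > 0" and m: "m > 0"
  shows "periodic_sol T m F T = periodic_sol T m F 0"
proof -
  define e where "e = exp (- m * T)"
  define I where "I = (\<integral>s. complex_of_real (exp (m * s)) * F s \<partial>time T)"
  have "e < 1" using T m by (simp add: e_def)
  then have "e * (e / (1 - e) + 1) = e / (1 - e)" by (simp add: field_simps)
  then have "complex_of_real e * (complex_of_real (e / (1 - e)) + 1) = complex_of_real (e / (1 - e))"
    by (metis of_real_1 of_real_add of_real_mult)
  then have "complex_of_real e * (complex_of_real (e / (1 - e)) * I + I) = complex_of_real (e / (1 - e)) * I"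
    by (metis distrib_right mult.assoc mult_1_left)
  then show ?thesis
    unfolding periodic_sol_0
    unfolding periodic_sol_def periodic_const_def e_def I_def primitive_end[OF order_refl]
    by (simp only:)
qed

text \<open>For the difference W of two solutions, exp (m t) W t is constant. Periodicity then gives
  (exp (m T) - 1) W 0 = 0, and m T > 0 makes the factor nonzero.\<close>

lemma periodic_sol_unique:
  assumes T: "T > 0" and m: "m > 0" and F: "integrable (time T) F" and g: "integrable (time T) g"
    and A: "\<And>s. s \<in> {0..T} \<Longrightarrow> A s = a + primitive T g s"
    and eq: "AE s in time T. g s + complex_of_real m * A s = F s"
    and per: "A T = A 0"
    and t: "t \<in> {0..T}"
  shows "A t = periodic_sol T m F t"
proof -
  define W where "W s = A s - periodic_sol T m F s" for s
  let ?k = "\<lambda>s. g s - (F s - complex_of_real m * periodic_sol T m F s)"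
  have k: "integrable (time T) ?k" by (intro Bochner_Integration.integrable_diff g integrable_periodic_rhs F)
  have W: "W s = (a - periodic_sol T m F 0) + primitive T ?k s" if "s \<in> {0..T}" for s
    unfolding W_def A[OF that] periodic_sol_primitive[OF F that] primitive_diff[OF g integrable_periodic_rhs[OF F]]
    by simp
  let ?e = "\<lambda>s. complex_of_real (m * exp (m * s))"
  have e: "integrable (time T) ?e"
    by (rule continuous_imp_integrable_time(1)) (intro continuous_intros)
  have const: "complex_of_real (exp (m * r)) * W r = 1 * (a - periodic_sol T m F 0)" if r: "r \<in> {0..T}" for r
  proof -
    have "complex_of_real (exp (m * r)) * W r = 1 * (a - periodic_sol T m F 0) + primitive T (\<lambda>s. W s * ?e s + complex_of_real (exp (m * s)) * ?k s) r"
      by (rule primitive_product_rule[OF e k exp_primitive W r])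
    moreover have "primitive T (\<lambda>s. W s * ?e s + complex_of_real (exp (m * s)) * ?k s) r = 0"
      unfolding primitive_def
    proof (rule integral_eq_zero_AE)
      show "AE s in time T. indicator {..<r} s * (W s * ?e s + complex_of_real (exp (m * s)) * ?k s) = 0"
        using eq
      proof eventually_elim
        case (elim s)
        then have "?k s = - complex_of_real m * W s" by (simp add: W_def algebra_simps)
        then show ?case by (simp only:) simp
      qed
    qed
    ultimately show ?thesis by simp
  qed
  have "W T = W 0" using per periodic_sol_periodic[OF T m] by (simp add: W_def)
  moreover have "W 0 = a - periodic_sol T m F 0" using const[of 0] T by simp
  moreover have "complex_of_real (exp (m * T)) * W T = a - periodic_sol T m F 0" using const[of T] T by simp
  ultimately have "complex_of_real (exp (m * T)) * (a - periodic_sol T m F 0) = a - periodic_sol T m F 0" by (simp only:)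
  then have "(complex_of_real (exp (m * T)) - 1) * (a - periodic_sol T m F 0) = 0"
    by (simp only: left_diff_distrib mult_1_left diff_self)
  moreover have "exp (m * T) \<noteq> 1" using T m by simp
  then have "complex_of_real (exp (m * T)) - 1 \<noteq> 0" by (metis eq_iff_diff_eq_0 of_real_1 of_real_eq_iff)
  ultimately have "a - periodic_sol T m F 0 = 0" by (simp only: mult_eq_0_iff) blast
  with const[OF t] have "W t = 0" by simp
  then show ?thesis by (simp add: W_def)
qed

text \<open>In the expansion of $|g+mA|^2$ the cross term is the derivative of $m|A|^2$, which
  integrates to zero over a period.\<close>

lemma periodic_energy:
  assumes T: "T > 0" and m: "m \<ge> 0" and F: "sq_integrable (time T) F" and g: "integrable (time T) g"
    and A: "\<And>s. s \<in> {0..T} \<Longrightarrow> A s = a + primitive T g s"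
    and eq: "AE s in time T. g s + complex_of_real m * A s = F s"
    and per: "A T = A 0"
  shows "sq_integrable (time T) g" "nsq (time T) g \<le> nsq (time T) F" "ennreal (m\<^sup>2) * nsq (time T) A \<le> nsq (time T) F"
proof -
  note gm = borel_measurable_integrable[OF g] and Fm = sq_integrableD(1)[OF F]
  have Pm: "(\<lambda>s. a + primitive T g s) \<in> borel_measurable (time T)"
    by (intro borel_measurable_add borel_measurable_const measurable_time primitive_measurable gm)
  have Am: "A \<in> borel_measurable (time T)"
    using Pm by (subst measurable_cong[where g = "\<lambda>s. a + primitive T g s"]) (auto simp: A space_time)
  \<comment> \<open>A is bounded, hence square integrable on (0, T), and the equation transfers this
    to g, which was only assumed integrable; after that every term of the expanded square is
    integrable.\<close>
  have "cmod (A s) \<le> cmod a + (\<integral>s. cmod (g s) \<partial>time T)" if "s \<in> {0<..<T}" for s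
    using that by (subst A) (auto intro!: order_trans[OF norm_triangle_ineq] primitive_bound g)
  then have A2: "sq_integrable (time T) A"
    by (rule sq_integrable_time_bounded[OF Am])
  have "sq_integrable (time T) (\<lambda>s. F s - complex_of_real m * A s)"
    by (intro sq_integrable_diff F sq_integrable_cmult A2)
  then show g2: "sq_integrable (time T) g"
  proof (rule sq_integrable_bound[OF _ gm])
    show "AE s in time T. cmod (g s) \<le> cmod (F s - complex_of_real m * A s)"
      using eq
    proof eventually_elim
      case (elim s)
      have "g s = F s - complex_of_real m * A s" unfolding elim[symmetric] by simp
      then show ?case by simp
    qed
  qed
  have cA2: "sq_integrable (time T) (\<lambda>s. cnj (A s))" and cg2: "sq_integrable (time T) (\<lambda>s. cnj (g s))"
    using sq_integrable_bound[OF A2 measurable_compose[OF Am cnj_measurable]]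
      sq_integrable_bound[OF g2 measurable_compose[OF gm cnj_measurable]] by auto
  have cA: "cnj (A s) = cnj a + primitive T (\<lambda>s. cnj (g s)) s" if "s \<in> {0..T}" for s
    by (simp add: A[OF that] primitive_cnj)
  have a: "A 0 = a" using A[of 0] T by (simp add: primitive_0)
  have TT: "T \<in> {0..T}" using T by simp
  have "A T * cnj (A T) = a * cnj a + primitive T (\<lambda>s. cnj (A s) * g s + A s * cnj (g s)) T"
    by (rule primitive_product_rule[OF g sq_integrable_imp_integrable_time[OF cg2] A cA TT])
  then have zero: "(\<integral>s. cnj (A s) * g s + A s * cnj (g s) \<partial>time T) = 0"
    by (simp add: primitive_end per a)
  have "(\<integral>s. complex_of_real (2 * Re (cnj (A s) * g s)) \<partial>time T) = 0"
  proof -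
    have "complex_of_real (2 * Re (cnj (A s) * g s)) = cnj (A s) * g s + A s * cnj (g s)" for s
      by (rule complex_eqI) auto
    then show ?thesis using zero by (simp only:)
  qed
  then have re0: "(\<integral>s. 2 * Re (cnj (A s) * g s) \<partial>time T) = 0"
    by (simp only: integral_complex_of_real of_real_eq_0_iff)
  have int: "integrable (time T) (\<lambda>s. 2 * Re (cnj (A s) * g s))"
    by (intro integrable_mult_right integrable_Re integrable_mult_sq_integrable cA2 g2)
  have ig: "integrable (time T) (\<lambda>s. (cmod (g s))\<^sup>2)" and iA: "integrable (time T) (\<lambda>s. (cmod (A s))\<^sup>2)" and iF: "integrable (time T) (\<lambda>s. (cmod (F s))\<^sup>2)"
    using g2 A2 F by (simp_all add: sq_integrable_def)
  have "(\<integral>s. (cmod (F s))\<^sup>2 \<partial>time T) = (\<integral>s. (cmod (g s))\<^sup>2 + m\<^sup>2 * (cmod (A s))\<^sup>2 + m * (2 * Re (cnj (A s) * g s)) \<partial>time T)"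
  proof (rule integral_cong_AE)
    show "AE s in time T. (cmod (F s))\<^sup>2 = (cmod (g s))\<^sup>2 + m\<^sup>2 * (cmod (A s))\<^sup>2 + m * (2 * Re (cnj (A s) * g s))"
      using eq
    proof eventually_elim
      case (elim s)
      show ?case unfolding elim[symmetric] cmod_power2
        by (simp add: power2_eq_square algebra_simps)
    qed
  qed (use iF ig iA int in \<open>auto intro!: borel_measurable_integrable\<close>)
  also have "\<dots> = (\<integral>s. (cmod (g s))\<^sup>2 \<partial>time T) + m\<^sup>2 * (\<integral>s. (cmod (A s))\<^sup>2 \<partial>time T) + m * (\<integral>s. 2 * Re (cnj (A s) * g s) \<partial>time T)"
    using ig iA int by (subst Bochner_Integration.integral_add; simp)
  finally have E: "(\<integral>s. (cmod (F s))\<^sup>2 \<partial>time T) = (\<integral>s. (cmod (g s))\<^sup>2 \<partial>time T) + m\<^sup>2 * (\<integral>s. (cmod (A s))\<^sup>2 \<partial>time T)"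
    unfolding re0 by simp
  have n: "nsq (time T) h = ennreal (\<integral>s. (cmod (h s))\<^sup>2 \<partial>time T)" if "integrable (time T) (\<lambda>s. (cmod (h s))\<^sup>2)" for h
    unfolding nsq_def using that by (intro nn_integral_eq_integral) auto
  have pos: "0 \<le> (\<integral>s. (cmod (h s))\<^sup>2 \<partial>time T)" for h :: "real \<Rightarrow> complex"
    by (intro Bochner_Integration.integral_nonneg) auto
  show "nsq (time T) g \<le> nsq (time T) F"
    unfolding n[OF ig] n[OF iF] E using pos by (intro ennreal_leI) auto
  show "ennreal (m\<^sup>2) * nsq (time T) A \<le> nsq (time T) F"
    unfolding n[OF iA] n[OF iF] E using pos by (subst ennreal_mult[symmetric]) (auto intro!: ennreal_leI)
qed

text \<open>Cauchy-Schwarz against the indicator of [t, r): a square-integrable derivative gives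
  Hoelder continuity of order 1/2.\<close>

lemma primitive_diff_sq_le_ordered:
  assumes g: "sq_integrable (time T) g" and "t \<le> r"
  shows "ennreal ((cmod (primitive T g r - primitive T g t))\<^sup>2) \<le> ennreal (r - t) * nsq (time T) g"
proof -
  note gi = sq_integrable_imp_integrable_time[OF g]
  have im: "(\<lambda>s. indicator {t..<r} s :: complex) \<in> borel_measurable (time T)"
    by (intro measurable_time) auto
  have "primitive T g r - primitive T g t = (\<integral>s. indicator {..<r} s * g s - indicator {..<t} s * g s \<partial>time T)"
    unfolding primitive_def by (intro Bochner_Integration.integral_diff[symmetric] integrable_indicator_time gi)
  also have "\<dots> = (\<integral>s. indicator {t..<r} s * g s \<partial>time T)"
    using \<open>t \<le> r\<close> by (intro Bochner_Integration.integral_cong) (auto simp: indicator_def)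
  finally have "ennreal ((cmod (primitive T g r - primitive T g t))\<^sup>2) \<le> nsq (time T) (\<lambda>s. indicator {t..<r} s) * nsq (time T) g"
    using cmod_integral_mult_sq_le[OF im sq_integrableD(1)[OF g]] by simp
  also have "nsq (time T) (\<lambda>s. indicator {t..<r} s) \<le> ennreal (r - t)"
  proof -
    have "nsq (time T) (\<lambda>s. indicator {t..<r} s) = (\<integral>\<^sup>+s. ennreal ((cmod (indicator {t..<r} s))\<^sup>2) * indicator {0<..<T} s \<partial>lborel)"
      unfolding nsq_def by (subst nn_integral_restrict_space) auto
    also have "\<dots> \<le> (\<integral>\<^sup>+s. indicator {t..<r} s \<partial>lborel)"
      by (intro nn_integral_mono) (auto simp: indicator_def)
    also have "\<dots> = ennreal (r - t)" using \<open>t \<le> r\<close> by simp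
    finally show ?thesis .
  qed
  finally show ?thesis by (simp add: mult_right_mono)
qed

lemma primitive_diff_sq_le:
  assumes g: "sq_integrable (time T) g"
  shows "ennreal ((cmod (primitive T g r - primitive T g t))\<^sup>2) \<le> ennreal \<bar>r - t\<bar> * nsq (time T) g"
proof (cases "t \<le> r")
  case True
  then show ?thesis using primitive_diff_sq_le_ordered[OF g True] by simp
next
  case False
  then show ?thesis using primitive_diff_sq_le_ordered[OF g, of r t]
    by (simp add: norm_minus_commute abs_minus_commute)
qed

section \<open>Weak time derivatives\<close>

declare [[simproc del: measurable]]

text \<open>Measurability is shown on the whole plane rather than on the strip, because values at
  the end times 0 and T are needed later.\<close>

lemma primitive_joint_measurable:
  assumes G: "case_prod G \<in> borel_measurable (strip T)"
  shows "case_prod (\<lambda>t \<xi>. primitive T (\<lambda>s. G s \<xi>) t) \<in> borel_measurable (borel \<Otimes>\<^sub>M borel)"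
proof -
  let ?M = "(borel \<Otimes>\<^sub>M borel) \<Otimes>\<^sub>M time T :: ((real \<times> real) \<times> real) measure"
  have s: "snd \<in> ?M \<rightarrow>\<^sub>M time T" by (rule measurable_snd)
  have x: "(\<lambda>p. snd (fst p)) \<in> ?M \<rightarrow>\<^sub>M lborel"
    using measurable_compose[OF measurable_fst measurable_snd] by (simp only: measurable_lborel1)
  have t: "(\<lambda>p. fst (fst p)) \<in> borel_measurable ?M"
    by (rule measurable_compose[OF measurable_fst measurable_fst])
  have Gm: "(\<lambda>p. G (snd p) (snd (fst p))) \<in> borel_measurable ?M"
    by (rule measurable_uncurry[OF G s x])
  have lt: "Measurable.pred ?M (\<lambda>p. snd p < fst (fst p))"
    by (rule borel_measurable_pred_less[OF measurable_compose[OF s measurable_time_ident] t])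
  have "(\<lambda>p. if snd p < fst (fst p) then G (snd p) (snd (fst p)) else 0) \<in> borel_measurable ?M"
    by (rule measurable_If[OF Gm borel_measurable_const]) (use lt in \<open>simp only: pred_def\<close>)
  moreover have "(\<lambda>p. if snd p < fst (fst p) then G (snd p) (snd (fst p)) else 0) = (\<lambda>(k, s). indicator {..<fst k} s * G s (snd k))"
    by (auto simp: indicator_def)
  ultimately have "(\<lambda>(k, s). indicator {..<fst k} s * G s (snd k)) \<in> borel_measurable ?M" by (simp only:)
  then have "(\<lambda>k. \<integral>s. indicator {..<fst k} s * G s (snd k) \<partial>time T) \<in> borel_measurable (borel \<Otimes>\<^sub>M borel)"
    by (rule sigma_finite_measure.borel_measurable_lebesgue_integral[OF sigma_finite_time])
  then show ?thesis by (simp only: primitive_def case_prod_beta')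
qed

lemma joint_section1:
  assumes "case_prod f \<in> borel_measurable (borel \<Otimes>\<^sub>M borel)"
  shows "f t \<in> borel_measurable borel"
  using measurable_uncurry[OF assms measurable_const measurable_ident_sets[OF refl]] by (simp only: space_borel UNIV_I)

lemma primitive_section_measurable:
  assumes "case_prod G \<in> borel_measurable (strip T)"
  shows "(\<lambda>\<xi>. primitive T (\<lambda>s. G s \<xi>) t) \<in> borel_measurable borel"
  by (rule joint_section1[OF primitive_joint_measurable[OF assms]])

lemma strip_borel_snd:
  assumes "w \<in> borel_measurable borel"
  shows "(\<lambda>k. w (snd k)) \<in> borel_measurable (strip T)"
  using measurable_compose[OF measurable_snd, of w lborel borel "time T"] assms by (simp only: measurable_lborel2)

lemma weighted_measurable:
  assumes "w \<in> borel_measurable borel" "case_prod U \<in> borel_measurable (strip T)"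
  shows "case_prod (weighted w U) \<in> borel_measurable (strip T)"
proof -
  have "(\<lambda>k. complex_of_real (w (snd k))) \<in> borel_measurable (strip T)"
    by (rule strip_borel_snd) (use assms(1) in measurable)
  from borel_measurable_times[OF this assms(2)] show ?thesis
    by (simp only: weighted_def case_prod_beta')
qed

lemma sq_integrable_time_continuous:
  fixes f :: "real \<Rightarrow> complex"
  assumes f: "continuous_on UNIV f"
  shows "sq_integrable (time T) f"
proof -
  obtain B where "\<forall>t\<in>{0<..<T}. cmod (f t) \<le> B" using continuous_imp_integrable_time(2)[OF f] ..
  then show ?thesis by (intro sq_integrable_time_bounded[where B = B] continuous_imp_integrable_time(3)[OF f]) blast
qed

lemma sq_integrable_test_function:
  assumes "\<theta> \<in> test_functions T"
  shows "sq_integrable (time T) (\<lambda>t. complex_of_real (\<theta> t))" "sq_integrable (time T) (\<lambda>t. complex_of_real (deriv \<theta> t))"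
  using test_functionD(2,3)[OF assms, of UNIV] by (auto intro!: sq_integrable_time_continuous continuous_on_of_real)

lemma is_weak_dtD:
  assumes "is_weak_dt T u v"
  shows "case_prod u \<in> borel_measurable (strip T)" "case_prod v \<in> borel_measurable (strip T)"
    "AE x in lborel. integrable (time T) (\<lambda>t. u t x)" "AE x in lborel. integrable (time T) (\<lambda>t. v t x)"
    "\<theta> \<in> test_functions T \<Longrightarrow> AE x in lborel. (\<integral>t. complex_of_real (deriv \<theta> t) * u t x \<partial>time T) = - (\<integral>t. complex_of_real (\<theta> t) * v t x \<partial>time T)"
  using assms unfolding is_weak_dt_def by (auto elim: eventually_mono)

lemma is_weak_dt_countable:
  assumes "is_weak_dt T u v" "countable \<Theta>" "\<Theta> \<subseteq> test_functions T"
  shows "AE x in lborel. \<forall>\<theta>\<in>\<Theta>. (\<integral>t. complex_of_real (deriv \<theta> t) * u t x \<partial>time T) = - (\<integral>t. complex_of_real (\<theta> t) * v t x \<partial>time T)"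
  by (subst AE_ball_countable[OF assms(2)]) (use is_weak_dtD(5)[OF assms(1)] assms(3) in blast)

text \<open>Each tested identity is an equality between two functions of x, and the transform
  carries both sides to their counterparts in \<xi>; uniqueness of the transform gives one direction
  and injectivity the other.\<close>

lemma is_weak_dt_fourier_iff:
  assumes F: "is_fourier_x T u U" "is_fourier_x T v V" and L2: "u \<in> L2_L2 T" "v \<in> L2_L2 T"
  shows "is_weak_dt T u v \<longleftrightarrow> is_weak_dt T U V"
proof -
  have L2': "U \<in> L2_L2 T" "V \<in> L2_L2 T" using is_fourier_x_L2_L2 F L2 by blast+
  have int: "AE x in lborel. integrable (time T) (\<lambda>t. p t x) \<and> integrable (time T) (\<lambda>t. q t x)" if "p \<in> L2_L2 T" "q \<in> L2_L2 T" for p q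
    using L2_L2_section2[OF that(1)] L2_L2_section2[OF that(2)]
    by eventually_elim (intro conjI sq_integrable_imp_integrable_time)
  have iff: "(AE x in lborel. (\<integral>t. complex_of_real (deriv \<theta> t) * u t x \<partial>time T) = - (\<integral>t. complex_of_real (\<theta> t) * v t x \<partial>time T))
     \<longleftrightarrow> (AE x in lborel. (\<integral>t. complex_of_real (deriv \<theta> t) * U t x \<partial>time T) = - (\<integral>t. complex_of_real (\<theta> t) * V t x \<partial>time T))"
    if \<theta>: "\<theta> \<in> test_functions T" for \<theta>
  proof -
    note A = fourier_x_time_integral[OF F(1) L2(1) sq_integrable_test_function(2)[OF \<theta>]]
    have B: "is_fourier (\<lambda>x. - (\<integral>t. complex_of_real (\<theta> t) * v t x \<partial>time T)) (\<lambda>x. - (\<integral>t. complex_of_real (\<theta> t) * V t x \<partial>time T))"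
      using is_fourier_cmult[OF fourier_x_time_integral[OF F(2) L2(2) sq_integrable_test_function(1)[OF \<theta>]], of "-1"] by simp
    show ?thesis
    proof
      assume "AE x in lborel. (\<integral>t. complex_of_real (deriv \<theta> t) * u t x \<partial>time T) = - (\<integral>t. complex_of_real (\<theta> t) * v t x \<partial>time T)"
      from is_fourier_cong_AE[OF A is_fourierD(3)[OF B] this is_fourierD(4)[OF A]]
      have "is_fourier (\<lambda>x. - (\<integral>t. complex_of_real (\<theta> t) * v t x \<partial>time T)) (\<lambda>x. \<integral>t. complex_of_real (deriv \<theta> t) * U t x \<partial>time T)" by simp
      from is_fourier_unique[OF this B] show "AE x in lborel. (\<integral>t. complex_of_real (deriv \<theta> t) * U t x \<partial>time T) = - (\<integral>t. complex_of_real (\<theta> t) * V t x \<partial>time T)" .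
    next
      assume "AE x in lborel. (\<integral>t. complex_of_real (deriv \<theta> t) * U t x \<partial>time T) = - (\<integral>t. complex_of_real (\<theta> t) * V t x \<partial>time T)"
      from is_fourier_inj[OF A B this] show "AE x in lborel. (\<integral>t. complex_of_real (deriv \<theta> t) * u t x \<partial>time T) = - (\<integral>t. complex_of_real (\<theta> t) * v t x \<partial>time T)" .
    qed
  qed
  show ?thesis unfolding is_weak_dt_def
    using int[OF L2] int[OF L2'] iff is_fourier_xD(1,2)[OF F(1)] is_fourier_xD(1,2)[OF F(2)] by blast
qed

lemma is_weak_dt_cong:
  assumes w: "is_weak_dt T u v" and m: "case_prod u' \<in> borel_measurable (strip T)" "case_prod v' \<in> borel_measurable (strip T)"
    and eq: "AE (t, x) in strip T. u t x = u' t x" "AE (t, x) in strip T. v t x = v' t x"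
  shows "is_weak_dt T u' v'"
proof -
  note D = is_weak_dtD[OF w]
  have eq': "AE x in lborel. AE t in time T. u t x = u' t x" "AE x in lborel. AE t in time T. v t x = v' t x"
    using eq AE_strip_iff(2)[OF D(1) m(1)] AE_strip_iff(2)[OF D(2) m(2)] by blast+
  have tm: "(\<lambda>t. complex_of_real (\<theta> t)) \<in> borel_measurable (time T)" "(\<lambda>t. complex_of_real (deriv \<theta> t)) \<in> borel_measurable (time T)"
    if "\<theta> \<in> test_functions T" for \<theta>
    using sq_integrable_test_function[OF that] by (auto dest: sq_integrableD)
  have int: "AE x in lborel. integrable (time T) (\<lambda>t. u' t x) \<and> integrable (time T) (\<lambda>t. v' t x)"
    using eq' D(3,4)
  proof eventually_elim
    case (elim x)
    then show ?case
      using integrable_cong_AE[OF strip_section2[OF D(1)] strip_section2[OF m(1)] elim(1)]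
        integrable_cong_AE[OF strip_section2[OF D(2)] strip_section2[OF m(2)] elim(2)] by blast
  qed
  have "AE x in lborel. (\<integral>t. complex_of_real (deriv \<theta> t) * u' t x \<partial>time T) = - (\<integral>t. complex_of_real (\<theta> t) * v' t x \<partial>time T)"
    if \<theta>: "\<theta> \<in> test_functions T" for \<theta>
    using eq' D(5)[OF \<theta>]
  proof eventually_elim
    case (elim x)
    have "(\<integral>t. complex_of_real (deriv \<theta> t) * u' t x \<partial>time T) = (\<integral>t. complex_of_real (deriv \<theta> t) * u t x \<partial>time T)"
      by (intro integral_cong_AE borel_measurable_times tm[OF \<theta>] strip_section2[OF D(1)] strip_section2[OF m(1)])
         (use elim(1) in \<open>auto elim: eventually_mono\<close>)
    moreover have "(\<integral>t. complex_of_real (\<theta> t) * v' t x \<partial>time T) = (\<integral>t. complex_of_real (\<theta> t) * v t x \<partial>time T)"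
      by (intro integral_cong_AE borel_measurable_times tm[OF \<theta>] strip_section2[OF D(2)] strip_section2[OF m(2)])
         (use elim(2) in \<open>auto elim: eventually_mono\<close>)
    ultimately show ?case using elim(3) by simp
  qed
  with int m show ?thesis by (simp add: is_weak_dt_def)
qed

lemma bump_complex_measurable: "(\<lambda>t. complex_of_real (bump (1 / real (Suc k)) p q t)) \<in> borel_measurable (time T)"
  by (intro continuous_imp_integrable_time(3) continuous_on_of_real continuous_on_bump) simp

lemma integrable_bump_mult:
  assumes "integrable (time T) (E :: real \<Rightarrow> complex)"
  shows "integrable (time T) (\<lambda>t. complex_of_real (bump (1 / real (Suc k)) p q t) * E t)"
proof (rule integrable_bounded_mult_time[OF assms bump_complex_measurable, where B = 1])
  fix t
  show "cmod (complex_of_real (bump (1 / real (Suc k)) p q t)) \<le> 1"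
    using bump_le_1[of "1 / real (Suc k)" p q t] bump_nonneg[of "1 / real (Suc k)" p q t] by (simp only: norm_of_real abs_of_nonneg) simp
qed

text \<open>Since the null set in the definition depends on the test function, only the countably
  many bumps with rational end points are used. Off one common null set of x, v and v' have the same
  integrals against all of them.\<close>

lemma weak_dt_unique:
  assumes w: "is_weak_dt T u v" and w': "is_weak_dt T u' v'" and eq: "AE (t, x) in strip T. u t x = u' t x"
  shows "AE (t, x) in strip T. v t x = v' t x"
proof -
  have w2: "is_weak_dt T u v'"
    by (rule is_weak_dt_cong[OF w' is_weak_dtD(1)[OF w] is_weak_dtD(2)[OF w']]) (use eq in \<open>auto elim: eventually_mono\<close>)
  note D = is_weak_dtD[OF w] and D2 = is_weak_dtD[OF w2]
  define I where "I = {(k :: nat, p, q). p \<in> \<rat> \<and> q \<in> \<rat> \<and> 0 < p \<and> p < q \<and> q < T}"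
  define \<Theta> where "\<Theta> = (\<lambda>(k, p, q). bump (1 / real (Suc k)) p q) ` I"
  have "I \<subseteq> UNIV \<times> \<rat> \<times> \<rat>" by (auto simp: I_def)
  then have "countable I" by (rule countable_subset) (intro countable_SIGMA countable_rat, auto)
  then have c: "countable \<Theta>" unfolding \<Theta>_def by (rule countable_image)
  have t: "\<Theta> \<subseteq> test_functions T"
    unfolding \<Theta>_def I_def by (auto intro!: bump_test_function simp del: of_nat_Suc)
  have "AE x in lborel. AE t in time T. v t x = v' t x"
    using is_weak_dt_countable[OF w c t] is_weak_dt_countable[OF w2 c t] D(4) D2(4)
  proof eventually_elim
    case (elim x)
    have "AE t in time T. v t x - v' t x = 0"
    proof (rule AE_zero_if_bump_integrals_zero)
      show "integrable (time T) (\<lambda>t. v t x - v' t x)" using elim by (intro Bochner_Integration.integrable_diff)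
      fix k p q assume pq: "p \<in> \<rat>" "q \<in> \<rat>" "0 < p" "p < q" "q < T"
      let ?\<rho> = "bump (1 / real (Suc k)) p q"
      have "?\<rho> \<in> \<Theta>" unfolding \<Theta>_def I_def using pq by (intro image_eqI[of _ _ "(k, p, q)"]) auto
      then have "(\<integral>t. complex_of_real (?\<rho> t) * v t x \<partial>time T) = (\<integral>t. complex_of_real (?\<rho> t) * v' t x \<partial>time T)"
        using bspec[OF elim(1), of ?\<rho>] bspec[OF elim(2), of ?\<rho>] by (simp only: neg_equal_iff_equal)
      then show "(\<integral>t. complex_of_real (?\<rho> t) * (v t x - v' t x) \<partial>time T) = 0"
        unfolding right_diff_distrib
        by (simp only: Bochner_Integration.integral_diff[OF integrable_bump_mult[OF elim(3)] integrable_bump_mult[OF elim(4)]] diff_self)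
    qed
    then show ?case by simp
  qed
  then show ?thesis using AE_strip_iff(2)[OF D(2) D2(2)] by blast
qed

lemma bump_mass_time:
  assumes "0 < p" "q < T"
  shows "(\<integral>t. complex_of_real (bump \<epsilon> p q t) \<partial>time T) = complex_of_real (bump_mass \<epsilon> p q)"
proof -
  have "(\<integral>t. complex_of_real (bump \<epsilon> p q t) \<partial>time T) = (\<integral>t. indicator {0<..<T} t *\<^sub>R complex_of_real (bump \<epsilon> p q t) \<partial>lborel)"
    by (subst integral_restrict_space) (auto simp: set_lebesgue_integral_def intro: borel_open)
  also have "\<dots> = (\<integral>t. complex_of_real (bump \<epsilon> p q t) \<partial>lborel)"
    using assms by (intro Bochner_Integration.integral_cong) (auto simp: bump_eq indicator_def)
  finally show ?thesis by (simp only: bump_mass_def integral_complex_of_real)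
qed

text \<open>The mean of \<open>U - \<integral> V\<close> over the period, so that \<open>U = time_mean + \<integral> V\<close>
  if \<open>V\<close> is the weak derivative of \<open>U\<close>.\<close>

definition time_mean :: "real \<Rightarrow> (real \<Rightarrow> complex) \<Rightarrow> (real \<Rightarrow> complex) \<Rightarrow> complex" where
  "time_mean T u v = complex_of_real (1 / T) * (\<integral>t. u t - primitive T v t \<partial>time T)"

text \<open>Let D be u minus the primitive of v. Testing with differences of normalised bumps shows
  that all bump averages of D coincide, so D minus the common value c is orthogonal to every
  rational bump. The test functions are passed as a set \<Theta> so that one countable choice can
  serve all x.\<close>

lemma du_Bois_Reymond:
  assumes T: "T > 0" and u: "integrable (time T) u" and v: "integrable (time T) v"
    and ibp: "\<And>\<theta>. \<theta> \<in> \<Theta> \<Longrightarrow> (\<integral>t. complex_of_real (deriv \<theta> t) * u t \<partial>time T) = - (\<integral>t. complex_of_real (\<theta> t) * v t \<partial>time T)"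
    and \<Theta>: "\<Theta> \<subseteq> test_functions T"
    and ex: "\<And>k p q k' p' q'. p \<in> \<rat> \<Longrightarrow> q \<in> \<rat> \<Longrightarrow> p' \<in> \<rat> \<Longrightarrow> q' \<in> \<rat> \<Longrightarrow> 0 < p \<Longrightarrow> p < q \<Longrightarrow> q < T \<Longrightarrow> 0 < p' \<Longrightarrow> p' < q' \<Longrightarrow> q' < T \<Longrightarrow>
      \<exists>\<theta>\<in>\<Theta>. \<forall>t. deriv \<theta> t = bump (1 / real (Suc k)) p q t / bump_mass (1 / real (Suc k)) p q - bump (1 / real (Suc k')) p' q' t / bump_mass (1 / real (Suc k')) p' q'"
  shows "AE t in time T. u t = time_mean T u v + primitive T v t"
proof -
  define D where "D t = u t - primitive T v t" for t
  have Pi: "integrable (time T) (primitive T v)"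
    using primitive_integrable_mult[OF sq_integrable_imp_integrable_time[OF sq_integrable_time_const[of T 1]] v] by simp
  have Di: "integrable (time T) D" unfolding D_def by (intro Bochner_Integration.integrable_diff u Pi)
  let ?I = "\<lambda>k p q. \<integral>t. complex_of_real (bump (1 / real (Suc k)) p q t) * D t \<partial>time T"
  let ?m = "\<lambda>k p q. complex_of_real (bump_mass (1 / real (Suc k)) p q)"
  have same: "?I k p q / ?m k p q = ?I k' p' q' / ?m k' p' q'"
    if pq: "p \<in> \<rat>" "q \<in> \<rat>" "p' \<in> \<rat>" "q' \<in> \<rat>" "0 < p" "p < q" "q < T" "0 < p'" "p' < q'" "q' < T" for k p q k' p' q'
  proof -
    obtain \<theta> where \<theta>: "\<theta> \<in> \<Theta>" "\<And>t. deriv \<theta> t = bump (1 / real (Suc k)) p q t / bump_mass (1 / real (Suc k)) p q - bump (1 / real (Suc k')) p' q' t / bump_mass (1 / real (Suc k')) p' q'"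
      using ex[OF pq] by blast
    have \<theta>t: "\<theta> \<in> test_functions T" using \<theta> \<Theta> by blast
    have di: "integrable (time T) (\<lambda>t. complex_of_real (deriv \<theta> t) * k t)" if "integrable (time T) k" for k
    proof -
      have c: "continuous_on UNIV (\<lambda>t. complex_of_real (deriv \<theta> t))"
        using test_functionD(3)[OF \<theta>t] by (intro continuous_on_of_real)
      obtain B where "\<forall>t\<in>{0<..<T}. cmod (complex_of_real (deriv \<theta> t)) \<le> B"
        using continuous_imp_integrable_time(2)[OF c] ..
      then show ?thesis by (intro integrable_bounded_mult_time[OF that continuous_imp_integrable_time(3)[OF c], where B = B]) blast
    qed
    have "(\<integral>t. complex_of_real (deriv \<theta> t) * primitive T v t \<partial>time T) = - (\<integral>t. complex_of_real (\<theta> t) * v t \<partial>time T)"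
      by (rule integration_by_parts_test[OF \<theta>t T v, where a = 0]) simp
    then have "0 = (\<integral>t. complex_of_real (deriv \<theta> t) * u t \<partial>time T) - (\<integral>t. complex_of_real (deriv \<theta> t) * primitive T v t \<partial>time T)"
      using ibp[OF \<theta>(1)] by simp
    also have "\<dots> = (\<integral>t. complex_of_real (deriv \<theta> t) * D t \<partial>time T)"
      unfolding D_def right_diff_distrib by (intro Bochner_Integration.integral_diff[symmetric] di u Pi)
    also have "\<dots> = (\<integral>t. complex_of_real (bump (1 / real (Suc k)) p q t) * D t / ?m k p q - complex_of_real (bump (1 / real (Suc k')) p' q' t) * D t / ?m k' p' q' \<partial>time T)"
      unfolding \<theta>(2) by (simp only: of_real_diff of_real_divide left_diff_distrib times_divide_eq_left)
    also have "\<dots> = ?I k p q / ?m k p q - ?I k' p' q' / ?m k' p' q'"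
      by (simp only: Bochner_Integration.integral_diff[OF integrable_divide[OF integrable_bump_mult[OF Di]] integrable_divide[OF integrable_bump_mult[OF Di]]] integral_divide_zero)
    finally show ?thesis by simp
  qed
  obtain p0 where p0: "p0 \<in> \<rat>" "0 < p0" "p0 < T" using Rats_dense_in_real[OF T] by blast
  obtain q0 where q0: "q0 \<in> \<rat>" "p0 < q0" "q0 < T" using Rats_dense_in_real[OF p0(3)] by blast
  define c where "c = ?I 0 p0 q0 / ?m 0 p0 q0"
  have "AE t in time T. D t - c = 0"
  proof (rule AE_zero_if_bump_integrals_zero)
    have ci: "integrable (time T) (\<lambda>t. c)" by (rule sq_integrable_imp_integrable_time[OF sq_integrable_time_const])
    show "integrable (time T) (\<lambda>t. D t - c)" by (intro Bochner_Integration.integrable_diff Di ci)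
    fix k p q assume pq: "p \<in> \<rat>" "q \<in> \<rat>" "0 < p" "p < q" "q < T"
    have m0: "?m k p q \<noteq> 0" using bump_primitive(1)[of "1 / real (Suc k)" p q] pq by simp
    have "(\<integral>t. complex_of_real (bump (1 / real (Suc k)) p q t) * (D t - c) \<partial>time T) = ?I k p q - (\<integral>t. complex_of_real (bump (1 / real (Suc k)) p q t) * c \<partial>time T)"
      unfolding right_diff_distrib by (intro Bochner_Integration.integral_diff integrable_bump_mult Di ci)
    also have "\<dots> = ?I k p q - ?m k p q * c"
      by (simp only: integral_mult_left_zero bump_mass_time[OF pq(3,5)])
    also have "\<dots> = 0"
      unfolding c_def same[OF p0(1) q0(1) pq(1,2) p0(2) q0(2,3) pq(3-5), where k = 0 and k' = k] using m0 by simp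
    finally show "(\<integral>t. complex_of_real (bump (1 / real (Suc k)) p q t) * (D t - c) \<partial>time T) = 0" .
  qed
  then have Dc: "AE t in time T. D t = c" by eventually_elim simp
  have "(\<integral>t. D t \<partial>time T) = (\<integral>t. c \<partial>time T)"
    by (rule integral_cong_AE[OF borel_measurable_integrable[OF Di] borel_measurable_const Dc])
  also have "\<dots> = complex_of_real T * c"
  proof -
    have "measure (time T) (space (time T)) = T"
      using T by (simp add: space_time measure_restrict_space borel_open)
    then show ?thesis by (simp add: scaleR_conv_of_real)
  qed
  \<comment> \<open>Averaging over (0, T) identifies the constant by a formula that depends
    measurably on a parameter, unlike a constant obtained by choice.\<close>
  finally have "time_mean T u v = c" using T by (simp add: time_mean_def D_def)
  moreover from Dc have "AE t in time T. u t = c + primitive T v t"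
    unfolding D_def by eventually_elim (simp add: diff_eq_eq)
  ultimately show ?thesis by simp
qed

text \<open>The test functions are chosen for each of countably many index tuples before x is fixed;
  hence a single null set of x suffices.\<close>

lemma weak_dt_primitive:
  assumes T: "T > 0" and w: "is_weak_dt T u v"
  shows "AE x in lborel. AE t in time T. u t x = time_mean T (\<lambda>s. u s x) (\<lambda>s. v s x) + primitive T (\<lambda>s. v s x) t"
proof -
  note D = is_weak_dtD[OF w]
  define I where "I = {(k :: nat, p, q, k' :: nat, p', q'). p \<in> \<rat> \<and> q \<in> \<rat> \<and> p' \<in> \<rat> \<and> q' \<in> \<rat> \<and> 0 < p \<and> p < q \<and> q < T \<and> 0 < p' \<and> p' < q' \<and> q' < T}"
  define P where "P = (\<lambda>(k :: nat, p, q, k' :: nat, p', q') \<theta>. \<theta> \<in> test_functions T \<and> (\<forall>t. deriv \<theta> t = bump (1 / real (Suc k)) p q t / bump_mass (1 / real (Suc k)) p q - bump (1 / real (Suc k')) p' q' t / bump_mass (1 / real (Suc k')) p' q'))"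
  have "\<forall>i\<in>I. \<exists>\<theta>. P i \<theta>"
  proof
    fix i assume "i \<in> I"
    then obtain k p q k' p' q' where i: "i = (k, p, q, k', p', q')" "0 < p" "p < q" "q < T" "0 < p'" "p' < q'" "q' < T"
      unfolding I_def by blast
    have e: "1 / real (Suc k) > 0" "1 / real (Suc k') > 0" by auto
    show "\<exists>\<theta>. P i \<theta>"
      by (rule bump_difference_test_function[OF e(1) i(2-4) e(2) i(5-7)]) (auto simp: P_def i(1))
  qed
  then obtain h where h: "\<And>i. i \<in> I \<Longrightarrow> P i (h i)" by metis
  have "I \<subseteq> UNIV \<times> \<rat> \<times> \<rat> \<times> UNIV \<times> \<rat> \<times> \<rat>" by (auto simp: I_def)
  then have "countable I" by (rule countable_subset) (intro countable_SIGMA countable_rat, auto)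
  then have c: "countable (h ` I)" by (rule countable_image)
  have t: "h ` I \<subseteq> test_functions T" using h by (fastforce simp: P_def)
  show ?thesis
    using is_weak_dt_countable[OF w c t] D(3,4)
  proof eventually_elim
    case (elim x)
    show ?case
    proof (rule du_Bois_Reymond[OF T elim(2,3) bspec[OF elim(1)] t])
      fix k p q k' p' q'
      assume "p \<in> \<rat>" "q \<in> \<rat>" "p' \<in> \<rat>" "q' \<in> \<rat>" "0 < p" "p < q" "q < T" "0 < p'" "p' < q'" "q' < T"
      then have i: "(k, p, q, k', p', q') \<in> I" by (simp add: I_def)
      from h[OF i] have D1: "\<forall>t. deriv (h (k, p, q, k', p', q')) t = bump (1 / real (Suc k)) p q t / bump_mass (1 / real (Suc k)) p q - bump (1 / real (Suc k')) p' q' t / bump_mass (1 / real (Suc k')) p' q'"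
        unfolding P_def prod.case by (rule conjunct2)
      show "\<exists>\<theta>\<in>h ` I. \<forall>t. deriv \<theta> t = bump (1 / real (Suc k)) p q t / bump_mass (1 / real (Suc k)) p q - bump (1 / real (Suc k')) p' q' t / bump_mass (1 / real (Suc k')) p' q'"
        by (rule rev_bexI[OF imageI[OF i]]) (rule D1)
    qed
  qed
qed

lemma is_weak_dtI:
  assumes T: "T > 0" and m: "case_prod u \<in> borel_measurable (strip T)" "case_prod v \<in> borel_measurable (strip T)"
    and int: "AE x in lborel. integrable (time T) (\<lambda>t. u t x)" "AE x in lborel. integrable (time T) (\<lambda>t. v t x)"
    and eq: "AE x in lborel. \<forall>t\<in>{0..T}. u t x = u 0 x + primitive T (\<lambda>s. v s x) t"
  shows "is_weak_dt T u v"
proof -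
  have "AE x in lborel. (\<integral>t. complex_of_real (deriv \<theta> t) * u t x \<partial>time T) = - (\<integral>t. complex_of_real (\<theta> t) * v t x \<partial>time T)"
    if \<theta>: "\<theta> \<in> test_functions T" for \<theta>
    using int(2) eq
  proof eventually_elim
    case (elim x)
    show ?case
      by (rule integration_by_parts_test[OF \<theta> T elim(1), where A = "\<lambda>t. u t x" and a = "u 0 x"]) (rule bspec[OF elim(2)])
  qed
  moreover have "AE x in lborel. integrable (time T) (\<lambda>t. u t x) \<and> integrable (time T) (\<lambda>t. v t x)"
    using int by eventually_elim (rule conjI)
  ultimately show ?thesis using m unfolding is_weak_dt_def by blast
qed

section \<open>Values at the end points\<close>

lemma AE_time_ex:
  assumes ae: "AE t in time T. Q t" and "0 \<le> a" "a < b" "b \<le> T"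
  shows "\<exists>t. a < t \<and> t < b \<and> Q t"
proof (rule ccontr)
  assume no: "\<not> ?thesis"
  have "AE t in lborel. t \<notin> {a<..<b}"
    using ae[unfolded AE_time_iff] by eventually_elim (use no assms(2,4) in force)
  then have "{a<..<b} \<in> null_sets lborel"
    by (subst AE_iff_null_sets) (auto intro: borel_open)
  then have "emeasure lborel {a<..<b} = 0" by auto
  with \<open>a < b\<close> show False by simp
qed

text \<open>Times of full measure are dense in [0, T]; the end points too are approached from
  inside. This gives access to continuous representatives at times where only almost-everywhere
  information is available.\<close>

lemma AE_time_ex_near:
  assumes ae: "AE t in time T. Q t" and T: "T > 0" and s: "s \<in> {0..T}" and d: "d > 0"
  shows "\<exists>t\<in>{0..T}. t \<noteq> s \<and> dist t s < d \<and> Q t"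
proof (cases "s < T")
  case True
  obtain t where "s < t" "t < min T (s + d)" "Q t"
    using AE_time_ex[OF ae, of s "min T (s + d)"] True s d by auto
  then show ?thesis using s by (intro bexI[of _ t]) (auto simp: dist_real_def)
next
  case False
  then have "s = T" using s by simp
  obtain t where "max 0 (T - d) < t" "t < T" "Q t"
    using AE_time_ex[OF ae, of "max 0 (T - d)" T] T d by auto
  then show ?thesis using \<open>s = T\<close> by (intro bexI[of _ t]) (auto simp: dist_real_def)
qed

lemma nsq_strip_weighted:
  assumes w: "w \<in> borel_measurable borel" and U: "case_prod U \<in> borel_measurable (strip T)"
  shows "nsq (strip T) (case_prod (weighted w U)) = (\<integral>\<^sup>+\<xi>. ennreal ((w \<xi>)\<^sup>2) * nsq (time T) (\<lambda>t. U t \<xi>) \<partial>lborel)"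
  unfolding nsq_strip_swap[OF weighted_measurable[OF assms]] weighted_def
  by (subst nsq_cmult[OF strip_section2[OF U]]) simp

text \<open>Tonelli turns an inequality between squared time norms at almost every frequency, with
  constant K^2, into one between weighted norms with constant K. Each of the five bounds is obtained
  in this way.\<close>

lemma weighted_norm_le:
  assumes m: "w1 \<in> borel_measurable borel" "w2 \<in> borel_measurable borel" "case_prod X \<in> borel_measurable (strip T)"
    "case_prod Y \<in> borel_measurable (strip T)" and K: "K \<ge> 0"
    and le: "AE \<xi> in lborel. ennreal ((w1 \<xi>)\<^sup>2) * nsq (time T) (\<lambda>t. X t \<xi>) \<le> ennreal (K\<^sup>2) * (ennreal ((w2 \<xi>)\<^sup>2) * nsq (time T) (\<lambda>t. Y t \<xi>))"
    and Y: "weighted w2 Y \<in> L2_L2 T"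
  shows "weighted w1 X \<in> L2_L2 T" "L2_L2_norm T (weighted w1 X) \<le> K * L2_L2_norm T (weighted w2 Y)"
proof -
  note mX = weighted_measurable[OF m(1,3)] and mY = weighted_measurable[OF m(2,4)]
  have "nsq (strip T) (case_prod (weighted w1 X)) \<le> (\<integral>\<^sup>+\<xi>. ennreal (K\<^sup>2) * (ennreal ((w2 \<xi>)\<^sup>2) * nsq (time T) (\<lambda>t. Y t \<xi>)) \<partial>lborel)"
    unfolding nsq_strip_weighted[OF m(1,3)] by (rule nn_integral_mono_AE[OF le])
  also have "\<dots> = ennreal (K\<^sup>2) * nsq (strip T) (case_prod (weighted w2 Y))"
    unfolding nsq_strip_weighted[OF m(2,4)]
  proof (rule nn_integral_cmult)
    have "(\<lambda>\<xi>. ennreal ((w2 \<xi>)\<^sup>2)) \<in> borel_measurable lborel" using m(2) by measurable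
    then show "(\<lambda>\<xi>. ennreal ((w2 \<xi>)\<^sup>2) * nsq (time T) (\<lambda>t. Y t \<xi>)) \<in> borel_measurable lborel"
      using nsq_section2_measurable[OF m(4)] by (rule borel_measurable_times_ennreal)
  qed
  finally have le2: "nsq (strip T) (case_prod (weighted w1 X)) \<le> ennreal (K\<^sup>2) * nsq (strip T) (case_prod (weighted w2 Y))" .
  have fin: "nsq (strip T) (case_prod (weighted w2 Y)) < top" using Y by (simp add: L2_L2_iff)
  have fin2: "ennreal (K\<^sup>2) * nsq (strip T) (case_prod (weighted w2 Y)) < top"
    using fin by (simp add: ennreal_mult_less_top)
  show "weighted w1 X \<in> L2_L2 T" using le_less_trans[OF le2 fin2] mX by (simp add: L2_L2_iff)
  have "enn2real (nsq (strip T) (case_prod (weighted w1 X))) \<le> K\<^sup>2 * enn2real (nsq (strip T) (case_prod (weighted w2 Y)))"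
    using enn2real_mono[OF le2 fin2] by (simp add: enn2real_mult)
  then have "sqrt (enn2real (nsq (strip T) (case_prod (weighted w1 X)))) \<le> sqrt (K\<^sup>2 * enn2real (nsq (strip T) (case_prod (weighted w2 Y))))"
    by (rule real_sqrt_le_mono)
  then show "L2_L2_norm T (weighted w1 X) \<le> K * L2_L2_norm T (weighted w2 Y)"
    unfolding L2_L2_norm_eq[OF mX] L2_L2_norm_eq[OF mY] using K by (simp add: real_sqrt_mult)
qed

text \<open>The Hoelder bound at each frequency, applied to the weighted derivative and integrated
  over \<xi>, makes the primitive continuous in the weighted norm.\<close>

lemma nsq_weighted_primitive_diff_le:
  assumes w: "w \<in> borel_measurable borel" and V: "case_prod V \<in> borel_measurable (strip T)" and L2: "weighted w V \<in> L2_L2 T"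
  shows "nsq lborel (\<lambda>\<xi>. complex_of_real (w \<xi>) * (primitive T (\<lambda>s. V s \<xi>) r - primitive T (\<lambda>s. V s \<xi>) t))
    \<le> ennreal \<bar>r - t\<bar> * nsq (strip T) (case_prod (weighted w V))"
proof -
  note m = weighted_measurable[OF w V]
  have eq: "complex_of_real (w \<xi>) * (primitive T (\<lambda>s. V s \<xi>) r - primitive T (\<lambda>s. V s \<xi>) t)
      = primitive T (\<lambda>s. weighted w V s \<xi>) r - primitive T (\<lambda>s. weighted w V s \<xi>) t" for \<xi>
    unfolding weighted_def primitive_cmult right_diff_distrib ..
  have "nsq lborel (\<lambda>\<xi>. primitive T (\<lambda>s. weighted w V s \<xi>) r - primitive T (\<lambda>s. weighted w V s \<xi>) t)
      \<le> (\<integral>\<^sup>+\<xi>. ennreal \<bar>r - t\<bar> * nsq (time T) (\<lambda>s. weighted w V s \<xi>) \<partial>lborel)"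
    unfolding nsq_def[of lborel]
  proof (rule nn_integral_mono_AE)
    show "AE \<xi> in lborel. ennreal ((cmod (primitive T (\<lambda>s. weighted w V s \<xi>) r - primitive T (\<lambda>s. weighted w V s \<xi>) t))\<^sup>2)
        \<le> ennreal \<bar>r - t\<bar> * nsq (time T) (\<lambda>s. weighted w V s \<xi>)"
      using L2_L2_section2[OF L2] by eventually_elim (rule primitive_diff_sq_le)
  qed
  also have "\<dots> = ennreal \<bar>r - t\<bar> * nsq (strip T) (case_prod (weighted w V))"
    unfolding nsq_strip_swap[OF m] by (rule nn_integral_cmult[OF nsq_section2_measurable[OF m]])
  finally show ?thesis unfolding eq .
qed

text \<open>Two curves that are continuous in time and agree at almost every time agree at t. Since
  the constant c is not known to have finite weighted norm, only increments are compared: C t - C r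
  and P r - P t, for a nearby time r at which the identity holds.\<close>

lemma continuous_rep_eq_primitive:
  assumes T: "T > 0" and w: "w \<in> borel_measurable borel" and w0: "AE \<xi> in lborel. w \<xi> \<noteq> 0"
    and rep: "is_continuous_rep T w U C" and dt: "is_weak_dt T U V" and L2: "weighted w V \<in> L2_L2 T" and t: "t \<in> {0..T}"
  shows "AE \<xi> in lborel. C t \<xi> = time_mean T (\<lambda>s. U s \<xi>) (\<lambda>s. V s \<xi>) + primitive T (\<lambda>s. V s \<xi>) t"
proof -
  note Um = is_weak_dtD(1)[OF dt] and Vm = is_weak_dtD(2)[OF dt]
  define P where "P r \<xi> = primitive T (\<lambda>s. V s \<xi>) r" for r \<xi>
  define c where "c \<xi> = time_mean T (\<lambda>s. U s \<xi>) (\<lambda>s. V s \<xi>)" for \<xi>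
  have Pj: "case_prod P \<in> borel_measurable (borel \<Otimes>\<^sub>M borel)"
    unfolding P_def[abs_def] by (rule primitive_joint_measurable[OF Vm])
  have Pm: "P r \<in> borel_measurable lborel" for r
    using joint_section1[OF Pj] by (simp only: measurable_lborel2)
  have Pstrip: "case_prod P \<in> borel_measurable (strip T)" by (rule measurable_strip_borel[OF Pj])
  have "case_prod (\<lambda>t \<xi>. U t \<xi> - P t \<xi>) \<in> borel_measurable (strip T)"
    using borel_measurable_diff[OF Um Pstrip] by (simp only: case_prod_beta')
  from time_integral_measurable[OF borel_measurable_const[of "1 :: complex"] this]
  have "(\<lambda>\<xi>. \<integral>t. U t \<xi> - P t \<xi> \<partial>time T) \<in> borel_measurable lborel" by (simp only: mult_1_left)
  then have cm: "c \<in> borel_measurable lborel"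
    unfolding c_def[abs_def] time_mean_def P_def by (rule borel_measurable_times[OF borel_measurable_const])
  have "(\<lambda>k. c (snd k)) \<in> borel_measurable (strip T)"
    using measurable_compose[OF measurable_snd cm] .
  from borel_measurable_add[OF this Pstrip]
  have cPm: "case_prod (\<lambda>t \<xi>. c \<xi> + P t \<xi>) \<in> borel_measurable (strip T)" by (simp only: case_prod_beta')
  have "AE \<xi> in lborel. AE t in time T. U t \<xi> = c \<xi> + P t \<xi>"
    using weak_dt_primitive[OF T dt] unfolding c_def P_def .
  then have ae1: "AE t in time T. AE \<xi> in lborel. U t \<xi> = c \<xi> + P t \<xi>"
    using AE_strip_iff[OF Um cPm] by blast
  have ae2: "AE t in time T. AE \<xi> in lborel. C t \<xi> = U t \<xi>"
    and sq: "\<And>r. r \<in> {0..T} \<Longrightarrow> sq_integrable lborel (weighted w C r)"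
    and cont: "((\<lambda>r. L2_norm lborel (\<lambda>\<xi>. weighted w C r \<xi> - weighted w C t \<xi>)) \<longlongrightarrow> 0) (at t within {0..T})"
    using rep t unfolding is_continuous_rep_def by blast+
  have good: "AE r in time T. AE \<xi> in lborel. C r \<xi> = c \<xi> + P r \<xi>"
    using ae1 ae2
  proof eventually_elim
    case (elim r)
    show ?case using elim by eventually_elim simp
  qed
  define N where "N = nsq (strip T) (case_prod (weighted w V))"
  have N: "N < top" using L2 by (simp add: L2_L2_iff N_def)
  have wm: "(\<lambda>\<xi>. complex_of_real (w \<xi>)) \<in> borel_measurable lborel" using w by measurable
  define X where "X \<xi> = weighted w C t \<xi> - complex_of_real (w \<xi>) * (c \<xi> + P t \<xi>)" for \<xi>
  have Xm: "X \<in> borel_measurable lborel"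
    unfolding X_def[abs_def]
    by (intro borel_measurable_diff borel_measurable_times borel_measurable_add wm cm Pm sq_integrableD(1)[OF sq[OF t]])
  define f where "f r = 2 * nsq lborel (\<lambda>\<xi>. weighted w C r \<xi> - weighted w C t \<xi>) + 2 * (ennreal \<bar>r - t\<bar> * N)" for r
  have f0: "(f \<longlongrightarrow> 0) (at t within {0..T})"
  proof -
    have "((\<lambda>r. ennreal ((L2_norm lborel (\<lambda>\<xi>. weighted w C r \<xi> - weighted w C t \<xi>))\<^sup>2)) \<longlongrightarrow> ennreal (0\<^sup>2)) (at t within {0..T})"
      by (intro tendsto_ennrealI tendsto_power cont)
    then have "((\<lambda>r. ennreal ((L2_norm lborel (\<lambda>\<xi>. weighted w C r \<xi> - weighted w C t \<xi>))\<^sup>2)) \<longlongrightarrow> 0) (at t within {0..T})" by simp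
    moreover have "\<forall>\<^sub>F r in at t within {0..T}. ennreal ((L2_norm lborel (\<lambda>\<xi>. weighted w C r \<xi> - weighted w C t \<xi>))\<^sup>2) = nsq lborel (\<lambda>\<xi>. weighted w C r \<xi> - weighted w C t \<xi>)"
      unfolding eventually_at_filter by (intro always_eventually) (auto intro!: ennreal_L2_norm_sq sq_integrable_diff sq t)
    ultimately have a: "((\<lambda>r. nsq lborel (\<lambda>\<xi>. weighted w C r \<xi> - weighted w C t \<xi>)) \<longlongrightarrow> 0) (at t within {0..T})"
      by (rule Lim_transform_eventually)
    have "((\<lambda>r. N * ennreal \<bar>r - t\<bar>) \<longlongrightarrow> N * ennreal \<bar>t - t\<bar>) (at t within {0..T})"
      by (intro ennreal_tendsto_cmult N tendsto_ennrealI tendsto_intros)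
    then have b: "((\<lambda>r. ennreal \<bar>r - t\<bar> * N) \<longlongrightarrow> 0) (at t within {0..T})" by (simp add: mult.commute)
    show ?thesis by (rule tendsto_0_le_add2[OF a b]) (simp add: f_def)
  qed
  have "nsq lborel X \<le> 0 + ennreal e" if e: "e > 0" for e
  proof -
    have "\<forall>\<^sub>F r in at t within {0..T}. f r < ennreal e" by (rule order_tendstoD(2)[OF f0]) (use e in simp)
    then obtain d where d: "d > 0" "\<And>r. r \<in> {0..T} \<Longrightarrow> r \<noteq> t \<Longrightarrow> dist r t < d \<Longrightarrow> f r < ennreal e"
      unfolding eventually_at by blast
    obtain r where r: "r \<in> {0..T}" "r \<noteq> t" "dist r t < d" "AE \<xi> in lborel. C r \<xi> = c \<xi> + P r \<xi>"
      using AE_time_ex_near[OF good T t d(1)] by blast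
    let ?a = "\<lambda>\<xi>. weighted w C t \<xi> - weighted w C r \<xi>" and ?b = "\<lambda>\<xi>. complex_of_real (w \<xi>) * (P r \<xi> - P t \<xi>)"
    have "AE \<xi> in lborel. X \<xi> = ?a \<xi> + ?b \<xi>"
      using r(4) by eventually_elim (simp add: X_def weighted_def algebra_simps)
    then have "nsq lborel X = nsq lborel (\<lambda>\<xi>. ?a \<xi> + ?b \<xi>)" by (rule nsq_cong_AE)
    also have "\<dots> \<le> 2 * nsq lborel ?a + 2 * nsq lborel ?b"
      by (intro nsq_add_le borel_measurable_diff borel_measurable_times wm Pm sq_integrableD(1)[OF sq] t r)
    also have "\<dots> \<le> f r"
      unfolding f_def nsq_diff_commute[of _ "weighted w C t"] P_def N_def
      by (intro add_left_mono mult_left_mono nsq_weighted_primitive_diff_le[OF w Vm L2]) auto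
    also have "\<dots> \<le> ennreal e" using d(2)[OF r(1-3)] by simp
    finally show ?thesis by simp
  qed
  then have "nsq lborel X \<le> 0" by (rule ennreal_le_epsilon)
  then have "AE \<xi> in lborel. X \<xi> = 0" using nsq_eq_0_iff[OF Xm] by simp
  with w0 have "AE \<xi> in lborel. C t \<xi> = c \<xi> + P t \<xi>"
    by eventually_elim (simp add: X_def weighted_def)
  then show ?thesis unfolding c_def P_def .
qed

text \<open>Subtracting the representations at the two ends removes the constant, and the
  periodicity condition takes the form that the scalar equation can use.\<close>

lemma equal_ends_primitive_zero:
  assumes T: "T > 0" and w: "w \<in> borel_measurable borel" and w0: "AE \<xi> in lborel. w \<xi> \<noteq> 0"
    and rep: "is_continuous_rep T w U C" and dt: "is_weak_dt T U V" and L2: "weighted w V \<in> L2_L2 T"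
    and eq: "AE \<xi> in lborel. C 0 \<xi> = C T \<xi>"
  shows "AE \<xi> in lborel. primitive T (\<lambda>s. V s \<xi>) T = 0"
proof -
  have "AE \<xi> in lborel. C 0 \<xi> = time_mean T (\<lambda>s. U s \<xi>) (\<lambda>s. V s \<xi>) + primitive T (\<lambda>s. V s \<xi>) 0"
    by (rule continuous_rep_eq_primitive[OF T w w0 rep dt L2]) (use T in simp)
  moreover have "AE \<xi> in lborel. C T \<xi> = time_mean T (\<lambda>s. U s \<xi>) (\<lambda>s. V s \<xi>) + primitive T (\<lambda>s. V s \<xi>) T"
    by (rule continuous_rep_eq_primitive[OF T w w0 rep dt L2]) (use T in simp)
  ultimately show ?thesis using eq by eventually_elim (simp add: primitive_0)
qed

section \<open>The solution on the Fourier side\<close>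

text \<open>The energy estimate is used twice, for U with datum F and for its derivative G with
  datum V. The second use rests on the periodicity of F, expressed by the vanishing integral of
  V.\<close>

lemma periodic_sol_estimates:
  assumes T: "T > 0" and m: "m > 0" and F: "sq_integrable (time T) F" and V: "integrable (time T) V"
    and FV: "AE t in time T. F t = c + primitive T V t" and V0: "primitive T V T = 0" and V2: "sq_integrable (time T) V"
  defines "U \<equiv> periodic_sol T m F"
  defines "G \<equiv> (\<lambda>t. F t - complex_of_real m * U t)"
  shows "ennreal (m\<^sup>2) * nsq (time T) U \<le> nsq (time T) F"
    "nsq (time T) G \<le> nsq (time T) F"
    "ennreal (m\<^sup>2) * nsq (time T) G \<le> nsq (time T) V"
proof -
  note Fi = sq_integrable_imp_integrable_time[OF F]
  have Gi: "integrable (time T) G" unfolding G_def U_def by (rule integrable_periodic_rhs[OF Fi])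
  have U: "U s = U 0 + primitive T G s" if "s \<in> {0..T}" for s
    unfolding U_def G_def by (rule periodic_sol_primitive[OF Fi that])
  have UT: "U T = U 0" unfolding U_def by (rule periodic_sol_periodic[OF T m])
  have e: "AE s in time T. G s + complex_of_real m * U s = F s" by (simp add: G_def)
  have m0: "m \<ge> 0" using m by simp
  show "ennreal (m\<^sup>2) * nsq (time T) U \<le> nsq (time T) F" "nsq (time T) G \<le> nsq (time T) F"
    using periodic_energy[OF T m0 F Gi U e UT] by blast+
  \<comment> \<open>F equals its primitive representation only almost everywhere; B is the version
    of G that is absolutely continuous at every time and therefore has end values to
    compare.\<close>
  define B where "B t = (c + primitive T V t) - complex_of_real m * U t" for t
  define h where "h t = V t - complex_of_real m * G t" for t
  have hi: "integrable (time T) h" unfolding h_def by (intro Bochner_Integration.integrable_diff integrable_mult_right V Gi)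
  have B: "B s = (c - complex_of_real m * U 0) + primitive T h s" if "s \<in> {0..T}" for s
  proof -
    have "primitive T h s = primitive T V s - complex_of_real m * primitive T G s"
      unfolding h_def by (subst primitive_diff[OF V integrable_mult_right[OF Gi]]) (simp only: primitive_cmult)
    then show ?thesis unfolding B_def by (subst U[OF that]) (simp add: algebra_simps)
  qed
  have GB: "AE s in time T. G s = B s" using FV by eventually_elim (simp add: G_def B_def)
  have e2: "AE s in time T. h s + complex_of_real m * B s = V s"
    using GB by eventually_elim (simp add: h_def)
  have BT: "B T = B 0" by (simp add: B_def UT V0 primitive_0)
  have "ennreal (m\<^sup>2) * nsq (time T) B \<le> nsq (time T) V"
    by (rule periodic_energy(3)[OF T m0 V2 hi B e2 BT])
  then show "ennreal (m\<^sup>2) * nsq (time T) G \<le> nsq (time T) V" using nsq_cong_AE[OF GB] by simp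
qed

text \<open>Replaces the factor m in a bound by any weight s, at the price of s/m on the other side;
  s will be a power of |\<xi>|.\<close>

lemma ennreal_sq_rescale:
  assumes "m > 0" "ennreal (m\<^sup>2) * a \<le> b"
  shows "ennreal (s\<^sup>2) * a \<le> ennreal ((s / m)\<^sup>2) * b"
proof -
  have "s\<^sup>2 = (s / m)\<^sup>2 * m\<^sup>2" using assms(1) by (simp add: power_divide)
  then have "ennreal (s\<^sup>2) = ennreal ((s / m)\<^sup>2) * ennreal (m\<^sup>2)" by (subst ennreal_mult[symmetric]) auto
  then have "ennreal (s\<^sup>2) * a = ennreal ((s / m)\<^sup>2) * (ennreal (m\<^sup>2) * a)" by (simp only: mult.assoc)
  also have "\<dots> \<le> ennreal ((s / m)\<^sup>2) * b" by (intro mult_left_mono assms) simp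
  finally show ?thesis .
qed

lemma hom_weight_measurable [measurable]: "hom_weight s \<in> borel_measurable borel"
  unfolding hom_weight_def[abs_def] by measurable

lemma inhom_weight_measurable [measurable]: "inhom_weight s \<in> borel_measurable borel"
  unfolding inhom_weight_def[abs_def] by measurable

lemma hom_weight_nonzero: "AE \<xi> in lborel. hom_weight s \<xi> \<noteq> 0"
  using AE_lborel_singleton[of 0] by eventually_elim (simp add: hom_weight_def)

lemma inhom_weight_nonzero: "inhom_weight s \<xi> \<noteq> 0"
proof -
  have "1 + \<xi>\<^sup>2 > 0" by (rule add_pos_nonneg) auto
  then show ?thesis by (simp add: inhom_weight_def)
qed

lemma weighted_one: "weighted (\<lambda>_. 1) U = U"
  by (auto simp: weighted_def fun_eq_iff)

definition fourier_sol :: "real \<Rightarrow> real \<Rightarrow> real \<Rightarrow> (real \<Rightarrow> real \<Rightarrow> complex) \<Rightarrow> real \<Rightarrow> real \<Rightarrow> complex" where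
  "fourier_sol T \<kappa> \<alpha> F t \<xi> = periodic_sol T (\<kappa> * hom_weight \<alpha> \<xi>) (\<lambda>s. F s \<xi>) t"

definition fourier_sol_dt :: "real \<Rightarrow> real \<Rightarrow> real \<Rightarrow> (real \<Rightarrow> real \<Rightarrow> complex) \<Rightarrow> real \<Rightarrow> real \<Rightarrow> complex" where
  "fourier_sol_dt T \<kappa> \<alpha> F t \<xi> = F t \<xi> - complex_of_real (\<kappa> * hom_weight \<alpha> \<xi>) * fourier_sol T \<kappa> \<alpha> F t \<xi>"

text \<open>The explicit formula gives measurability in t and \<xi> on the whole plane, end times
  included; solutions obtained by mere existence at each frequency would carry no measurability in
  \<xi>.\<close>

lemma fourier_sol_joint_measurable:
  assumes F: "case_prod F \<in> borel_measurable (strip T)"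
  shows "case_prod (fourier_sol T \<kappa> \<alpha> F) \<in> borel_measurable (borel \<Otimes>\<^sub>M borel)"
proof -
  define m where "m \<xi> = \<kappa> * hom_weight \<alpha> \<xi>" for \<xi>
  have mm: "m \<in> borel_measurable borel" unfolding m_def[abs_def] by measurable
  define E where "E t \<xi> = complex_of_real (exp (m \<xi> * t)) * F t \<xi>" for t \<xi>
  have "(\<lambda>k. m (snd k)) \<in> borel_measurable (strip T)" by (rule strip_borel_snd[OF mm])
  moreover have "(\<lambda>k. fst k) \<in> borel_measurable (strip T)"
    by (rule measurable_compose[OF measurable_fst measurable_time_ident])
  ultimately have "(\<lambda>k. m (snd k) * fst k) \<in> borel_measurable (strip T)" by (rule borel_measurable_times)
  moreover have "(\<lambda>x. complex_of_real (exp x)) \<in> borel_measurable borel" by measurable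
  ultimately have "(\<lambda>k. complex_of_real (exp (m (snd k) * fst k))) \<in> borel_measurable (strip T)"
    by (rule measurable_compose)
  from borel_measurable_times[OF this F] have E: "case_prod E \<in> borel_measurable (strip T)"
    by (simp only: E_def[abs_def] case_prod_beta')
  define P where "P t \<xi> = primitive T (\<lambda>s. E s \<xi>) t" for t \<xi>
  have [measurable]: "(\<lambda>k. P (fst k) (snd k)) \<in> borel_measurable (borel \<Otimes>\<^sub>M borel)"
    using primitive_joint_measurable[OF E] by (simp only: P_def[abs_def] case_prod_beta')
  have [measurable]: "P T \<in> borel_measurable borel" unfolding P_def[abs_def] by (rule primitive_section_measurable[OF E])
  have [measurable]: "m \<in> borel_measurable borel" by (rule mm)
  have "(\<lambda>k. complex_of_real (exp (- m (snd k) * fst k)) * (complex_of_real (exp (- m (snd k) * T) / (1 - exp (- m (snd k) * T))) * P T (snd k) + P (fst k) (snd k)))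
      \<in> borel_measurable (borel \<Otimes>\<^sub>M borel)"
    by measurable
  then show ?thesis
    by (simp only: fourier_sol_def[abs_def] periodic_sol_def periodic_const_def P_def E_def m_def primitive_end[OF order_refl] case_prod_beta')
qed

lemma fourier_sol_measurable:
  assumes F: "case_prod F \<in> borel_measurable (strip T)"
  shows "case_prod (fourier_sol T \<kappa> \<alpha> F) \<in> borel_measurable (strip T)"
    "case_prod (fourier_sol_dt T \<kappa> \<alpha> F) \<in> borel_measurable (strip T)"
proof -
  show U: "case_prod (fourier_sol T \<kappa> \<alpha> F) \<in> borel_measurable (strip T)"
    by (rule measurable_strip_borel[OF fourier_sol_joint_measurable[OF F]])
  have w: "(\<lambda>\<xi>. \<kappa> * hom_weight \<alpha> \<xi>) \<in> borel_measurable borel" by measurable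
  from borel_measurable_diff[OF F weighted_measurable[OF w U]]
  show "case_prod (fourier_sol_dt T \<kappa> \<alpha> F) \<in> borel_measurable (strip T)"
    by (simp only: fourier_sol_dt_def[abs_def] weighted_def case_prod_beta')
qed

context
  fixes T \<kappa> \<alpha> :: real and F V :: "real \<Rightarrow> real \<Rightarrow> complex"
  assumes T: "T > 0" and \<kappa>: "\<kappa> > 0"
    and F: "F \<in> L2_L2 T" and dt: "is_weak_dt T F V"
    and hF: "weighted (hom_weight (- \<alpha> / 2)) F \<in> L2_L2 T"
    and hV: "weighted (hom_weight (- \<alpha> / 2)) V \<in> L2_L2 T"
    and hFF: "weighted (hom_weight (- \<alpha>)) F \<in> L2_L2 T"
    and V0: "AE \<xi> in lborel. primitive T (\<lambda>s. V s \<xi>) T = 0"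
begin

abbreviation "solU \<equiv> fourier_sol T \<kappa> \<alpha> F"
abbreviation "solG \<equiv> fourier_sol_dt T \<kappa> \<alpha> F"

lemma F_measurable: "case_prod F \<in> borel_measurable (strip T)" and V_measurable: "case_prod V \<in> borel_measurable (strip T)"
  using is_weak_dtD(1,2)[OF dt] .

text \<open>V is known to be square integrable only after weighting, but at a fixed \<xi> \<noteq> 0
  the weight is a positive number and can be divided out. The scalar estimates then apply with m =
  \<kappa> |\<xi>|^\<alpha> > 0.\<close>

lemma sol_pointwise:
  "AE \<xi> in lborel. \<xi> \<noteq> 0 \<and> integrable (time T) (\<lambda>t. F t \<xi>) \<and>
    ennreal ((\<kappa> * hom_weight \<alpha> \<xi>)\<^sup>2) * nsq (time T) (\<lambda>t. solU t \<xi>) \<le> nsq (time T) (\<lambda>t. F t \<xi>) \<and>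
    nsq (time T) (\<lambda>t. solG t \<xi>) \<le> nsq (time T) (\<lambda>t. F t \<xi>) \<and>
    ennreal ((\<kappa> * hom_weight \<alpha> \<xi>)\<^sup>2) * nsq (time T) (\<lambda>t. solG t \<xi>) \<le> nsq (time T) (\<lambda>t. V t \<xi>)"
  using AE_lborel_singleton[of 0] L2_L2_section2[OF F] L2_L2_section2[OF hV] weak_dt_primitive[OF T dt] V0
    is_weak_dtD(4)[OF dt]
proof eventually_elim
  case (elim \<xi>)
  have h: "hom_weight s \<xi> > 0" for s using elim(1) by (simp add: hom_weight_def)
  have m: "\<kappa> * hom_weight \<alpha> \<xi> > 0" using \<kappa> h by simp
  have "(\<lambda>t. complex_of_real (1 / hom_weight (- \<alpha> / 2) \<xi>) * weighted (hom_weight (- \<alpha> / 2)) V t \<xi>) = (\<lambda>t. V t \<xi>)"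
    using h[of "- \<alpha> / 2"] by (auto simp: weighted_def)
  then have V2: "sq_integrable (time T) (\<lambda>t. V t \<xi>)"
    using sq_integrable_cmult[OF elim(3), of "complex_of_real (1 / hom_weight (- \<alpha> / 2) \<xi>)"] by (simp only:)
  note E = periodic_sol_estimates[OF T m elim(2,6,4,5) V2]
  show ?case
    unfolding fourier_sol_dt_def fourier_sol_def
    by (intro conjI elim(1) sq_integrable_imp_integrable_time[OF elim(2)] E)
qed

lemma hom_weight_quotient:
  assumes "\<xi> \<noteq> 0"
  shows "hom_weight s \<xi> / (\<kappa> * hom_weight \<alpha> \<xi>) = 1 / \<kappa> * hom_weight (s - \<alpha>) \<xi>"
  using assms \<kappa> by (simp add: hom_weight_def powr_diff)

text \<open>Dividing |\<xi>|^s by m = \<kappa> |\<xi>|^\<alpha> gains \<alpha> derivatives and the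
  factor 1/\<kappa>. The uses are s = 0, \<alpha>/2 and \<alpha>, matching the three parts of the
  norm of f that involve no time derivative.\<close>

lemma sol_norm_U:
  assumes "weighted (hom_weight (s - \<alpha>)) F \<in> L2_L2 T"
  shows "weighted (hom_weight s) solU \<in> L2_L2 T"
    "L2_L2_norm T (weighted (hom_weight s) solU) \<le> 1 / \<kappa> * L2_L2_norm T (weighted (hom_weight (s - \<alpha>)) F)"
proof -
  have le: "AE \<xi> in lborel. ennreal ((hom_weight s \<xi>)\<^sup>2) * nsq (time T) (\<lambda>t. solU t \<xi>)
      \<le> ennreal ((1 / \<kappa>)\<^sup>2) * (ennreal ((hom_weight (s - \<alpha>) \<xi>)\<^sup>2) * nsq (time T) (\<lambda>t. F t \<xi>))"
    using sol_pointwise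
  proof eventually_elim
    case (elim \<xi>)
    then have "\<xi> \<noteq> 0" by simp
    have m: "\<kappa> * hom_weight \<alpha> \<xi> > 0" using \<kappa> \<open>\<xi> \<noteq> 0\<close> by (simp add: hom_weight_def)
    have "ennreal ((hom_weight s \<xi>)\<^sup>2) * nsq (time T) (\<lambda>t. solU t \<xi>) \<le> ennreal ((hom_weight s \<xi> / (\<kappa> * hom_weight \<alpha> \<xi>))\<^sup>2) * nsq (time T) (\<lambda>t. F t \<xi>)"
      using elim by (intro ennreal_sq_rescale[OF m]) blast
    then show ?case
      unfolding hom_weight_quotient[OF \<open>\<xi> \<noteq> 0\<close>] by (simp only: power_mult_distrib ennreal_mult zero_le_power2 mult.assoc)
  qed
  have "0 \<le> 1 / \<kappa>" using \<kappa> by simp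
  from weighted_norm_le[OF hom_weight_measurable hom_weight_measurable fourier_sol_measurable(1)[OF F_measurable] F_measurable this le assms]
  show "weighted (hom_weight s) solU \<in> L2_L2 T"
    "L2_L2_norm T (weighted (hom_weight s) solU) \<le> 1 / \<kappa> * L2_L2_norm T (weighted (hom_weight (s - \<alpha>)) F)" .
qed

text \<open>Since \<alpha>/2 - \<alpha> = -\<alpha>/2, the datum V enters with exactly the weight
  that is available for it.\<close>

lemma sol_norm_G_V:
  shows "weighted (hom_weight (\<alpha> / 2)) solG \<in> L2_L2 T"
    "L2_L2_norm T (weighted (hom_weight (\<alpha> / 2)) solG) \<le> 1 / \<kappa> * L2_L2_norm T (weighted (hom_weight (- \<alpha> / 2)) V)"
proof -
  have le: "AE \<xi> in lborel. ennreal ((hom_weight (\<alpha> / 2) \<xi>)\<^sup>2) * nsq (time T) (\<lambda>t. solG t \<xi>)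
      \<le> ennreal ((1 / \<kappa>)\<^sup>2) * (ennreal ((hom_weight (- \<alpha> / 2) \<xi>)\<^sup>2) * nsq (time T) (\<lambda>t. V t \<xi>))"
    using sol_pointwise
  proof eventually_elim
    case (elim \<xi>)
    then have "\<xi> \<noteq> 0" by simp
    have m: "\<kappa> * hom_weight \<alpha> \<xi> > 0" using \<kappa> \<open>\<xi> \<noteq> 0\<close> by (simp add: hom_weight_def)
    have "ennreal ((hom_weight (\<alpha> / 2) \<xi>)\<^sup>2) * nsq (time T) (\<lambda>t. solG t \<xi>) \<le> ennreal ((hom_weight (\<alpha> / 2) \<xi> / (\<kappa> * hom_weight \<alpha> \<xi>))\<^sup>2) * nsq (time T) (\<lambda>t. V t \<xi>)"
      using elim by (intro ennreal_sq_rescale[OF m]) blast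
    moreover have "\<alpha> / 2 - \<alpha> = - \<alpha> / 2" by simp
    ultimately show ?case
      unfolding hom_weight_quotient[OF \<open>\<xi> \<noteq> 0\<close>] by (simp only: power_mult_distrib ennreal_mult zero_le_power2 mult.assoc)
  qed
  have "0 \<le> 1 / \<kappa>" using \<kappa> by simp
  from weighted_norm_le[OF hom_weight_measurable hom_weight_measurable fourier_sol_measurable(2)[OF F_measurable] V_measurable this le hV]
  show "weighted (hom_weight (\<alpha> / 2)) solG \<in> L2_L2 T"
    "L2_L2_norm T (weighted (hom_weight (\<alpha> / 2)) solG) \<le> 1 / \<kappa> * L2_L2_norm T (weighted (hom_weight (- \<alpha> / 2)) V)" .
qed

lemma sol_norm_G:
  shows "solG \<in> L2_L2 T" "L2_L2_norm T solG \<le> L2_L2_norm T F"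
proof -
  have le: "AE \<xi> in lborel. ennreal (1\<^sup>2) * nsq (time T) (\<lambda>t. solG t \<xi>) \<le> ennreal (1\<^sup>2) * (ennreal (1\<^sup>2) * nsq (time T) (\<lambda>t. F t \<xi>))"
    using sol_pointwise by eventually_elim simp
  have "weighted (\<lambda>_. 1) F \<in> L2_L2 T" using F by (simp only: weighted_one)
  from weighted_norm_le[OF borel_measurable_const borel_measurable_const fourier_sol_measurable(2)[OF F_measurable] F_measurable zero_le_one le this]
  show "solG \<in> L2_L2 T" "L2_L2_norm T solG \<le> L2_L2_norm T F" by (simp_all only: weighted_one mult_1_left)
qed

text \<open>\<open>hom_weight 0\<close> is 1 except at \<xi> = 0, where \<open>0 powr 0 = 0\<close>;
  a single frequency is a null set.\<close>

lemma nsq_weighted_hom_0: "nsq (strip T) (case_prod (weighted (hom_weight 0) X)) = nsq (strip T) (case_prod X)"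
  if "case_prod X \<in> borel_measurable (strip T)" for X
  unfolding nsq_strip_weighted[OF hom_weight_measurable that] nsq_strip_swap[OF that]
proof (rule nn_integral_cong_AE)
  show "AE \<xi> in lborel. ennreal ((hom_weight 0 \<xi>)\<^sup>2) * nsq (time T) (\<lambda>t. X t \<xi>) = nsq (time T) (\<lambda>t. X t \<xi>)"
    using AE_lborel_singleton[of 0] by eventually_elim (simp add: hom_weight_def)
qed

lemma weighted_hom_0:
  assumes X: "case_prod X \<in> borel_measurable (strip T)"
  shows "weighted (hom_weight 0) X \<in> L2_L2 T \<longleftrightarrow> X \<in> L2_L2 T" "L2_L2_norm T (weighted (hom_weight 0) X) = L2_L2_norm T X"
  using nsq_weighted_hom_0[OF X] weighted_measurable[OF hom_weight_measurable X, of 0] X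
  by (simp_all only: L2_L2_iff L2_L2_norm_eq)

lemma sol_L2:
  shows "solU \<in> L2_L2 T" "L2_L2_norm T solU \<le> 1 / \<kappa> * L2_L2_norm T (weighted (hom_weight (- \<alpha>)) F)"
  using sol_norm_U[of 0] hFF weighted_hom_0[OF fourier_sol_measurable(1)[OF F_measurable]] by simp_all

lemma sol_half:
  shows "weighted (hom_weight (\<alpha> / 2)) solU \<in> L2_L2 T"
    "L2_L2_norm T (weighted (hom_weight (\<alpha> / 2)) solU) \<le> 1 / \<kappa> * L2_L2_norm T (weighted (hom_weight (- \<alpha> / 2)) F)"
proof -
  have "\<alpha> / 2 - \<alpha> = - \<alpha> / 2" by simp
  with sol_norm_U[of "\<alpha> / 2"] hF show "weighted (hom_weight (\<alpha> / 2)) solU \<in> L2_L2 T"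
    "L2_L2_norm T (weighted (hom_weight (\<alpha> / 2)) solU) \<le> 1 / \<kappa> * L2_L2_norm T (weighted (hom_weight (- \<alpha> / 2)) F)"
    by (simp_all only:)
qed

lemma sol_full:
  shows "weighted (hom_weight \<alpha>) solU \<in> L2_L2 T" "L2_L2_norm T (weighted (hom_weight \<alpha>) solU) \<le> 1 / \<kappa> * L2_L2_norm T F"
  using sol_norm_U[of \<alpha>] F weighted_hom_0[OF F_measurable] by simp_all

lemma sol_primitive:
  "AE \<xi> in lborel. \<forall>t\<in>{0..T}. solU t \<xi> = solU 0 \<xi> + primitive T (\<lambda>s. solG s \<xi>) t"
  using sol_pointwise
proof eventually_elim
  case (elim \<xi>)
  then have "integrable (time T) (\<lambda>t. F t \<xi>)" by blast
  from periodic_sol_primitive[OF this] show ?case unfolding fourier_sol_dt_def fourier_sol_def by blast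
qed

lemma sol_periodic: "AE \<xi> in lborel. solU 0 \<xi> = solU T \<xi>"
  using AE_lborel_singleton[of 0]
proof eventually_elim
  case (elim \<xi>)
  then have "\<kappa> * hom_weight \<alpha> \<xi> > 0" using \<kappa> by (simp add: hom_weight_def)
  from periodic_sol_periodic[OF T this] show ?case unfolding fourier_sol_def by simp
qed

lemma sol_weak_dt: "is_weak_dt T solU solG"
proof (rule is_weak_dtI[OF T fourier_sol_measurable[OF F_measurable] _ _ sol_primitive])
  show "AE x in lborel. integrable (time T) (\<lambda>t. solU t x)"
    using L2_L2_section2[OF sol_L2(1)] by eventually_elim (rule sq_integrable_imp_integrable_time)
  show "AE x in lborel. integrable (time T) (\<lambda>t. solG t x)"
    using L2_L2_section2[OF sol_norm_G(1)] by eventually_elim (rule sq_integrable_imp_integrable_time)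
qed

text \<open>At almost every frequency Z has a version A that is a constant plus a primitive and is
  periodic by the vanishing integral. Scalar uniqueness applies to A and carries over to Z at almost
  every time.\<close>

lemma sol_unique:
  assumes dtZ: "is_weak_dt T Z Z'" and eq: "AE (t, \<xi>) in strip T. Z' t \<xi> + complex_of_real (\<kappa> * hom_weight \<alpha> \<xi>) * Z t \<xi> = F t \<xi>"
    and Z0: "AE \<xi> in lborel. primitive T (\<lambda>s. Z' s \<xi>) T = 0"
  shows "AE (t, \<xi>) in strip T. Z t \<xi> = solU t \<xi>"
proof -
  note Zm = is_weak_dtD(1)[OF dtZ] and Zm' = is_weak_dtD(2)[OF dtZ]
  have w: "(\<lambda>\<xi>. \<kappa> * hom_weight \<alpha> \<xi>) \<in> borel_measurable borel" by measurable
  have "case_prod (\<lambda>t \<xi>. Z' t \<xi> + complex_of_real (\<kappa> * hom_weight \<alpha> \<xi>) * Z t \<xi>) \<in> borel_measurable (strip T)"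
    using borel_measurable_add[OF Zm' weighted_measurable[OF w Zm]] by (simp only: weighted_def case_prod_beta')
  from AE_strip_iff(2)[OF this F_measurable] eq
  have "AE \<xi> in lborel. AE t in time T. Z' t \<xi> + complex_of_real (\<kappa> * hom_weight \<alpha> \<xi>) * Z t \<xi> = F t \<xi>" by blast
  then have "AE \<xi> in lborel. AE t in time T. Z t \<xi> = solU t \<xi>"
    using Z0 weak_dt_primitive[OF T dtZ] is_weak_dtD(4)[OF dtZ] sol_pointwise
  proof eventually_elim
    case (elim \<xi>)
    then have "\<xi> \<noteq> 0" and Fi: "integrable (time T) (\<lambda>t. F t \<xi>)" by blast+
    then have m: "\<kappa> * hom_weight \<alpha> \<xi> > 0" using \<kappa> by (simp add: hom_weight_def)
    define c where "c = time_mean T (\<lambda>s. Z s \<xi>) (\<lambda>s. Z' s \<xi>)"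
    define A where "A t = c + primitive T (\<lambda>s. Z' s \<xi>) t" for t
    have AZ: "AE t in time T. Z t \<xi> = A t" using elim(3) unfolding A_def c_def .
    have "AE t in time T. Z' t \<xi> + complex_of_real (\<kappa> * hom_weight \<alpha> \<xi>) * A t = F t \<xi>"
      using elim(1) AZ by eventually_elim simp
    moreover have "A T = A 0" using elim(2) by (simp add: A_def primitive_0)
    ultimately have "A t = periodic_sol T (\<kappa> * hom_weight \<alpha> \<xi>) (\<lambda>s. F s \<xi>) t" if "t \<in> {0..T}" for t
      using that by (intro periodic_sol_unique[OF T m Fi elim(4), where A = A and a = c]) (simp_all add: A_def)
    then have AU: "A t = solU t \<xi>" if "t \<in> {0<..<T}" for t using that by (simp add: fourier_sol_def)
    show ?case
      using AZ AE_space_time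
    proof eventually_elim
      case (elim t)
      then show ?case using AU by simp
    qed
  qed
  then show ?thesis using AE_strip_iff(2)[OF Zm fourier_sol_measurable(1)[OF F_measurable]] by blast
qed

end

section \<open>Existence, uniqueness and estimate\<close>

lemma weighted_cong_AE:
  assumes "AE (t, \<xi>) in strip T. A t \<xi> = B t \<xi>"
  shows "AE (t, \<xi>) in strip T. weighted w A t \<xi> = weighted w B t \<xi>"
  using assms by eventually_elim (auto simp: weighted_def)

lemma L2_L2_cong_AE:
  assumes m: "case_prod A \<in> borel_measurable (strip T)" "case_prod B \<in> borel_measurable (strip T)"
    and eq: "AE (t, \<xi>) in strip T. A t \<xi> = B t \<xi>"
  shows "A \<in> L2_L2 T \<longleftrightarrow> B \<in> L2_L2 T" "L2_L2_norm T A = L2_L2_norm T B"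
proof -
  have "nsq (strip T) (case_prod A) = nsq (strip T) (case_prod B)"
    by (rule nsq_cong_AE) (use eq in \<open>auto elim: eventually_mono\<close>)
  with m show "A \<in> L2_L2 T \<longleftrightarrow> B \<in> L2_L2 T" "L2_L2_norm T A = L2_L2_norm T B"
    by (simp_all only: L2_L2_iff L2_L2_norm_eq)
qed

lemma fourier_x_is_fourier_x:
  assumes "is_fourier_x T u A"
  shows "is_fourier_x T u (fourier_x T u)"
  unfolding fourier_x_def by (rule someI[of "is_fourier_x T u", OF assms])

lemma weak_dt_is_weak_dt:
  assumes "is_weak_dt T u v"
  shows "is_weak_dt T u (weak_dt T u)"
  unfolding weak_dt_def by (rule someI[of "is_weak_dt T u", OF assms])

lemma AE_strip_refl: "AE (t, x) in strip T. u t x = u t x"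
  by (rule AE_I2) (simp add: case_prod_beta')

text \<open>\<open>Lambda\<close> is picked by \<open>SOME\<close>: the inverse transform shows that
  a candidate exists, and whichever one is picked has the right transform because transforms are
  unique up to null sets.\<close>

lemma Lambda_fourier:
  assumes u: "is_fourier_x T u A" and L2: "weighted (hom_weight s) A \<in> L2_L2 T"
  shows "is_fourier_x T (Lambda T s u) (weighted (hom_weight s) A)"
proof -
  obtain y where y: "is_fourier_x T y (weighted (hom_weight s) A)"
    using inverse_fourier_x_exists[OF L2] by blast
  then have "is_Lambda T s u y" using u unfolding is_Lambda_def by blast
  then have "is_Lambda T s u (Lambda T s u)" unfolding Lambda_def by (rule someI[of "is_Lambda T s u"])
  then obtain B where B: "is_fourier_x T u B" "is_fourier_x T (Lambda T s u) (weighted (hom_weight s) B)"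
    unfolding is_Lambda_def by blast
  have "AE (t, \<xi>) in strip T. B t \<xi> = A t \<xi>" by (rule is_fourier_x_unique[OF B(1) u AE_strip_refl])
  then show ?thesis
    by (intro is_fourier_x_cong[OF B(2) is_fourier_xD(1)[OF B(2)] is_fourier_xD(2)[OF y]] AE_strip_refl weighted_cong_AE)
qed

lemma inhom_weight_ge_1: "s \<ge> 0 \<Longrightarrow> 1 \<le> inhom_weight s \<xi>"
  unfolding inhom_weight_def by (intro ge_one_powr_ge_zero) auto

text \<open>The base 1 + \<xi>^2 is at most 2 for |\<xi>| \<le> 1 and at most 2 \<xi>^2 otherwise;
  both cases cost the factor 2^(s/2).\<close>

lemma inhom_weight_le: 
  assumes "s \<ge> 0"
  shows "inhom_weight s \<xi> \<le> 2 powr (s / 2) * (1 + hom_weight s \<xi>)"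
proof (cases "\<bar>\<xi>\<bar> \<le> 1")
  case True
  then have "1 + \<xi>\<^sup>2 \<le> 2" using abs_square_le_1[of \<xi>] by simp
  then have "inhom_weight s \<xi> \<le> 2 powr (s / 2)"
    unfolding inhom_weight_def using assms by (intro powr_mono2) auto
  also have "\<dots> \<le> 2 powr (s / 2) * (1 + hom_weight s \<xi>)"
    by (simp add: hom_weight_def)
  finally show ?thesis .
next
  case False
  then have "1 \<le> \<xi>\<^sup>2" by (simp add: abs_square_le_1[symmetric] not_le less_imp_le abs_le_square_iff[of 1, simplified])
  then have "1 + \<xi>\<^sup>2 \<le> 2 * \<bar>\<xi>\<bar>\<^sup>2" by simp
  then have "inhom_weight s \<xi> \<le> (2 * \<bar>\<xi>\<bar>\<^sup>2) powr (s / 2)"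
    unfolding inhom_weight_def using assms by (intro powr_mono2) auto
  also have "\<dots> = 2 powr (s / 2) * (\<bar>\<xi>\<bar>\<^sup>2) powr (s / 2)" by (rule powr_mult)
  also have "\<bar>\<xi>\<bar>\<^sup>2 = \<bar>\<xi>\<bar> powr 2" by (rule powr_numeral[symmetric]) (use False in auto)
  also have "(\<bar>\<xi>\<bar> powr 2) powr (s / 2) = hom_weight s \<xi>" by (simp only: powr_powr hom_weight_def) simp
  also have "2 powr (s / 2) * hom_weight s \<xi> \<le> 2 powr (s / 2) * (1 + hom_weight s \<xi>)" by (intro mult_left_mono) auto
  finally show ?thesis .
qed

lemma weighted_inhom_L2:
  assumes s: "s \<ge> 0" and A: "A \<in> L2_L2 T" and hA: "weighted (hom_weight s) A \<in> L2_L2 T"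
  shows "weighted (inhom_weight s) A \<in> L2_L2 T"
proof -
  have Am: "case_prod A \<in> borel_measurable (strip T)" using A by (simp add: L2_L2_iff)
  have sA: "sq_integrable (strip T) (case_prod A)" and shA: "sq_integrable (strip T) (case_prod (weighted (hom_weight s) A))"
    using A hA by (simp_all add: L2_L2_def)
  have cm: "(\<lambda>z. complex_of_real (cmod z)) \<in> borel_measurable borel" by measurable
  have "sq_integrable (strip T) (\<lambda>k. complex_of_real (cmod (case_prod A k)))"
    by (rule sq_integrable_bound[OF sA measurable_compose[OF Am cm]]) simp
  moreover have "sq_integrable (strip T) (\<lambda>k. complex_of_real (cmod (case_prod (weighted (hom_weight s) A) k)))"
    by (rule sq_integrable_bound[OF shA measurable_compose[OF weighted_measurable[OF hom_weight_measurable Am] cm]]) simp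
  ultimately have "sq_integrable (strip T) (\<lambda>k. complex_of_real (2 powr (s / 2)) * (complex_of_real (cmod (case_prod A k)) + complex_of_real (cmod (case_prod (weighted (hom_weight s) A) k))))"
    by (intro sq_integrable_cmult sq_integrable_add)
  then have "sq_integrable (strip T) (case_prod (weighted (inhom_weight s) A))"
  proof (rule sq_integrable_bound[OF _ weighted_measurable[OF inhom_weight_measurable Am]], intro AE_I2)
    fix k :: "real \<times> real"
    obtain t \<xi> where k: "k = (t, \<xi>)" by (cases k)
    have h: "0 \<le> hom_weight s \<xi>" by (simp add: hom_weight_def)
    have i: "0 \<le> inhom_weight s \<xi>" by (simp add: inhom_weight_def)
    have "cmod (case_prod (weighted (inhom_weight s) A) k) = inhom_weight s \<xi> * cmod (A t \<xi>)"
      using i by (simp add: k weighted_def norm_mult)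
    also have "\<dots> \<le> 2 powr (s / 2) * (1 + hom_weight s \<xi>) * cmod (A t \<xi>)"
      by (intro mult_right_mono inhom_weight_le s) auto
    also have "\<dots> = 2 powr (s / 2) * (cmod (A t \<xi>) + cmod (weighted (hom_weight s) A t \<xi>))"
      using h by (simp add: weighted_def norm_mult algebra_simps)
    also have "\<dots> = cmod (complex_of_real (2 powr (s / 2) * (cmod (A t \<xi>) + cmod (weighted (hom_weight s) A t \<xi>))))"
      by (subst norm_of_real) (simp add: abs_of_nonneg)
    finally show "cmod (case_prod (weighted (inhom_weight s) A) k) \<le> cmod (complex_of_real (2 powr (s / 2)) * (complex_of_real (cmod (case_prod A k)) + complex_of_real (cmod (case_prod (weighted (hom_weight s) A) k))))"
      by (simp add: k)
  qed
  then show ?thesis by (simp add: L2_L2_def)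
qed

lemma L2_L2_if_weighted_inhom:
  assumes s: "s \<ge> 0" and m: "case_prod A \<in> borel_measurable (strip T)" and A: "weighted (inhom_weight s) A \<in> L2_L2 T"
  shows "A \<in> L2_L2 T"
proof -
  have "sq_integrable (strip T) (case_prod A)"
  proof (rule sq_integrable_bound[OF _ m])
    show "sq_integrable (strip T) (case_prod (weighted (inhom_weight s) A))" using A by (simp add: L2_L2_def)
    show "AE k in strip T. cmod (case_prod A k) \<le> cmod (case_prod (weighted (inhom_weight s) A) k)"
    proof (rule AE_I2)
      fix k :: "real \<times> real"
      obtain t \<xi> where k: "k = (t, \<xi>)" by (cases k)
      have "1 * cmod (A t \<xi>) \<le> \<bar>inhom_weight s \<xi>\<bar> * cmod (A t \<xi>)"
        using inhom_weight_ge_1[OF s, of \<xi>] by (intro mult_right_mono) auto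
      then show "cmod (case_prod A k) \<le> cmod (case_prod (weighted (inhom_weight s) A) k)"
        by (simp add: k weighted_def norm_mult)
    qed
  qed
  then show ?thesis by (simp add: L2_L2_def)
qed

text \<open>Converse to \<open>continuous_rep_eq_primitive\<close>. Increments are finite and small
  in the weighted norm by the Hoelder bound, and a single time with finite weighted norm, found
  among almost all times, makes the norm finite at every time.\<close>

lemma continuous_rep_primitive:
  assumes T: "T > 0" and w: "w \<in> borel_measurable borel"
    and A: "case_prod A \<in> borel_measurable (borel \<Otimes>\<^sub>M borel)" and wA: "weighted w A \<in> L2_L2 T"
    and B: "case_prod B \<in> borel_measurable (strip T)" and wB: "weighted w B \<in> L2_L2 T"
    and prim: "AE \<xi> in lborel. \<forall>t\<in>{0..T}. A t \<xi> = A 0 \<xi> + primitive T (\<lambda>s. B s \<xi>) t"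
    and A': "AE t in time T. AE \<xi> in lborel. A t \<xi> = A' t \<xi>"
  shows "is_continuous_rep T w A' A"
proof -
  define N where "N = nsq (strip T) (case_prod (weighted w B))"
  have N: "N < top" using wB by (simp add: L2_L2_iff N_def)
  have wm: "(\<lambda>\<xi>. complex_of_real (w \<xi>)) \<in> borel_measurable lborel" using w by measurable
  have Am: "weighted w A t \<in> borel_measurable lborel" for t
    using borel_measurable_times[OF wm, of "A t"] joint_section1[OF A, of t]
    by (simp only: weighted_def[abs_def] measurable_lborel2)
  have inc: "nsq lborel (\<lambda>\<xi>. weighted w A r \<xi> - weighted w A t \<xi>) \<le> ennreal \<bar>r - t\<bar> * N" if "r \<in> {0..T}" "t \<in> {0..T}" for r t
  proof -
    have "AE \<xi> in lborel. weighted w A r \<xi> - weighted w A t \<xi> = complex_of_real (w \<xi>) * (primitive T (\<lambda>s. B s \<xi>) r - primitive T (\<lambda>s. B s \<xi>) t)"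
      using prim
    proof eventually_elim
      case (elim \<xi>)
      have "A r \<xi> - A t \<xi> = primitive T (\<lambda>s. B s \<xi>) r - primitive T (\<lambda>s. B s \<xi>) t"
        using bspec[OF elim that(1)] bspec[OF elim that(2)] by simp
      then show ?case by (simp only: weighted_def right_diff_distrib[symmetric])
    qed
    from nsq_cong_AE[OF this] show ?thesis
      using nsq_weighted_primitive_diff_le[OF w B wB] unfolding N_def by simp
  qed
  obtain t0 where t0: "t0 \<in> {0..T}" "sq_integrable lborel (weighted w A t0)"
    using AE_time_ex_near[OF L2_L2_section1[OF wA] T, of 0 1] T by auto
  have inc_sq: "sq_integrable lborel (\<lambda>\<xi>. weighted w A r \<xi> - weighted w A t \<xi>)" if "r \<in> {0..T}" "t \<in> {0..T}" for r t
    unfolding sq_integrable_iff_nsq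
    using borel_measurable_diff[OF Am Am] le_less_trans[OF inc[OF that]] N by (simp add: ennreal_mult_less_top)
  have sq: "sq_integrable lborel (weighted w A t)" if t: "t \<in> {0..T}" for t
    using sq_integrable_add[OF inc_sq[OF t t0(1)] t0(2)] by simp
  have cont: "((\<lambda>r. L2_norm lborel (\<lambda>\<xi>. weighted w A r \<xi> - weighted w A t \<xi>)) \<longlongrightarrow> 0) (at t within {0..T})" if t: "t \<in> {0..T}" for t
  proof (rule tendsto_sandwich[OF _ _ tendsto_const])
    have "((\<lambda>r. sqrt (\<bar>r - t\<bar> * enn2real N)) \<longlongrightarrow> sqrt (\<bar>t - t\<bar> * enn2real N)) (at t within {0..T})"
      by (intro tendsto_intros)
    then show "((\<lambda>r. sqrt (\<bar>r - t\<bar> * enn2real N)) \<longlongrightarrow> 0) (at t within {0..T})" by simp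
    show "\<forall>\<^sub>F r in at t within {0..T}. 0 \<le> L2_norm lborel (\<lambda>\<xi>. weighted w A r \<xi> - weighted w A t \<xi>)"
      by (simp add: L2_norm_def)
    show "\<forall>\<^sub>F r in at t within {0..T}. L2_norm lborel (\<lambda>\<xi>. weighted w A r \<xi> - weighted w A t \<xi>) \<le> sqrt (\<bar>r - t\<bar> * enn2real N)"
      unfolding eventually_at_filter
    proof (intro always_eventually allI impI)
      fix r assume r: "r \<in> {0..T}"
      have "enn2real (nsq lborel (\<lambda>\<xi>. weighted w A r \<xi> - weighted w A t \<xi>)) \<le> enn2real (ennreal \<bar>r - t\<bar> * N)"
        using N by (intro enn2real_mono inc r t) (simp add: ennreal_mult_less_top)
      then show "L2_norm lborel (\<lambda>\<xi>. weighted w A r \<xi> - weighted w A t \<xi>) \<le> sqrt (\<bar>r - t\<bar> * enn2real N)"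
        unfolding L2_norm_eq_nsq[OF borel_measurable_diff[OF Am Am]] by (simp add: enn2real_mult)
    qed
  qed
  show ?thesis unfolding is_continuous_rep_def using A' sq cont by blast
qed

section \<open>Real-valued data give real-valued solutions\<close>

lemma periodic_sol_cong_AE:
  assumes "AE s in time T. F s = F' s" "F \<in> borel_measurable (time T)" "F' \<in> borel_measurable (time T)"
  shows "periodic_sol T m F t = periodic_sol T m F' t"
proof -
  have e: "(\<lambda>s. complex_of_real (exp (m * s))) \<in> borel_measurable (time T)"
    by (rule continuous_imp_integrable_time(3)[OF continuous_exp_complex])
  have "primitive T (\<lambda>s. complex_of_real (exp (m * s)) * F s) r = primitive T (\<lambda>s. complex_of_real (exp (m * s)) * F' s) r" for r
    using assms(1) by (intro primitive_cong_AE borel_measurable_times e assms(2,3)) (auto elim: eventually_mono)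
  then show ?thesis by (simp only: periodic_sol_def periodic_const_def primitive_end[OF order_refl, symmetric])
qed

lemma periodic_sol_cnj: "periodic_sol T m (\<lambda>s. cnj (F s)) t = cnj (periodic_sol T m F t)"
proof -
  have "primitive T (\<lambda>s. complex_of_real (exp (m * s)) * cnj (F s)) r = cnj (primitive T (\<lambda>s. complex_of_real (exp (m * s)) * F s) r)" for r
    unfolding primitive_cnj[symmetric] by (simp only: complex_cnj_mult complex_cnj_complex_of_real)
  then show ?thesis
    by (simp only: periodic_sol_def periodic_const_def primitive_end[OF order_refl, symmetric] complex_cnj_mult complex_cnj_add complex_cnj_complex_of_real)
qed

text \<open>The multiplier is real and depends on |\<xi>| only, so reflection and conjugation of F
  pass through the solution formula.\<close>

lemma fourier_sol_real:
  assumes F: "case_prod F \<in> borel_measurable (strip T)" and eq: "AE (t, \<xi>) in strip T. F t \<xi> = cnj (F t (- \<xi>))"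
  shows "AE (t, \<xi>) in strip T. fourier_sol T \<kappa> \<alpha> F t \<xi> = cnj (fourier_sol T \<kappa> \<alpha> F t (- \<xi>))"
proof -
  have m: "case_prod (\<lambda>t \<xi>. cnj (A t (- \<xi>))) \<in> borel_measurable (strip T)" if "case_prod A \<in> borel_measurable (strip T)" for A
    using measurable_compose[OF strip_reflect[OF that] cnj_measurable] by (simp only: case_prod_beta')
  have "AE \<xi> in lborel. AE t in time T. F t \<xi> = cnj (F t (- \<xi>))"
    using eq AE_strip_iff(2)[OF F m[OF F]] by blast
  then have "AE \<xi> in lborel. AE t in time T. fourier_sol T \<kappa> \<alpha> F t \<xi> = cnj (fourier_sol T \<kappa> \<alpha> F t (- \<xi>))"
  proof eventually_elim
    case (elim \<xi>)
    have "fourier_sol T \<kappa> \<alpha> F t \<xi> = cnj (fourier_sol T \<kappa> \<alpha> F t (- \<xi>))" for t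
      unfolding fourier_sol_def periodic_sol_cnj[symmetric]
      using periodic_sol_cong_AE[OF elim strip_section2[OF F] strip_section2[OF m[OF F]]]
      by (simp add: hom_weight_def)
    then show ?case by simp
  qed
  then show ?thesis using AE_strip_iff(2)[OF fourier_sol_measurable(1)[OF F] m[OF fourier_sol_measurable(1)[OF F]]] by blast
qed

text \<open>Real values mean equality with the conjugate, whose transform is the reflected
  conjugate; uniqueness and injectivity of the transform give the two directions.\<close>

lemma is_fourier_x_real:
  assumes u: "is_fourier_x T u A"
  shows "(AE (t, x) in strip T. u t x \<in> \<real>) \<longleftrightarrow> (AE (t, \<xi>) in strip T. A t \<xi> = cnj (A t (- \<xi>)))"
proof
  assume "AE (t, x) in strip T. u t x \<in> \<real>"
  then have "AE (t, x) in strip T. u t x = cnj (u t x)"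
    by eventually_elim (auto simp: Reals_cnj_iff)
  then show "AE (t, \<xi>) in strip T. A t \<xi> = cnj (A t (- \<xi>))" by (rule is_fourier_x_unique[OF u is_fourier_x_cnj[OF u]])
next
  assume "AE (t, \<xi>) in strip T. A t \<xi> = cnj (A t (- \<xi>))"
  then have "AE (t, x) in strip T. u t x = cnj (u t x)" by (rule is_fourier_x_inj[OF u is_fourier_x_cnj[OF u]])
  then show "AE (t, x) in strip T. u t x \<in> \<real>" by eventually_elim (auto simp: Reals_cnj_iff)
qed

theorem theorem2p1:
  fixes T \<kappa> \<alpha> :: real and f :: "real \<Rightarrow> real \<Rightarrow> complex"
  assumes "T > 0" and "\<kappa> > 0" and "1 < \<alpha>" and "\<alpha> < 3 / 2"
    and "f \<in> X_space T \<alpha>"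
    and "equal_end_values T (hom_weight (- \<alpha> / 2)) f"
  shows "\<exists>u. periodic_strong_solution T \<kappa> \<alpha> f u \<and>
      H1_H_norm T (\<alpha> / 2) u + L2_L2_norm T (Lambda T \<alpha> u) \<le> (1 + 1 / \<kappa>) * X_norm T \<alpha> f \<and>
      (\<forall>v. periodic_strong_solution T \<kappa> \<alpha> f v \<longrightarrow> (AE (t, x) in strip T. v t x = u t x)) \<and>
      ((AE (t, x) in strip T. f t x \<in> \<real>) \<longrightarrow> (AE (t, x) in strip T. u t x \<in> \<real>))"
proof -
  note T = assms(1) and \<kappa> = assms(2)
  have half: "0 \<le> \<alpha> / 2" using assms(3) by simp
  have f2: "f \<in> L2_L2 T" using assms(5) by (simp add: X_space_def)
  obtain F1 V1 where F1: "is_fourier_x T f F1" and V1: "is_weak_dt T F1 V1"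
    and w1: "weighted (hom_weight (- \<alpha> / 2)) F1 \<in> L2_L2 T" "weighted (hom_weight (- \<alpha> / 2)) V1 \<in> L2_L2 T"
    using assms(5) unfolding X_space_def H1_Hdot_def by blast
  obtain F2 where F2: "is_fourier_x T f F2" and w2: "weighted (hom_weight (- \<alpha>)) F2 \<in> L2_L2 T"
    using assms(5) unfolding X_space_def L2_Hdot_def by blast
  \<comment> \<open>The norms refer to the chosen \<open>fourier_x T f\<close> and its chosen weak
    derivative, while membership in the spaces provides other versions; all properties are moved to
    the chosen ones along almost-everywhere equality.\<close>
  define F where "F = fourier_x T f"
  define V where "V = weak_dt T F"
  have F: "is_fourier_x T f F" unfolding F_def by (rule fourier_x_is_fourier_x[OF F1])
  note Fm = is_fourier_xD(2)[OF F]
  have FF: "F \<in> L2_L2 T" using is_fourier_x_L2_L2[OF F] f2 by simp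
  have eq1: "AE (t, \<xi>) in strip T. F1 t \<xi> = F t \<xi>" by (rule is_fourier_x_unique[OF F1 F AE_strip_refl])
  have eq2: "AE (t, \<xi>) in strip T. F2 t \<xi> = F t \<xi>" by (rule is_fourier_x_unique[OF F2 F AE_strip_refl])
  have FV1: "is_weak_dt T F V1" by (rule is_weak_dt_cong[OF V1 Fm is_weak_dtD(2)[OF V1] eq1 AE_strip_refl])
  have V: "is_weak_dt T F V" unfolding V_def by (rule weak_dt_is_weak_dt[OF FV1])
  have eqV: "AE (t, \<xi>) in strip T. V1 t \<xi> = V t \<xi>" by (rule weak_dt_unique[OF FV1 V AE_strip_refl])
  note hm = weighted_measurable[OF hom_weight_measurable]
  have hF: "weighted (hom_weight (- \<alpha> / 2)) F \<in> L2_L2 T"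
    using L2_L2_cong_AE(1)[OF hm[OF is_fourier_xD(2)[OF F1]] hm[OF Fm] weighted_cong_AE[OF eq1]] w1(1) by blast
  have hV: "weighted (hom_weight (- \<alpha> / 2)) V \<in> L2_L2 T"
    using L2_L2_cong_AE(1)[OF hm[OF is_weak_dtD(2)[OF V1]] hm[OF is_weak_dtD(2)[OF V]] weighted_cong_AE[OF eqV]] w1(2) by blast
  have hFF: "weighted (hom_weight (- \<alpha>)) F \<in> L2_L2 T"
    using L2_L2_cong_AE(1)[OF hm[OF is_fourier_xD(2)[OF F2]] hm[OF Fm] weighted_cong_AE[OF eq2]] w2 by blast
  obtain C where C: "is_continuous_rep T (hom_weight (- \<alpha> / 2)) F C" "AE \<xi> in lborel. C 0 \<xi> = C T \<xi>"
    using assms(6) unfolding equal_end_values_def F_def[symmetric] by (elim exE conjE)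
  \<comment> \<open>Periodicity of f in the weight |\<xi>|^(-\<alpha>/2) becomes the vanishing
    integral on which the second energy estimate depends.\<close>
  have V0: "AE \<xi> in lborel. primitive T (\<lambda>s. V s \<xi>) T = 0"
    by (rule equal_ends_primitive_zero[OF T hom_weight_measurable hom_weight_nonzero C(1) V hV C(2)])
  note ctx = T \<kappa> FF V hF hV hFF V0
  define A where "A = fourier_sol T \<kappa> \<alpha> F"
  define B where "B = fourier_sol_dt T \<kappa> \<alpha> F"
  note nA = sol_L2[OF ctx, folded A_def] and nA2 = sol_half[OF ctx, folded A_def] and nA3 = sol_full[OF ctx, folded A_def]
  note nB = sol_norm_G[OF ctx, folded B_def] and nB2 = sol_norm_G_V[OF ctx, folded B_def]
  note AB = sol_weak_dt[OF ctx, folded A_def B_def]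
  \<comment> \<open>The solution and its future time derivative v are taken as separate inverse
    transforms of A and B; that v is the weak derivative of u is then read back from the Fourier
    side.\<close>
  obtain u where u: "is_fourier_x T u A" "u \<in> L2_L2 T" using inverse_fourier_x_exists[OF nA(1)] by blast
  obtain v where v: "is_fourier_x T v B" "v \<in> L2_L2 T" using inverse_fourier_x_exists[OF nB(1)] by blast
  have uv: "is_weak_dt T u v" using is_weak_dt_fourier_iff[OF u(1) v(1) u(2) v(2)] AB by simp
  define v' where "v' = weak_dt T u"
  have uv': "is_weak_dt T u v'" unfolding v'_def by (rule weak_dt_is_weak_dt[OF uv])
  have vv': "AE (t, x) in strip T. v t x = v' t x" by (rule weak_dt_unique[OF uv uv' AE_strip_refl])
  have v'B: "is_fourier_x T v' B"
    by (rule is_fourier_x_cong[OF v(1) is_weak_dtD(2)[OF uv'] is_fourier_xD(2)[OF v(1)] vv' AE_strip_refl])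
  note L = Lambda_fourier[OF u(1) nA3(1)] and Lh = Lambda_fourier[OF u(1) nA2(1)] and Lv = Lambda_fourier[OF v'B nB2(1)]
  have iA: "weighted (inhom_weight (\<alpha> / 2)) A \<in> L2_L2 T" by (rule weighted_inhom_L2[OF half nA(1) nA2(1)])
  have iB: "weighted (inhom_weight (\<alpha> / 2)) B \<in> L2_L2 T" by (rule weighted_inhom_L2[OF half nB(1) nB2(1)])
  have memH: "u \<in> H1_H T (\<alpha> / 2)" unfolding H1_H_def L2_H_def using u(1) v(1) uv iA iB by blast
  have memD: "u \<in> L2_Hdot T \<alpha>" unfolding L2_Hdot_def using u(1) nA3(1) by blast
  \<comment> \<open>B was defined as F minus the multiplier times A, so the equation holds
    identically on the Fourier side and is pulled back by injectivity.\<close>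
  have eqn: "AE (t, x) in strip T. v' t x + complex_of_real \<kappa> * Lambda T \<alpha> u t x = f t x"
  proof -
    have e: "(\<lambda>t \<xi>. B t \<xi> + complex_of_real \<kappa> * weighted (hom_weight \<alpha>) A t \<xi>) = F"
      by (auto simp: fun_eq_iff A_def B_def fourier_sol_dt_def weighted_def mult.assoc)
    have "is_fourier_x T (\<lambda>t x. v' t x + complex_of_real \<kappa> * Lambda T \<alpha> u t x) F"
      using is_fourier_x_add[OF v'B is_fourier_x_cmult[OF L, of "complex_of_real \<kappa>"]] by (simp only: e)
    from is_fourier_x_inj[OF this F AE_strip_refl] show ?thesis .
  qed
  have ends: "equal_end_values T (inhom_weight (\<alpha> / 2)) u"
  proof -
    have fu: "is_fourier_x T u (fourier_x T u)" by (rule fourier_x_is_fourier_x[OF u(1)])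
    have "AE (t, \<xi>) in strip T. A t \<xi> = fourier_x T u t \<xi>" by (rule is_fourier_x_unique[OF u(1) fu AE_strip_refl])
    then have "AE t in time T. AE \<xi> in lborel. A t \<xi> = fourier_x T u t \<xi>"
      using AE_strip_iff(1)[OF is_fourier_xD(2)[OF u(1)] is_fourier_xD(2)[OF fu]] by blast
    \<comment> \<open>A itself, defined at every time including 0 and T, is the continuous
      representative.\<close>
    from continuous_rep_primitive[OF T inhom_weight_measurable fourier_sol_joint_measurable[OF Fm, of \<kappa> \<alpha>, folded A_def] iA
        is_fourier_xD(2)[OF v(1)] iB sol_primitive[OF ctx, folded A_def B_def] this]
    have "is_continuous_rep T (inhom_weight (\<alpha> / 2)) (fourier_x T u) A" .
    then show ?thesis unfolding equal_end_values_def using sol_periodic[OF ctx, folded A_def] by blast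
  qed
  have sol: "periodic_strong_solution T \<kappa> \<alpha> f u"
    unfolding periodic_strong_solution_def using memH memD eqn ends unfolding v'_def by blast
  have norm: "H1_H_norm T (\<alpha> / 2) u + L2_L2_norm T (Lambda T \<alpha> u) \<le> (1 + 1 / \<kappa>) * X_norm T \<alpha> f"
  proof -
    define a b c d where "a = L2_L2_norm T (weighted (hom_weight (- \<alpha> / 2)) F)" and "b = L2_L2_norm T (weighted (hom_weight (- \<alpha> / 2)) V)"
      and "c = L2_L2_norm T F" and "d = L2_L2_norm T (weighted (hom_weight (- \<alpha>)) F)"
    have pos: "0 \<le> a" "0 \<le> b" "0 \<le> c" "0 \<le> d"
      unfolding a_def b_def c_def d_def L2_L2_norm_def L2_norm_def by (auto intro!: Bochner_Integration.integral_nonneg)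
    have X: "X_norm T \<alpha> f = a + b + c + d"
      unfolding X_norm_def H1_Hdot_norm_def L2_Hdot_norm_def a_def b_def c_def d_def F_def[symmetric] V_def[symmetric] L2_L2_norm_fourier[OF F] ..
    have "H1_H_norm T (\<alpha> / 2) u + L2_L2_norm T (Lambda T \<alpha> u)
        = L2_L2_norm T A + L2_L2_norm T (weighted (hom_weight (\<alpha> / 2)) A) + L2_L2_norm T B
          + L2_L2_norm T (weighted (hom_weight (\<alpha> / 2)) B) + L2_L2_norm T (weighted (hom_weight \<alpha>) A)"
      unfolding H1_H_norm_def v'_def[symmetric] L2_L2_norm_fourier[OF u(1)] L2_L2_norm_fourier[OF v'B]
        L2_L2_norm_fourier[OF L] L2_L2_norm_fourier[OF Lh] L2_L2_norm_fourier[OF Lv] ..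
    \<comment> \<open>The bounds pair u with d, \<Lambda>^(\<alpha>/2) u with a, u_t with c,
      \<Lambda>^(\<alpha>/2) u_t with b, and \<Lambda>^\<alpha> u again with c.\<close>
    also have "\<dots> \<le> 1 / \<kappa> * d + 1 / \<kappa> * a + c + 1 / \<kappa> * b + 1 / \<kappa> * c"
      unfolding a_def b_def c_def d_def by (intro add_mono nA(2) nA2(2) nB(2) nB2(2) nA3(2))
    also have "\<dots> \<le> (1 + 1 / \<kappa>) * (a + b + c + d)"
    proof -
      have "k * d + k * a + c + k * b + k * c \<le> (1 + k) * (a + b + c + d)" for k
        using pos by (simp add: algebra_simps)
      then show ?thesis .
    qed
    finally show ?thesis unfolding X .
  qed
  have unique: "AE (t, x) in strip T. z t x = u t x" if zsol: "periodic_strong_solution T \<kappa> \<alpha> f z" for z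
  proof -
    obtain Z where Z: "is_fourier_x T z Z" "weighted (inhom_weight (\<alpha> / 2)) Z \<in> L2_L2 T"
      using zsol unfolding periodic_strong_solution_def H1_H_def L2_H_def by blast
    obtain z1 Z1 where z1: "is_weak_dt T z z1" "is_fourier_x T z1 Z1" "weighted (inhom_weight (\<alpha> / 2)) Z1 \<in> L2_L2 T"
      using zsol unfolding periodic_strong_solution_def H1_H_def L2_H_def by blast
    obtain Z2 where Z2: "is_fourier_x T z Z2" "weighted (hom_weight \<alpha>) Z2 \<in> L2_L2 T"
      using zsol unfolding periodic_strong_solution_def L2_Hdot_def by blast
    have eqz: "AE (t, x) in strip T. weak_dt T z t x + complex_of_real \<kappa> * Lambda T \<alpha> z t x = f t x"
      and endz: "equal_end_values T (inhom_weight (\<alpha> / 2)) z"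
      using zsol unfolding periodic_strong_solution_def by blast+
    define Zf where "Zf = fourier_x T z"
    have Zf: "is_fourier_x T z Zf" unfolding Zf_def by (rule fourier_x_is_fourier_x[OF Z(1)])
    note Zfm = is_fourier_xD(2)[OF Zf]
    \<comment> \<open>The inhomogeneous weight is at least 1, so the competing solution and its
      derivative lie in L2 of the strip and the weak derivative can be transferred to the Fourier
      side.\<close>
    have ZL: "Z \<in> L2_L2 T" by (rule L2_L2_if_weighted_inhom[OF half is_fourier_xD(2)[OF Z(1)] Z(2)])
    then have zL: "z \<in> L2_L2 T" using is_fourier_x_L2_L2[OF Z(1)] by simp
    have Z1L: "Z1 \<in> L2_L2 T" by (rule L2_L2_if_weighted_inhom[OF half is_fourier_xD(2)[OF z1(2)] z1(3)])
    then have z1L: "z1 \<in> L2_L2 T" using is_fourier_x_L2_L2[OF z1(2)] by simp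
    have dtZ: "is_weak_dt T Zf Z1" using is_weak_dt_fourier_iff[OF Zf z1(2) zL z1L] z1(1) by simp
    have eqw: "AE (t, x) in strip T. weak_dt T z t x = z1 t x"
      by (rule weak_dt_unique[OF weak_dt_is_weak_dt[OF z1(1)] z1(1) AE_strip_refl])
    have eqZ: "AE (t, \<xi>) in strip T. Z2 t \<xi> = Zf t \<xi>" by (rule is_fourier_x_unique[OF Z2(1) Zf AE_strip_refl])
    have hZ: "weighted (hom_weight \<alpha>) Zf \<in> L2_L2 T"
      using L2_L2_cong_AE(1)[OF hm[OF is_fourier_xD(2)[OF Z2(1)]] hm[OF Zfm] weighted_cong_AE[OF eqZ]] Z2(2) by blast
    have sum: "is_fourier_x T (\<lambda>t x. z1 t x + complex_of_real \<kappa> * Lambda T \<alpha> z t x) (\<lambda>t \<xi>. Z1 t \<xi> + complex_of_real \<kappa> * weighted (hom_weight \<alpha>) Zf t \<xi>)"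
      by (rule is_fourier_x_add[OF z1(2) is_fourier_x_cmult[OF Lambda_fourier[OF Zf hZ]]])
    have "AE (t, x) in strip T. z1 t x + complex_of_real \<kappa> * Lambda T \<alpha> z t x = f t x"
      using eqz eqw by eventually_elim auto
    from is_fourier_x_unique[OF sum F this]
    have "AE (t, \<xi>) in strip T. Z1 t \<xi> + complex_of_real (\<kappa> * hom_weight \<alpha> \<xi>) * Zf t \<xi> = F t \<xi>"
      by (simp add: weighted_def mult.assoc)
    moreover have "AE \<xi> in lborel. primitive T (\<lambda>s. Z1 s \<xi>) T = 0"
    proof -
      obtain D where D: "is_continuous_rep T (inhom_weight (\<alpha> / 2)) Zf D" "AE \<xi> in lborel. D 0 \<xi> = D T \<xi>"
        using endz unfolding equal_end_values_def Zf_def by blast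
      have "AE \<xi> in lborel. inhom_weight (\<alpha> / 2) \<xi> \<noteq> 0" using inhom_weight_nonzero by simp
      from equal_ends_primitive_zero[OF T inhom_weight_measurable this D(1) dtZ z1(3) D(2)] show ?thesis .
    qed
    ultimately have "AE (t, \<xi>) in strip T. Zf t \<xi> = A t \<xi>"
      using sol_unique[OF ctx dtZ] unfolding A_def by blast
    then show ?thesis by (rule is_fourier_x_inj[OF Zf u(1)])
  qed
  have real: "AE (t, x) in strip T. u t x \<in> \<real>" if "AE (t, x) in strip T. f t x \<in> \<real>"
    using fourier_sol_real[OF Fm] that is_fourier_x_real[OF F] is_fourier_x_real[OF u(1)] unfolding A_def by blast
  show ?thesis using sol norm unique real by blast
qed

end
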